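(* For each number of agents $N\ge 2$ let an undirected connected communication graph with $N$ nodes and edge set $\mathcal{E}=\mathcal{E}_N$ be given. Let $J_{\mathrm{ET}}(1)$ be the cost under event-triggered control with threshold $\Delta=1$, and $J_{\mathrm{TT}}(\mathbb{E}[T_{\mathrm{ET}}(1)])$ the cost under time-triggered control with constant inter-event time $\mathbb{E}[T_{\mathrm{ET}}(1)]$. Then, as $N\to\infty$, $$J_{\mathrm{ET}}(1)\sim J_{\mathrm{TT}}(\mathbb{E}[T_{\mathrm{ET}}(1)])\sim\frac{|\mathcal{E}|}{4\ln N}.$$
   Context: There are $N$ agents with scalar states $x_i$, $\mathrm{d}x_i=u_i\,\mathrm{d}t+\mathrm{d}v_i$, $x_i(0)=0$, where $v_1,\dots,v_N$ are independent standard Brownian motions started at $0$. The communication graph is undirected and connected, without self-loops, with node set $\{1,\dots,N\}$, edge set $\mathcal{E}\subset\{1,\dots,N\}^2$ consisting of ordered pairs (so $(i,j)\in\mathcal{E}\Leftrightarrow(j,i)\in\mathcal{E}$, and $|\mathcal{E}|$ is twice the number of undirected edges), and Laplacian $L$ (degree matrix minus adjacency matrix). Cost: $J=\limsup_{M\to\infty}\frac1M\int_0^M\mathbb{E}[x(t)^\top L x(t)]\,\mathrm{d}t=\limsup_{M\to\infty}\frac1M\int_0^M\mathbb{E}\big[\tfrac12\sum_{(i,j)\in\mathcal{E}}(x_i(t)-x_j(t))^2\big]\mathrm{d}t$. Triggering instants are $0=t_0<t_1<t_2<\cdots$. Impulsive resetting input (used under both schemes): $u_i(t)=\sum_{k\in\mathbb{N}}\delta(t-t_k)(c_i(t_k)-x_i(t_k))$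 with $\delta$ the Dirac impulse and $c_i(t_k)=c_j(t_k)$ for all $i,j$; that is, at each $t_k$ all agents are instantaneously reset to a common consensus point, and no input is applied between triggering instants, so $x_i(t)=x_i(t_k)+v_i(t)-v_i(t_k)$ for $t\in[t_k,t_{k+1})$, with $x_i(t_k)$ here the common value after the reset. Event-triggered control with threshold $\Delta$: $t_{k+1}=\inf\{t>t_k\mid \exists i: |x_i(t)-x_i(t_k)|\ge\Delta\}$, with $x_i(t_k)$ the value after the reset; $T_{\mathrm{ET}}(\Delta)=t_1=\inf\{t>0\mid\exists i: |v_i(t)|=\Delta\}$; its cost is $J_{\mathrm{ET}}(\Delta)$. Time-triggered control: $t_{k+1}-t_k=T_{\mathrm{TT}}$ constant for all $k\ge0$, with cost $J_{\mathrm{TT}}(T_{\mathrm{TT}})$. All quantities depend implicitly on $N$. For sequences, $a_N\sim b_N$ means $\lim_{N\to\infty}a_N/b_N=1$. *)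

theory Defs
  imports "HOL-Probability.Probability" "HOL-Library.Landau_Symbols"
    "Graph_Theory.Pair_Digraph" "Graph_Theory.Digraph_Component"
begin

text \<open>Time is \<^typ>\<open>real\<close>, and only nonnegative times are constrained. Paths start at 0 and are
  continuous for every outcome, not merely almost surely, so that hitting times are measurable.\<close>

locale standard_brownian_motion = prob_space M for M :: "'a measure" +
  fixes B :: "real \<Rightarrow> 'a \<Rightarrow> real"
  assumes measurable_at: "0 \<le> t \<Longrightarrow> B t \<in> borel_measurable M"
    and start_zero: "\<omega> \<in> space M \<Longrightarrow> B 0 \<omega> = 0"
    and continuous_paths: "\<omega> \<in> space M \<Longrightarrow> continuous_on {0..} (\<lambda>t. B t \<omega>)"
    and gaussian_increments: "0 \<le> s \<Longrightarrow> s < t \<Longrightarrow>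
      distributed M lborel (\<lambda>\<omega>. B t \<omega> - B s \<omega>) (normal_density 0 (sqrt (t - s)))"
    and independent_increments: "0 \<le> \<tau> 0 \<Longrightarrow> (\<And>k. k < n \<Longrightarrow> \<tau> k \<le> \<tau> (Suc k)) \<Longrightarrow>
      indep_vars (\<lambda>_. borel) (\<lambda>k \<omega>. B (\<tau> (Suc k)) \<omega> - B (\<tau> k) \<omega>) {..<n :: nat}"

text \<open>Independence of the family is independence of the path-valued random variables.\<close>

definition independent_brownian_motions ::
  "'a measure \<Rightarrow> 'i set \<Rightarrow> ('i \<Rightarrow> real \<Rightarrow> 'a \<Rightarrow> real) \<Rightarrow> bool" where
  "independent_brownian_motions M I v \<longleftrightarrow>
     prob_space M \<and>
     (\<forall>i\<in>I. standard_brownian_motion M (v i)) \<and>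
     prob_space.indep_vars M (\<lambda>_. PiM {0..} (\<lambda>_. borel)) (\<lambda>i \<omega>. \<lambda>t\<in>{0..}. v i t \<omega>) I"

definition laplacian :: "'i pair_pre_digraph \<Rightarrow> 'i \<Rightarrow> 'i \<Rightarrow> real" where
  "laplacian G i j =
     (if i = j then real (out_degree (with_proj G) i) else 0) - (if (i, j) \<in> parcs G then 1 else 0)"

definition laplacian_form :: "'i pair_pre_digraph \<Rightarrow> ('i \<Rightarrow> real) \<Rightarrow> real" where
  "laplacian_form G x = (\<Sum>i\<in>pverts G. \<Sum>j\<in>pverts G. x i * laplacian G i j * x j)"

lemma laplacian_form_edges:
  assumes "pair_graph G"
  shows "laplacian_form G x = (1/2) * (\<Sum>(i, j)\<in>parcs G. (x i - x j)\<^sup>2)"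
proof -
  interpret pair_graph G by fact
  let ?V = "pverts G" and ?E = "parcs G"
  have fV: "finite ?V" and fE: "finite ?E" by (rule pair_finite_verts, rule pair_finite_arcs)
  have sub: "?E \<subseteq> ?V \<times> ?V" using in_arcsD1 in_arcsD2 by auto
  have swap: "(\<Sum>(i, j)\<in>?E. f j i) = (\<Sum>(i, j)\<in>?E. f i j)" for f :: "'a \<Rightarrow> 'a \<Rightarrow> real"
    by (rule sum.reindex_bij_witness[of _ prod.swap prod.swap])
      (use pair_sym_arcs in \<open>auto simp: symmetric_def sym_def\<close>)
  have deg: "real (out_degree (with_proj G) i) = (\<Sum>j\<in>?V. if (i, j) \<in> ?E then 1 else 0)" for i
  proof -
    have "out_arcs (with_proj G) i = Pair i ` {j\<in>?V. (i, j) \<in> ?E}"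
      using sub by (auto simp: out_arcs_def)
    then have "out_degree (with_proj G) i = card {j\<in>?V. (i, j) \<in> ?E}"
      by (simp add: out_degree_def card_image inj_on_def)
    then show ?thesis using fV by (simp add: sum.If_cases Int_def)
  qed
  have edge_sum: "(\<Sum>i\<in>?V. \<Sum>j\<in>?V. if (i, j) \<in> ?E then f i j else 0) = (\<Sum>(i, j)\<in>?E. f i j)"
    for f :: "'a \<Rightarrow> 'a \<Rightarrow> real"
  proof -
    have "(\<Sum>i\<in>?V. \<Sum>j\<in>?V. if (i, j) \<in> ?E then f i j else 0)
        = (\<Sum>p\<in>?V \<times> ?V. if p \<in> ?E then f (fst p) (snd p) else 0)"
      by (simp add: sum.cartesian_product case_prod_beta)
    also have "\<dots> = (\<Sum>p\<in>?E. f (fst p) (snd p))"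
      using sub fV by (simp add: sum.inter_restrict[symmetric] Int_absorb1)
    finally show ?thesis by (simp add: case_prod_beta)
  qed
  have "laplacian_form G x = (\<Sum>i\<in>?V. (x i)\<^sup>2 * real (out_degree (with_proj G) i))
      - (\<Sum>i\<in>?V. \<Sum>j\<in>?V. if (i, j) \<in> ?E then x i * x j else 0)"
  proof -
    have "(\<Sum>j\<in>?V. x i * laplacian G i j * x j) = (x i)\<^sup>2 * real (out_degree (with_proj G) i)
        - (\<Sum>j\<in>?V. if (i, j) \<in> ?E then x i * x j else 0)" if "i \<in> ?V" for i
    proof -
      have "(\<Sum>j\<in>?V. x i * laplacian G i j * x j)
          = (\<Sum>j\<in>?V. (if i = j then (x i)\<^sup>2 * real (out_degree (with_proj G) i) else 0)
              - (if (i, j) \<in> ?E then x i * x j else 0))"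
        by (rule sum.cong) (auto simp: laplacian_def power2_eq_square algebra_simps)
      then show ?thesis using that fV by (simp add: sum_subtractf)
    qed
    then show ?thesis by (simp add: laplacian_form_def sum_subtractf)
  qed
  also have "\<dots> = (\<Sum>(i, j)\<in>?E. (x i)\<^sup>2) - (\<Sum>(i, j)\<in>?E. x i * x j)"
    by (simp add: deg sum_distrib_left edge_sum[symmetric] if_distrib cong: if_cong)
  also have "\<dots> = (1/2) * ((\<Sum>(i, j)\<in>?E. (x i)\<^sup>2) + (\<Sum>(i, j)\<in>?E. (x j)\<^sup>2)
      - 2 * (\<Sum>(i, j)\<in>?E. x i * x j))"
    using swap[of "\<lambda>i j. (x i)\<^sup>2"] by simp
  also have "\<dots> = (1/2) * (\<Sum>(i, j)\<in>?E. (x i - x j)\<^sup>2)"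
    by (simp add: power2_diff sum.distrib sum_subtractf sum_distrib_left case_prod_beta
        algebra_simps)
  finally show ?thesis .
qed

text \<open>State at time \<open>t\<close> of an agent with noise path \<open>w\<close> that was reset to \<open>a\<close> at time \<open>s \<le> t\<close> and
  has received no input since then.\<close>

definition free_state :: "real \<Rightarrow> real \<Rightarrow> (real \<Rightarrow> real) \<Rightarrow> real \<Rightarrow> real" where
  "free_state a s w t = a + (w t - w s)"

text \<open>Triggering instants \<open>\<tau> k \<omega>\<close> lie in \<^typ>\<open>ennreal\<close>; the infimum of the empty set is \<open>\<infinity>\<close>.
  The process \<open>c\<close> collects the consensus points: \<open>c k \<omega>\<close> is the common value to which all agents
  are reset at \<open>\<tau> k \<omega>\<close>. It is an arbitrary parameter. Since \<open>\<tau> 0 = 0\<close>, the initial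
  state 0 is immediately replaced by \<open>c 0 \<omega>\<close>, where \<open>c 0 \<omega> = 0\<close> is allowed but not required.\<close>

definition closed_loop_state ::
  "('i \<Rightarrow> real \<Rightarrow> 'a \<Rightarrow> real) \<Rightarrow> (nat \<Rightarrow> 'a \<Rightarrow> ennreal) \<Rightarrow> (nat \<Rightarrow> 'a \<Rightarrow> real) \<Rightarrow> 'i \<Rightarrow> real \<Rightarrow> 'a \<Rightarrow> real"
  where
  "closed_loop_state v \<tau> c i t \<omega> =
     (let k = (THE k. \<tau> k \<omega> \<le> ennreal t \<and> ennreal t < \<tau> (Suc k) \<omega>)
      in free_state (c k \<omega>) (enn2real (\<tau> k \<omega>)) (\<lambda>s. v i s \<omega>) t)"

text \<open>The Laplacian form is nonnegative, so both the expectation and the time integral are taken as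
  nonnegative Lebesgue integrals, without integrability side conditions.\<close>

definition consensus_cost ::
  "'a measure \<Rightarrow> 'i pair_pre_digraph \<Rightarrow> ('i \<Rightarrow> real \<Rightarrow> 'a \<Rightarrow> real) \<Rightarrow>
   (nat \<Rightarrow> 'a \<Rightarrow> ennreal) \<Rightarrow> (nat \<Rightarrow> 'a \<Rightarrow> real) \<Rightarrow> ennreal" where
  "consensus_cost M G v \<tau> c =
     Limsup at_top (\<lambda>m :: real.
       (\<integral>\<^sup>+t\<in>{0..m}. (\<integral>\<^sup>+\<omega>. ennreal (laplacian_form G (\<lambda>i. closed_loop_state v \<tau> c i t \<omega>)) \<partial>M) \<partial>lborel)
         / ennreal m)"

text \<open>The threshold is tested on the state before the next reset, i.e. on the uncontrolled evolution
  since \<open>\<tau> k\<close>.\<close>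

primrec event_time ::
  "'i set \<Rightarrow> ('i \<Rightarrow> real \<Rightarrow> 'a \<Rightarrow> real) \<Rightarrow> (nat \<Rightarrow> 'a \<Rightarrow> real) \<Rightarrow> real \<Rightarrow> nat \<Rightarrow> 'a \<Rightarrow> ennreal" where
  "event_time I v c \<Delta> 0 \<omega> = 0"
| "event_time I v c \<Delta> (Suc k) \<omega> =
     Inf {ennreal t | t. 0 \<le> t \<and> event_time I v c \<Delta> k \<omega> < ennreal t \<and>
       (\<exists>i\<in>I. \<bar>free_state (c k \<omega>) (enn2real (event_time I v c \<Delta> k \<omega>)) (\<lambda>s. v i s \<omega>) t - c k \<omega>\<bar> \<ge> \<Delta>)}"

definition J_ET ::
  "'a measure \<Rightarrow> 'i pair_pre_digraph \<Rightarrow> ('i \<Rightarrow> real \<Rightarrow> 'a \<Rightarrow> real) \<Rightarrow> (nat \<Rightarrow> 'a \<Rightarrow> real) \<Rightarrow>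
   real \<Rightarrow> ennreal" where
  "J_ET M G v c \<Delta> = consensus_cost M G v (event_time (pverts G) v c \<Delta>) c"

definition J_TT ::
  "'a measure \<Rightarrow> 'i pair_pre_digraph \<Rightarrow> ('i \<Rightarrow> real \<Rightarrow> 'a \<Rightarrow> real) \<Rightarrow> (nat \<Rightarrow> 'a \<Rightarrow> real) \<Rightarrow>
   real \<Rightarrow> ennreal" where
  "J_TT M G v c T = consensus_cost M G v (\<lambda>k \<omega>. ennreal (real k * T)) c"

definition T_ET :: "'i set \<Rightarrow> ('i \<Rightarrow> real \<Rightarrow> 'a \<Rightarrow> real) \<Rightarrow> real \<Rightarrow> 'a \<Rightarrow> ennreal" where
  "T_ET I v \<Delta> \<omega> = Inf {ennreal t | t. 0 < t \<and> (\<exists>i\<in>I. \<bar>v i t \<omega>\<bar> = \<Delta>)}"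

definition mean_T_ET :: "'a measure \<Rightarrow> 'i set \<Rightarrow> ('i \<Rightarrow> real \<Rightarrow> 'a \<Rightarrow> real) \<Rightarrow> real \<Rightarrow> ennreal" where
  "mean_T_ET M I v \<Delta> = (\<integral>\<^sup>+\<omega>. T_ET I v \<Delta> \<omega> \<partial>M)"

lemma event_time_1_eq_T_ET:
  assumes bm: "\<And>i. i \<in> I \<Longrightarrow> standard_brownian_motion M (v i)"
    and \<omega>: "\<omega> \<in> space M" and \<Delta>: "0 < \<Delta>"
  shows "event_time I v c \<Delta> 1 \<omega> = T_ET I v \<Delta> \<omega>"
proof (rule antisym)
  have v0: "v i 0 \<omega> = 0" and cont: "continuous_on {0..} (\<lambda>t. v i t \<omega>)" if "i \<in> I" for i
    using standard_brownian_motion.start_zero[OF bm[OF that] \<omega>]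
      standard_brownian_motion.continuous_paths[OF bm[OF that] \<omega>] by auto
  have et: "event_time I v c \<Delta> 1 \<omega> = Inf {ennreal t | t. 0 < t \<and> (\<exists>i\<in>I. \<bar>v i t \<omega>\<bar> \<ge> \<Delta>)}"
    unfolding One_nat_def event_time.simps
    by (rule arg_cong[of _ _ Inf]) (use v0 in \<open>force simp: free_state_def ennreal_less_zero_iff\<close>)
  show "event_time I v c \<Delta> 1 \<omega> \<le> T_ET I v \<Delta> \<omega>"
    unfolding et T_ET_def by (rule Inf_superset_mono) force
  show "T_ET I v \<Delta> \<omega> \<le> event_time I v c \<Delta> 1 \<omega>"
    unfolding et
  proof (rule Inf_greatest, clarify)
    fix t i assume t: "0 < t" and i: "i \<in> I" and ge: "\<Delta> \<le> \<bar>v i t \<omega>\<bar>"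
    have "continuous_on {0..t} (\<lambda>s. \<bar>v i s \<omega>\<bar>)"
      by (intro continuous_intros continuous_on_subset[OF cont[OF i]]) auto
    then obtain s where s: "0 \<le> s" "s \<le> t" "\<bar>v i s \<omega>\<bar> = \<Delta>"
      using IVT'[of "\<lambda>s. \<bar>v i s \<omega>\<bar>" 0 \<Delta> t] v0[OF i] ge t \<Delta> by auto
    with v0[OF i] \<Delta> have "s \<noteq> 0" by auto
    with s i have "T_ET I v \<Delta> \<omega> \<le> ennreal s"
      unfolding T_ET_def by (intro Inf_lower) force
    also have "\<dots> \<le> ennreal t" using s by (simp add: ennreal_leI)
    finally show "T_ET I v \<Delta> \<omega> \<le> ennreal t" .
  qed
qed

end

theory Submission
  imports Defs "HOL-Real_Asymp.Real_Asymp"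
begin

text \<open>By the strong Markov property, the cycles between consecutive events are independent copies of
  the first one, so a renewal-reward argument turns the event-triggered cost into the mean cost of
  the first cycle \<open>[0, T]\<close> divided by the mean of \<open>T\<close>. The time-triggered cost with period \<open>a\<close> is exactly
  \<open>a / 2\<close> per ordered edge. The first exit time \<open>T\<close> is the minimum of \<open>N\<close> independent exit times with
  Gaussian tails and hence concentrates at \<open>h = 1 / (2 ln N)\<close>. During the first cycle half the squared
  difference along an edge accumulates about \<open>\<integral> t dt = h\<^sup>2 / 2\<close> over \<open>[0, h]\<close>, uniformly over the edges,
  so both costs are asymptotic to \<open>h / 2\<close> per ordered edge.\<close>

section \<open>Event times of deterministic paths\<close>

text \<open>The scale \<open>h\<close> comes from the Gaussian tail: an agent is beyond the
  threshold at time \<open>s\<close> with probability roughly \<open>exp (- 1 / (2 * s))\<close>,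
  and \<open>N\<close> times this is of order one at \<open>s = 1 / (2 ln N)\<close>. The cost is a
  limsup of expectations, so the renewal argument is run in expectation, by an identity of Wald type
  for each cycle. The obstacle is the cycle in progress at the horizon, which is biased towards long
  cycles: its excess is cut at a fixed length \<open>a\<close>, and what lies beyond is a small
  fraction of the number of cycles. The exit time is not independent of the difference along an
  edge, since the two agents may trigger it themselves; the loss caused by early exits is therefore
  bounded through a fourth moment. Since the cost of a cycle is of order \<open>h\<^sup>2\<close>,
  concentration in probability is too weak: the mean time spent in the cycle after
  \<open>(1 + \<epsilon>) h\<close> has to be small against \<open>h\<^sup>2\<close>.\<close>

lemma ennreal_eqI_less:
  fixes a b :: ennreal
  assumes "\<And>u. 0 \<le> u \<Longrightarrow> ennreal u < a \<longleftrightarrow> ennreal u < b"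
  shows "a = b"
proof -
  have "a \<le> b" if *: "\<And>u. 0 \<le> u \<Longrightarrow> ennreal u < a \<Longrightarrow> ennreal u < b" for a b :: ennreal
  proof (rule ccontr)
    assume "\<not> a \<le> b"
    then obtain z where z: "b < z" "z < a" using dense[of b a] by (auto simp: not_le)
    then obtain u where "0 \<le> u" "z = ennreal u" by (cases z) auto
    with z *[of u] show False by auto
  qed
  from this[of a b] this[of b a] assms show ?thesis by (auto intro: antisym)
qed

text \<open>The event times with the consensus points cancelled: the trigger condition involves only
  the deviation from the reset value, so the times depend on the noise paths alone. If one time is
  infinite, the next set is empty, and the value 0 of \<open>enn2real\<close> at infinity does no
  harm.\<close>

primrec reset_time :: "'i set \<Rightarrow> ('i \<Rightarrow> real \<Rightarrow> real) \<Rightarrow> nat \<Rightarrow> ennreal" where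
  "reset_time I w 0 = 0"
| "reset_time I w (Suc k) = Inf {ennreal t | t. 0 \<le> t \<and> reset_time I w k < ennreal t \<and>
     (\<exists>i\<in>I. 1 \<le> \<bar>w i t - w i (enn2real (reset_time I w k))\<bar>)}"

lemma event_time_eq_reset_time: "event_time I v c 1 k \<omega> = reset_time I (\<lambda>i t. v i t \<omega>) k"
  by (induction k) (simp_all add: free_state_def)

definition shift :: "real \<Rightarrow> ('i \<Rightarrow> real \<Rightarrow> real) \<Rightarrow> 'i \<Rightarrow> real \<Rightarrow> real" where
  "shift s w i u = w i (s + u) - w i s"

text \<open>Only rational times occur, which makes the definition measurable on the full product space. It
  is the first time a path leaves the open unit cube only if the path is continuous.\<close>

definition exit_time :: "'i set \<Rightarrow> ('i \<Rightarrow> real \<Rightarrow> real) \<Rightarrow> ennreal" where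
  "exit_time I w = (SUP n::nat. INF q::rat.
     if 0 \<le> q \<and> (\<exists>i\<in>I. 1 - 1 / Suc n < \<bar>w i (of_rat q)\<bar>) then ennreal (of_rat q) else \<infinity>)"

definition paths :: "'i set \<Rightarrow> ('i \<Rightarrow> real \<Rightarrow> real) set" where
  "paths I = {w. \<forall>i\<in>I. continuous_on {0..} (w i)}"

lemma shift_paths: "w \<in> paths I \<Longrightarrow> 0 \<le> s \<Longrightarrow> shift s w \<in> paths I"
  unfolding paths_def shift_def
proof safe
  fix i assume *: "\<forall>i\<in>I. continuous_on {0..} (w i)" "i \<in> I" "0 \<le> s"
  then have "continuous_on {0..} (\<lambda>u. w i (s + u))"
    by (intro continuous_on_compose2[of "{0..}" "w i" "{0..}" "\<lambda>u. s + u"] continuous_intros) auto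
  then show "continuous_on {0..} (\<lambda>u. w i (s + u) - w i s)" by (intro continuous_intros)
qed

lemma continuous_on_pathD:
  fixes f :: "real \<Rightarrow> real"
  assumes "continuous_on {0..} f" "0 \<le> u" "0 < e"
  obtains d where "0 < d" "\<And>s. 0 \<le> s \<Longrightarrow> \<bar>s - u\<bar> < d \<Longrightarrow> \<bar>f s - f u\<bar> < e"
  using assms(1)[unfolded continuous_on_iff, rule_format, of u e] assms(2,3)
  by (auto simp: dist_real_def)

text \<open>Finitely many agents share one \<open>\<delta>\<close>. This margin to the right of
  \<open>u\<close> is what turns bounds on a closed time interval into a strict inequality for a
  hitting time.\<close>

lemma paths_right_open:
  assumes "finite I" "w \<in> paths I" "0 \<le> u" and less: "\<And>i. i \<in> I \<Longrightarrow> \<bar>w i u\<bar> < r"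
  shows "\<exists>\<delta>>0. \<forall>i\<in>I. \<forall>s\<in>{u..u + \<delta>}. \<bar>w i s\<bar> < r"
proof -
  have "\<exists>\<delta>>0. \<forall>s\<in>{u..u + \<delta>}. \<bar>w i s\<bar> < r" if i: "i \<in> I" for i
  proof -
    have c: "continuous_on {0..} (\<lambda>s. \<bar>w i s\<bar>)"
      using assms(2) i by (auto simp: paths_def intro!: continuous_intros)
    have "0 < r - \<bar>w i u\<bar>" using less[OF i] by simp
    then obtain d where d: "d > 0"
      "\<And>s. 0 \<le> s \<Longrightarrow> \<bar>s - u\<bar> < d \<Longrightarrow> \<bar>\<bar>w i s\<bar> - \<bar>w i u\<bar>\<bar> < r - \<bar>w i u\<bar>"
      using continuous_on_pathD[OF c assms(3)] by blast
    have "\<bar>w i s\<bar> < r" if "s \<in> {u..u + d/2}" for s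
      using d(2)[of s] that assms(3) d(1) by auto
    with d(1) show ?thesis by (intro exI[of _ "d/2"]) auto
  qed
  then obtain \<delta> where \<delta>: "\<And>i. i \<in> I \<Longrightarrow> \<delta> i > 0 \<and> (\<forall>s\<in>{u..u + \<delta> i}. \<bar>w i s\<bar> < r)" by metis
  show ?thesis
  proof (cases "I = {}")
    case False
    have "Min (\<delta> ` I) > 0" using \<delta> assms(1) False by auto
    moreover have "Min (\<delta> ` I) \<le> \<delta> i" if "i \<in> I" for i using that assms(1) by auto
    ultimately show ?thesis using \<delta> by (intro exI[of _ "Min (\<delta> ` I)"]) force
  qed (auto intro: exI[of _ 1])
qed

text \<open>A path may touch the level 1 at a single irrational time, so rational times can only
  detect that lower levels are exceeded. Those are exceeded at rational times by continuity, and the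
  hitting times of the levels \<open>1 - 1 / Suc n\<close> have the hitting time of 1 as their
  supremum.\<close>

lemma less_exit_time_iff:
  assumes fin: "finite I" and w: "w \<in> paths I" and u: "0 \<le> u"
  shows "ennreal u < exit_time I w \<longleftrightarrow> (\<forall>i\<in>I. \<forall>s\<in>{0..u}. \<bar>w i s\<bar> < 1)"
proof
  let ?D = "\<lambda>n::nat. INF q::rat. if 0 \<le> q \<and> (\<exists>i\<in>I. 1 - 1 / Suc n < \<bar>w i (of_rat q)\<bar>)
      then ennreal (of_rat q) else \<infinity>"
  assume "ennreal u < exit_time I w"
  then obtain n where n: "ennreal u < ?D n" unfolding exit_time_def less_SUP_iff by auto
  \<comment> \<open>The room between \<open>u\<close> and \<open>b\<close> is needed for
    \<open>s = u\<close>, because the approximating rational is taken to the right of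
    \<open>s\<close>.\<close>
  then obtain y where y: "ennreal u < y" "y < ?D n" using dense by blast
  then obtain b where b: "y = ennreal b" "u < b" using u
    by (cases y) (auto simp: ennreal_less_iff)
  have q: "\<bar>w i (of_rat q)\<bar> \<le> 1 - 1 / Suc n" if "i \<in> I" "0 \<le> q" "of_rat q < b" for i q
  proof (rule ccontr)
    assume "\<not> ?thesis"
    then have "?D n \<le> ennreal (of_rat q)"
      by (intro INF_lower2[of q]) (use that in auto)
    also have "\<dots> < y" unfolding b using that by (simp add: ennreal_less_iff zero_le_of_rat_iff)
    finally show False using y by simp
  qed
  show "\<forall>i\<in>I. \<forall>s\<in>{0..u}. \<bar>w i s\<bar> < 1"
  proof safe
    fix i s assume i: "i \<in> I" and s: "s \<in> {0..u}"
    show "\<bar>w i s\<bar> < 1"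
    proof (rule ccontr)
      assume ge: "\<not> \<bar>w i s\<bar> < 1"
      have "continuous_on {0..} (\<lambda>s. \<bar>w i s\<bar>)"
        using w i by (auto simp: paths_def intro!: continuous_intros)
      moreover have "0 \<le> s" "(0::real) < 1 / Suc n" using s by auto
      ultimately obtain d where d: "d > 0"
        "\<And>t. 0 \<le> t \<Longrightarrow> \<bar>t - s\<bar> < d \<Longrightarrow> \<bar>\<bar>w i t\<bar> - \<bar>w i s\<bar>\<bar> < 1 / Suc n"
        using continuous_on_pathD[of "\<lambda>s. \<bar>w i s\<bar>" s "1 / Suc n"] by blast
      have "s < min b (s + d)" using s b d by auto
      then obtain q where q': "s < of_rat q" "of_rat q < min b (s + d)" using of_rat_dense by blast
      have "0 \<le> (of_rat q :: real)" using q'(1) s by (simp del: zero_le_of_rat_iff)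
      then have "0 \<le> q" by (simp only: zero_le_of_rat_iff)
      have "\<bar>w i (of_rat q)\<bar> \<le> 1 - 1 / Suc n" by (rule q) (use i \<open>0 \<le> q\<close> q' in auto)
      moreover have "\<bar>\<bar>w i (of_rat q)\<bar> - \<bar>w i s\<bar>\<bar> < 1 / Suc n"
        by (rule d) (use s q' \<open>0 \<le> q\<close> in auto)
      ultimately show False using ge by linarith
    qed
  qed
next
  assume *: "\<forall>i\<in>I. \<forall>s\<in>{0..u}. \<bar>w i s\<bar> < 1"
  have "\<exists>m<1. \<forall>s\<in>{0..u}. \<bar>w i s\<bar> \<le> m" if i: "i \<in> I" for i
  proof -
    have "continuous_on {0..u} (\<lambda>s. \<bar>w i s\<bar>)"
      using w i by (auto simp: paths_def intro!: continuous_intros intro: continuous_on_subset)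
    then obtain t where "t \<in> {0..u}" "\<forall>s\<in>{0..u}. \<bar>w i s\<bar> \<le> \<bar>w i t\<bar>"
      using continuous_attains_sup[of "{0..u}" "\<lambda>s. \<bar>w i s\<bar>"] u by auto
    with * i show ?thesis by blast
  qed
  then obtain m where m: "\<And>i. i \<in> I \<Longrightarrow> m i < 1 \<and> (\<forall>s\<in>{0..u}. \<bar>w i s\<bar> \<le> m i)" by metis
  \<comment> \<open>A level strictly between all maxima and 1 leaves room both for the margin
    \<open>\<delta>\<close> after \<open>u\<close> and for some level \<open>1 - 1 / Suc n\<close>
    above it.\<close>
  have "\<exists>m'<1. \<forall>i\<in>I. m i < m'"
  proof (cases "I = {}")
    case False
    then have "Max (m ` I) < 1" using fin m by simp
    then obtain m' where "Max (m ` I) < m'" "m' < 1" using dense by blast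
    moreover have "m i \<le> Max (m ` I)" if "i \<in> I" for i using that fin by simp
    ultimately show ?thesis by force
  qed (auto intro: exI[of _ 0])
  then obtain m' where m': "m' < 1" "\<And>i. i \<in> I \<Longrightarrow> m i < m'" by blast
  have less: "\<bar>w i s\<bar> < m'" if "i \<in> I" "s \<in> {0..u}" for i s
    using m[OF that(1)] m'(2)[OF that(1)] that(2) by force
  obtain \<delta> where \<delta>: "\<delta> > 0" "\<forall>i\<in>I. \<forall>s\<in>{u..u + \<delta>}. \<bar>w i s\<bar> < m'"
    using paths_right_open[OF fin w u, of m'] less u by auto
  obtain n where n: "1 / Suc n < 1 - m'" using nat_approx_posE[of "1 - m'"] m'(1) by auto
  have "ennreal u < ennreal (u + \<delta>)" using \<delta> u by (simp add: ennreal_less_iff)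
  also have "\<dots> \<le> (INF q::rat. if 0 \<le> q \<and> (\<exists>i\<in>I. 1 - 1 / Suc n < \<bar>w i (of_rat q)\<bar>)
      then ennreal (of_rat q) else \<infinity>)"
  proof (rule INF_greatest)
    fix q :: rat
    have "ennreal (u + \<delta>) \<le> ennreal (of_rat q)"
      if "0 \<le> q" "i \<in> I" "1 - 1 / Suc n < \<bar>w i (of_rat q)\<bar>" for i
    proof (rule ennreal_leI, rule ccontr)
      assume "\<not> u + \<delta> \<le> of_rat q"
      moreover have "0 \<le> (of_rat q :: real)" using that(1) by (simp add: zero_le_of_rat_iff)
      ultimately have "\<bar>w i (of_rat q)\<bar> < m'"
        using less[OF that(2), of "of_rat q"] \<delta>(2) that(2) by (cases "of_rat q \<le> u") auto
      with that(3) n show False by linarith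
    qed
    then show "ennreal (u + \<delta>) \<le> (if 0 \<le> q \<and> (\<exists>i\<in>I. 1 - 1 / Suc n < \<bar>w i (of_rat q)\<bar>)
      then ennreal (of_rat q) else \<infinity>)" by auto
  qed
  also have "\<dots> \<le> exit_time I w" unfolding exit_time_def by (rule SUP_upper) simp
  finally show "ennreal u < exit_time I w" .
qed

text \<open>The deviation vanishes at \<open>\<sigma>\<close>, so excluding \<open>\<sigma>\<close>
  from the infimum loses nothing. Conversely, the strict bound persists a little beyond
  \<open>t\<close>, which makes the inequality of times strict.\<close>

lemma less_reset_time_Suc_iff:
  assumes fin: "finite I" and w: "w \<in> paths I" and \<sigma>: "0 \<le> \<sigma>" "reset_time I w k = ennreal \<sigma>"
    and t: "\<sigma> \<le> t"
  shows "ennreal t < reset_time I w (Suc k) \<longleftrightarrow> (\<forall>i\<in>I. \<forall>s\<in>{\<sigma>..t}. \<bar>w i s - w i \<sigma>\<bar> < 1)"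
proof
  assume l: "ennreal t < reset_time I w (Suc k)"
  show "\<forall>i\<in>I. \<forall>s\<in>{\<sigma>..t}. \<bar>w i s - w i \<sigma>\<bar> < 1"
  proof (safe, rule ccontr)
    fix i s assume i: "i \<in> I" "s \<in> {\<sigma>..t}" and ge: "\<not> \<bar>w i s - w i \<sigma>\<bar> < 1"
    then have "s \<noteq> \<sigma>" by auto
    moreover have "1 \<le> \<bar>w i s - w i \<sigma>\<bar>" using ge by simp
    ultimately have "reset_time I w (Suc k) \<le> ennreal s"
      using i(1,2) \<sigma> by (auto intro!: Inf_lower exI[of _ s] bexI[of _ i] simp: ennreal_less_iff)
    also have "\<dots> \<le> ennreal t" using i by (auto intro: ennreal_leI)
    finally show False using l by simp
  qed
next
  assume *: "\<forall>i\<in>I. \<forall>s\<in>{\<sigma>..t}. \<bar>w i s - w i \<sigma>\<bar> < 1"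
  have "shift \<sigma> w \<in> paths I" using w \<sigma> by (intro shift_paths)
  then obtain \<delta> where \<delta>: "\<delta> > 0" "\<forall>i\<in>I. \<forall>s\<in>{t - \<sigma>..t - \<sigma> + \<delta>}. \<bar>shift \<sigma> w i s\<bar> < 1"
    using paths_right_open[OF fin, of "shift \<sigma> w" "t - \<sigma>" 1] * t by (auto simp: shift_def)
  have less: "\<bar>w i s - w i \<sigma>\<bar> < 1" if "i \<in> I" "s \<in> {\<sigma>..t + \<delta>}" for i s
    using * \<delta>(2)[rule_format, OF that(1), of "s - \<sigma>"] that
    by (cases "s \<le> t") (auto simp: shift_def)
  have "ennreal t < ennreal (t + \<delta>)" using \<delta> \<sigma> t by (simp add: ennreal_less_iff)
  also have "\<dots> \<le> reset_time I w (Suc k)"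
    unfolding reset_time.simps
  proof (rule Inf_greatest, clarify)
    fix s i assume s: "0 \<le> s" "reset_time I w k < ennreal s" "i \<in> I"
      and ge: "1 \<le> \<bar>w i s - w i (enn2real (reset_time I w k))\<bar>"
    have "\<sigma> < s" using s \<sigma> by (simp add: ennreal_less_iff)
    with less[OF s(3), of s] ge \<sigma> show "ennreal (t + \<delta>) \<le> ennreal s"
      by (intro ennreal_leI) (cases "s \<le> t + \<delta>", auto)
  qed
  finally show "ennreal t < reset_time I w (Suc k)" .
qed

lemma reset_time_mono: "reset_time I w k \<le> reset_time I w (Suc k)"
  by (auto intro!: Inf_greatest)

lemma reset_time_incseq: "j \<le> k \<Longrightarrow> reset_time I w j \<le> reset_time I w k"
  by (rule lift_Suc_mono_le[where f="reset_time I w", OF reset_time_mono])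

lemma reset_time_Suc_top: "reset_time I w k = \<infinity> \<Longrightarrow> reset_time I w (Suc k) = \<infinity>"
  using reset_time_mono[of I w k] by (simp add: top_unique)

lemma less_reset_time_Suc_iff_exit_time:
  assumes "finite I" "w \<in> paths I" "0 \<le> \<sigma>" "reset_time I w k = ennreal \<sigma>" "\<sigma> \<le> t"
  shows "ennreal t < reset_time I w (Suc k) \<longleftrightarrow> ennreal (t - \<sigma>) < exit_time I (shift \<sigma> w)"
proof -
  have "(\<forall>s\<in>{\<sigma>..t}. P s) \<longleftrightarrow> (\<forall>s\<in>{0..t - \<sigma>}. P (\<sigma> + s))" for P
  proof safe
    fix s assume "\<forall>s\<in>{0..t - \<sigma>}. P (\<sigma> + s)" "s \<in> {\<sigma>..t}"
    then show "P s" using bspec[of "{0..t - \<sigma>}" "\<lambda>s. P (\<sigma> + s)" "s - \<sigma>"] by auto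
  qed auto
  then show ?thesis
    unfolding less_reset_time_Suc_iff[OF assms] using assms
    by (subst less_exit_time_iff[OF assms(1) shift_paths]) (auto simp: shift_def)
qed

text \<open>The deterministic half of the renewal structure: the length of a cycle is one fixed
  functional of the path restarted at the beginning of that cycle.\<close>

lemma reset_time_Suc:
  assumes "finite I" "w \<in> paths I" "0 \<le> \<sigma>" "reset_time I w k = ennreal \<sigma>"
  shows "reset_time I w (Suc k) = ennreal \<sigma> + exit_time I (shift \<sigma> w)"
proof (rule ennreal_eqI_less)
  fix u :: real assume u: "0 \<le> u"
  show "ennreal u < reset_time I w (Suc k) \<longleftrightarrow> ennreal u < ennreal \<sigma> + exit_time I (shift \<sigma> w)"
  proof (cases "\<sigma> \<le> u")
    case True
    have "ennreal u < ennreal \<sigma> + exit_time I (shift \<sigma> w) \<longleftrightarrow>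
        ennreal \<sigma> + ennreal (u - \<sigma>) < ennreal \<sigma> + exit_time I (shift \<sigma> w)"
      using True assms(3) by (simp flip: ennreal_plus)
    also have "\<dots> \<longleftrightarrow> ennreal (u - \<sigma>) < exit_time I (shift \<sigma> w)"
      by (simp add: ennreal_add_left_cancel_less)
    finally show ?thesis using less_reset_time_Suc_iff_exit_time[OF assms True] by simp
  next
    case False
    then have "ennreal u < ennreal \<sigma>" using u by (simp add: ennreal_less_iff)
    moreover have "ennreal \<sigma> \<le> reset_time I w (Suc k)" using reset_time_mono[of I w k] assms by simp
    moreover have "ennreal \<sigma> \<le> ennreal \<sigma> + exit_time I (shift \<sigma> w)" by simp
    ultimately show ?thesis by (meson order.strict_trans2)
  qed
qed

text \<open>Excludes accumulation of events: uniform continuity up to \<open>t + 1\<close> gives one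
  \<open>\<delta>\<close> such that every cycle begun by time \<open>t\<close> lasts longer than
  \<open>\<delta>\<close>. Hence every time lies in some cycle.\<close>

lemma reset_time_not_bounded:
  assumes fin: "finite I" and w: "w \<in> paths I" and t: "0 \<le> t"
  shows "\<exists>k. ennreal t < reset_time I w k"
proof -
  have "\<exists>\<delta>>0. \<forall>s\<in>{0..t + 1}. \<forall>s'\<in>{0..t + 1}. \<bar>s - s'\<bar> < \<delta> \<longrightarrow> \<bar>w i s - w i s'\<bar> < 1"
    if "i \<in> I" for i
  proof -
    have "uniformly_continuous_on {0..t + 1} (w i)"
      using w that by (intro compact_uniformly_continuous)
        (auto simp: paths_def intro: continuous_on_subset)
    then show ?thesis unfolding uniformly_continuous_on_def
      by (auto simp: dist_real_def abs_minus_commute dest!: spec[of _ 1])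
  qed
  then obtain d where d: "\<And>i. i \<in> I \<Longrightarrow> d i > 0 \<and>
      (\<forall>s\<in>{0..t + 1}. \<forall>s'\<in>{0..t + 1}. \<bar>s - s'\<bar> < d i \<longrightarrow> \<bar>w i s - w i s'\<bar> < 1)" by metis
  \<comment> \<open>Halving makes \<open>\<delta>\<close> strictly smaller than every modulus;
    inserting 1 keeps \<open>\<sigma> + \<delta>\<close> below \<open>t + 1\<close> and covers an
    empty index set.\<close>
  define \<delta> where "\<delta> = Min (insert 1 (d ` I)) / 2"
  have \<delta>: "\<delta> > 0" "\<delta> < 1" and \<delta>d: "\<And>i. i \<in> I \<Longrightarrow> \<delta> < d i"
  proof -
    have *: "Min (insert 1 (d ` I)) > 0" "Min (insert 1 (d ` I)) \<le> 1"
      "\<And>i. i \<in> I \<Longrightarrow> Min (insert 1 (d ` I)) \<le> d i" using fin d by auto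
    then show "\<delta> > 0" "\<delta> < 1" "\<And>i. i \<in> I \<Longrightarrow> \<delta> < d i" unfolding \<delta>_def by (force, force, force)
  qed
  have "ennreal t < reset_time I w k \<or> ennreal (k * \<delta>) \<le> reset_time I w k" for k
  proof (induction k)
    case (Suc k)
    show ?case
    proof (cases "ennreal t < reset_time I w k")
      case True
      then show ?thesis using reset_time_mono[of I w k] by (meson order.strict_trans2)
    next
      case False
      then obtain \<sigma> where \<sigma>: "0 \<le> \<sigma>" "reset_time I w k = ennreal \<sigma>"
        by (cases "reset_time I w k") (auto simp: not_less top_unique)
      with False t have st: "\<sigma> \<le> t" by (simp add: not_less)
      have "ennreal (k * \<delta>) \<le> ennreal \<sigma>" using Suc False \<sigma> by auto
      then have k: "k * \<delta> \<le> \<sigma>" using \<sigma> by simp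
      have "ennreal (\<sigma> + \<delta>) < reset_time I w (Suc k)"
      proof (subst less_reset_time_Suc_iff[OF fin w \<sigma>])
        show "\<forall>i\<in>I. \<forall>s\<in>{\<sigma>..\<sigma> + \<delta>}. \<bar>w i s - w i \<sigma>\<bar> < 1"
        proof safe
          fix i s assume "i \<in> I" "s \<in> {\<sigma>..\<sigma> + \<delta>}"
          then show "\<bar>w i s - w i \<sigma>\<bar> < 1"
            using d[of i] \<delta> \<delta>d[of i] \<sigma> st by auto
        qed
      qed (use \<delta> in auto)
      moreover have "ennreal (Suc k * \<delta>) \<le> ennreal (\<sigma> + \<delta>)"
        using k by (intro ennreal_leI) (simp add: algebra_simps)
      ultimately show ?thesis by auto
    qed
  qed auto
  moreover obtain k where "t < real k * \<delta>" using \<delta> ex_less_of_nat_mult by blast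
  then have "ennreal t < ennreal (k * \<delta>)" using t by (simp add: ennreal_less_iff)
  ultimately show ?thesis by (meson order.strict_trans2)
qed

lemma reset_time_unique_index:
  assumes "reset_time I w j \<le> ennreal t" "ennreal t < reset_time I w (Suc j)"
    and "reset_time I w k \<le> ennreal t" "ennreal t < reset_time I w (Suc k)"
  shows "j = k"
proof (rule ccontr)
  assume "j \<noteq> k"
  then consider "Suc j \<le> k" | "Suc k \<le> j" by linarith
  then show False
  proof cases
    case 1
    with reset_time_incseq[OF this, of I w] assms show ?thesis by simp
  next
    case 2
    with reset_time_incseq[OF this, of I w] assms show ?thesis by simp
  qed
qed

lemma reset_time_exists_index:
  assumes "finite I" "w \<in> paths I" "0 \<le> t"
  shows "\<exists>k. reset_time I w k \<le> ennreal t \<and> ennreal t < reset_time I w (Suc k)"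
proof -
  obtain k where "ennreal t < reset_time I w k" using reset_time_not_bounded[OF assms] by blast
  then have *: "ennreal t < reset_time I w (LEAST k. ennreal t < reset_time I w k)" by (rule LeastI)
  define n where "n = (LEAST k. ennreal t < reset_time I w k)"
  have "n \<noteq> 0" using * unfolding n_def[symmetric] by (intro notI) simp
  then obtain m where m: "n = Suc m" by (cases n) auto
  have "\<not> ennreal t < reset_time I w m" using not_less_Least[of m "\<lambda>k. ennreal t < reset_time I w k"] m n_def by simp
  with * m n_def show ?thesis by (auto simp: not_less)
qed

text \<open>Nonanticipation, by induction on the event: the previous event times are either both
  beyond \<open>t\<close>, or both at most \<open>t\<close> and then equal, after which the same
  increments decide.\<close>

lemma reset_time_local:
  assumes fin: "finite I" and w: "w \<in> paths I" "w' \<in> paths I"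
    and eq: "\<And>i s. i \<in> I \<Longrightarrow> 0 \<le> s \<Longrightarrow> s \<le> u \<Longrightarrow> w i s = w' i s" and t: "0 \<le> t" "t \<le> u"
  shows "ennreal t < reset_time I w k \<longleftrightarrow> ennreal t < reset_time I w' k"
  using t
proof (induction k arbitrary: t)
  case (Suc k)
  show ?case
  proof (cases "ennreal t < reset_time I w k")
    case True
    with Suc.IH[of t] Suc.prems have "ennreal t < reset_time I w' k" by simp
    with True show ?thesis
      using reset_time_mono[of I w k] reset_time_mono[of I w' k] by (meson order.strict_trans2)
  next
    case False
    with Suc.IH[of t] Suc.prems have F': "\<not> ennreal t < reset_time I w' k" by simp
    from False obtain \<sigma> where \<sigma>: "0 \<le> \<sigma>" "reset_time I w k = ennreal \<sigma>" "\<sigma> \<le> t"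
      using Suc.prems(1) by (cases "reset_time I w k") (auto simp: not_less top_unique)
    from F' obtain \<sigma>' where \<sigma>': "0 \<le> \<sigma>'" "reset_time I w' k = ennreal \<sigma>'" "\<sigma>' \<le> t"
      using Suc.prems(1) by (cases "reset_time I w' k") (auto simp: not_less top_unique)
    \<comment> \<open>The induction hypothesis at the time \<open>\<sigma>\<close> excludes
      \<open>\<sigma> < \<sigma>'\<close>, and at the time \<open>\<sigma>'\<close> it excludes the
      converse.\<close>
    have "\<sigma> = \<sigma>'"
      using Suc.IH[of \<sigma>] Suc.IH[of \<sigma>'] \<sigma> \<sigma>' Suc.prems by (auto simp: ennreal_less_iff)
    then show ?thesis
      using less_reset_time_Suc_iff[OF fin w(1) \<sigma>] less_reset_time_Suc_iff[OF fin w(2) \<sigma>'] eq \<sigma> \<sigma>' Suc.prems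
      by auto
  qed
qed simp

section \<open>Measurability\<close>

lemma reset_time_local_below:
  assumes fin: "finite I" and w: "w \<in> paths I" "w' \<in> paths I"
    and eq: "\<And>i s. i \<in> I \<Longrightarrow> 0 \<le> s \<Longrightarrow> s \<le> u \<Longrightarrow> w i s = w' i s"
    and less: "reset_time I w k < ennreal u"
  shows "reset_time I w' k = reset_time I w k"
proof -
  obtain t where t: "0 \<le> t" "reset_time I w k = ennreal t" "t < u"
    using less by (cases "reset_time I w k") (auto simp: ennreal_less_iff)
  have "reset_time I w' k \<le> ennreal t"
    using reset_time_local[OF fin w eq t(1), of u k] t by (simp add: not_less[symmetric])
  then obtain t' where t': "0 \<le> t'" "reset_time I w' k = ennreal t'" "t' \<le> t"
    using t(1) by (cases "reset_time I w' k") (auto simp: top_unique)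
  have "\<not> ennreal t' < reset_time I w k"
    using reset_time_local[OF fin w eq t'(1), of u k] t' t by simp
  then show ?thesis using t t' by (simp add: not_less)
qed

text \<open>Floor plus one, not the ceiling: the value exceeds \<open>s\<close> even if
  \<open>s\<close> is a grid point. Its level sets are then differences of events of the form
  \<open>s < u\<close>, the only ones assumed to be known at time \<open>u\<close>.\<close>

definition grid_above :: "nat \<Rightarrow> real \<Rightarrow> real" where
  "grid_above n s = (real (nat \<lfloor>s * Suc n\<rfloor>) + 1) / Suc n"

lemma grid_above_bounds:
  assumes "0 \<le> s"
  shows "s < grid_above n s" "grid_above n s \<le> s + 1 / Suc n"
proof -
  have *: "0 \<le> \<lfloor>s * Suc n\<rfloor>" using assms by simp
  have "real (nat \<lfloor>s * Suc n\<rfloor>) = of_int \<lfloor>s * Suc n\<rfloor>" using * by simp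
  moreover have "s * Suc n < of_int \<lfloor>s * Suc n\<rfloor> + 1" "of_int \<lfloor>s * Suc n\<rfloor> \<le> s * Suc n" by linarith+
  ultimately have "s * Suc n < real (nat \<lfloor>s * Suc n\<rfloor>) + 1" "real (nat \<lfloor>s * Suc n\<rfloor>) + 1 \<le> s * Suc n + 1"
    by linarith+
  then show "s < grid_above n s" "grid_above n s \<le> s + 1 / Suc n"
    unfolding grid_above_def by (simp_all only: pos_less_divide_eq pos_divide_le_eq of_nat_0_less_iff
      zero_less_Suc distrib_right) simp_all
qed

lemma grid_above_nonneg: "0 \<le> grid_above n s"
  by (simp add: grid_above_def)

lemma grid_above_tendsto:
  assumes "0 \<le> s"
  shows "(\<lambda>n. grid_above n s) \<longlonglongrightarrow> s"
proof (rule tendsto_sandwich[of "\<lambda>_. s" _ _ "\<lambda>n. s + 1 / Suc n"])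
  have "(\<lambda>n. s + inverse (real (Suc n))) \<longlonglongrightarrow> s + 0"
    by (intro tendsto_add tendsto_const LIMSEQ_inverse_real_of_nat)
  then show "(\<lambda>n. s + 1 / real (Suc n)) \<longlonglongrightarrow> s" by (simp add: inverse_eq_divide)
qed (use grid_above_bounds[OF assms] in \<open>auto intro!: always_eventually less_imp_le\<close>)

lemma path_tendsto_grid_above:
  assumes "continuous_on {0..} f" "0 \<le> s" "0 \<le> u"
  shows "(\<lambda>n. f (grid_above n s + u)) \<longlonglongrightarrow> f (s + u)"
proof (rule continuous_on_tendsto_compose[OF assms(1)])
  show "(\<lambda>n. grid_above n s + u) \<longlonglongrightarrow> s + u" by (intro tendsto_intros grid_above_tendsto assms)
qed (use assms grid_above_nonneg in \<open>auto intro: add_nonneg_nonneg\<close>)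

lemma measurable_exit_time:
  assumes "finite I" "\<And>i q. i \<in> I \<Longrightarrow> 0 \<le> q \<Longrightarrow> (\<lambda>x. w x i q) \<in> borel_measurable N"
  shows "(\<lambda>x. exit_time I (w x)) \<in> borel_measurable N"
proof -
  have *: "(\<lambda>x. if 0 \<le> q \<and> (\<exists>i\<in>I. 1 - 1 / real (Suc n) < \<bar>w x i (real_of_rat q)\<bar>)
      then ennreal (real_of_rat q) else (\<infinity> :: ennreal)) \<in> borel_measurable N" for n :: nat and q :: rat
  proof (cases "0 \<le> q")
    case True
    then have "0 \<le> real_of_rat q" by simp
    have "Measurable.pred N (\<lambda>x. \<exists>i\<in>I. 1 - 1 / real (Suc n) < \<bar>w x i (real_of_rat q)\<bar>)"
    proof (rule pred_intros_finite(4)[OF assms(1)])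
      fix i assume "i \<in> I"
      note [measurable] = assms(2)[OF this \<open>0 \<le> real_of_rat q\<close>]
      show "Measurable.pred N (\<lambda>x. 1 - 1 / real (Suc n) < \<bar>w x i (real_of_rat q)\<bar>)" by measurable
    qed
    then show ?thesis using True by simp
  qed simp
  show ?thesis
    unfolding exit_time_def by (intro borel_measurable_SUP borel_measurable_INF countableI_type *)
qed

text \<open>Free of distributional assumptions because it is instantiated twice: with the Brownian
  family, and over the sigma-algebra \<open>past u\<close> with the paths stopped at
  \<open>u\<close>.\<close>

locale continuous_process =
  fixes M :: "'a measure" and I :: "'i set" and v :: "'i \<Rightarrow> real \<Rightarrow> 'a \<Rightarrow> real"
  assumes finite_index: "finite I"
    and measurable_process: "i \<in> I \<Longrightarrow> 0 \<le> t \<Longrightarrow> v i t \<in> borel_measurable M"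
    and paths_process: "\<omega> \<in> space M \<Longrightarrow> (\<lambda>i t. v i t \<omega>) \<in> paths I"
begin

abbreviation path :: "'a \<Rightarrow> 'i \<Rightarrow> real \<Rightarrow> real" where
  "path \<omega> \<equiv> \<lambda>i t. v i t \<omega>"

abbreviation event_at :: "nat \<Rightarrow> 'a \<Rightarrow> ennreal" where
  "event_at k \<omega> \<equiv> reset_time I (path \<omega>) k"

abbreviation first_exit :: "'a \<Rightarrow> ennreal" where
  "first_exit \<omega> \<equiv> exit_time I (path \<omega>)"

lemma continuous_process_path: "\<omega> \<in> space M \<Longrightarrow> i \<in> I \<Longrightarrow> continuous_on {0..} (path \<omega> i)"
  using paths_process by (auto simp: paths_def)

text \<open>Measurability is given only for each fixed time. Rounding the random time to the grid
  leaves countably many fixed times, and continuity of the paths yields the limit.\<close>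

lemma measurable_process_random:
  assumes i: "i \<in> I" and [measurable]: "\<sigma> \<in> borel_measurable N" "X \<in> measurable N M"
    and nonneg: "\<And>x. x \<in> space N \<Longrightarrow> 0 \<le> \<sigma> x"
  shows "(\<lambda>x. v i (\<sigma> x) (X x)) \<in> borel_measurable N"
proof (rule borel_measurable_LIMSEQ_real)
  fix x assume x: "x \<in> space N"
  then have "X x \<in> space M" by (rule measurable_space[OF \<open>X \<in> measurable N M\<close>])
  from path_tendsto_grid_above[OF continuous_process_path[OF this i] nonneg[OF x], of 0]
  show "(\<lambda>n. v i (grid_above n (\<sigma> x)) (X x)) \<longlonglongrightarrow> v i (\<sigma> x) (X x)" by simp
next
  fix n
  have "(\<lambda>x. v i ((real (nat \<lfloor>\<sigma> x * Suc n\<rfloor>) + 1) / Suc n) (X x)) \<in> borel_measurable N"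
  proof (rule measurable_compose_countable[where f="\<lambda>k x. v i ((real k + 1) / Suc n) (X x)"])
    fix k :: nat
    have "v i ((real k + 1) / Suc n) \<in> borel_measurable M" by (intro measurable_process i) auto
    then show "(\<lambda>x. v i ((real k + 1) / Suc n) (X x)) \<in> borel_measurable N" by measurable
  qed measurable
  then show "(\<lambda>x. v i (grid_above n (\<sigma> x)) (X x)) \<in> borel_measurable N" by (simp add: grid_above_def)
qed

lemma measurable_shift_random:
  assumes i: "i \<in> I" and \<sigma>: "\<sigma> \<in> borel_measurable N" and X: "X \<in> measurable N M"
    and f: "f \<in> borel_measurable N"
    and nonneg: "\<And>x. x \<in> space N \<Longrightarrow> 0 \<le> \<sigma> x" "\<And>x. x \<in> space N \<Longrightarrow> 0 \<le> f x"
  shows "(\<lambda>x. shift (\<sigma> x) (path (X x)) i (f x)) \<in> borel_measurable N"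
  unfolding shift_def using \<sigma> f
  by (intro borel_measurable_diff measurable_process_random i X nonneg add_nonneg_nonneg) auto

lemma measurable_exit_time_shift:
  assumes \<sigma>: "\<sigma> \<in> borel_measurable N" and X: "X \<in> measurable N M"
    and nonneg: "\<And>x. x \<in> space N \<Longrightarrow> 0 \<le> \<sigma> x"
  shows "(\<lambda>x. exit_time I (shift (\<sigma> x) (path (X x)))) \<in> borel_measurable N"
  by (intro measurable_exit_time finite_index measurable_shift_random assms) auto

text \<open>The defining infimum runs over uncountably many times; the recursion through
  \<open>exit_time\<close> reduces it to rational ones. The case distinction is there because the
  recursion speaks of finite event times only.\<close>

lemma measurable_reset_time: "(\<lambda>\<omega>. event_at k \<omega>) \<in> borel_measurable M"
proof (induction k)
  case (Suc k)
  note [measurable] = Suc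
  have [measurable]: "(\<lambda>\<omega>. exit_time I (shift (enn2real (event_at k \<omega>)) (path \<omega>))) \<in> borel_measurable M"
    by (intro measurable_exit_time_shift) auto
  have "(\<lambda>\<omega>. if event_at k \<omega> = \<infinity> then \<infinity> else event_at k \<omega> +
      exit_time I (shift (enn2real (event_at k \<omega>)) (path \<omega>))) \<in> borel_measurable M"
    by measurable
  also have "?this \<longleftrightarrow> ?case"
  proof (rule measurable_cong)
    fix \<omega> assume "\<omega> \<in> space M"
    then have p: "path \<omega> \<in> paths I" by (rule paths_process)
    show "(if event_at k \<omega> = \<infinity> then \<infinity> else event_at k \<omega> +
      exit_time I (shift (enn2real (event_at k \<omega>)) (path \<omega>))) = event_at (Suc k) \<omega>"
    proof (cases "event_at k \<omega>")
      case (real r)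
      then show ?thesis using reset_time_Suc[OF finite_index p real] by (simp del: reset_time.simps)
    next
      case top
      then show ?thesis using reset_time_Suc_top[of I "path \<omega>" k] by (simp del: reset_time.simps)
    qed
  qed
  finally show ?case .
qed simp

text \<open>The natural filtration, neither completed nor made right-continuous.\<close>

definition past :: "real \<Rightarrow> 'a measure" where
  "past u = vimage_algebra (space M) (\<lambda>\<omega>. \<lambda>(i, t)\<in>I \<times> {0..u}. v i t \<omega>) (PiM (I \<times> {0..u}) (\<lambda>_. borel))"

lemma space_past [simp]: "space (past u) = space M"
  by (simp add: past_def)

lemma measurable_past:
  assumes "i \<in> I" "0 \<le> t" "t \<le> u"
  shows "v i t \<in> borel_measurable (past u)"
proof -
  have "(\<lambda>\<omega>. (\<lambda>(i, t)\<in>I \<times> {0..u}. v i t \<omega>)) \<in> measurable (past u) (PiM (I \<times> {0..u}) (\<lambda>_. borel))"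
    unfolding past_def by (intro measurable_vimage_algebra1) (auto simp: space_PiM)
  from measurable_compose[OF this measurable_component_singleton[of "(i, t)"]] assms
  show ?thesis by simp
qed

lemma measurable_process_tuple [measurable]:
  "(\<lambda>\<omega>. \<lambda>(i, t)\<in>I \<times> {0..u}. v i t \<omega>) \<in> measurable M (PiM (I \<times> {0..u}) (\<lambda>_. borel))"
  by (rule measurable_restrict) (auto intro: measurable_process)

text \<open>In both cases the coordinates up to \<open>u\<close> are measurable for
  \<open>N\<close>; the disjunction lets one argument give both inclusions.\<close>

lemma sets_past_le:
  assumes "N = past u' \<and> u \<le> u' \<or> N = M"
  shows "sets (past u) \<subseteq> sets N"
proof -
  have sp: "space N = space M" using assms by auto
  have N: "(\<lambda>\<omega>. \<lambda>(i, t)\<in>I \<times> {0..u}. v i t \<omega>) \<in> measurable N (PiM (I \<times> {0..u}) (\<lambda>_. borel))"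
    using assms by (intro measurable_restrict) (auto intro: measurable_process measurable_past)
  show ?thesis
  proof
    fix A assume "A \<in> sets (past u)"
    then obtain B where "B \<in> sets (PiM (I \<times> {0..u}) (\<lambda>_. borel))"
      "A = (\<lambda>\<omega>. \<lambda>(i, t)\<in>I \<times> {0..u}. v i t \<omega>) -` B \<inter> space M"
      unfolding past_def by (subst (asm) sets_vimage_algebra2) (auto simp: space_PiM)
    with measurable_sets[OF N, of B] sp show "A \<in> sets N" by auto
  qed
qed

lemma sets_past_subset: "sets (past u) \<subseteq> sets M"
  by (rule sets_past_le) simp

lemma sets_past_mono: "u \<le> u' \<Longrightarrow> sets (past u) \<subseteq> sets (past u')"
  by (rule sets_past_le[of _ u']) simp

text \<open>Events before time \<open>u\<close> are those of the path stopped at \<open>u\<close>.\<close>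

lemma reset_time_less_in_past:
  assumes u: "0 \<le> u"
  shows "{\<omega> \<in> space M. event_at k \<omega> < ennreal u \<and> event_at k \<omega> \<le> m} \<in> sets (past u)"
proof -
  let ?v = "\<lambda>i t \<omega>. v i (min t u) \<omega>"
  have w: "(\<lambda>i t. ?v i t \<omega>) \<in> paths I" if "\<omega> \<in> space M" for \<omega>
    unfolding paths_def
  proof safe
    fix i assume "i \<in> I"
    from continuous_process_path[OF that this]
    show "continuous_on {0..} (\<lambda>t. ?v i t \<omega>)"
      using u by (intro continuous_on_compose2[of "{0..}" "path \<omega> i" "{0..}" "\<lambda>t. min t u"]
        continuous_intros) auto
  qed
  interpret stopped: continuous_process "past u" I ?v
    by unfold_locales (use finite_index w u in \<open>auto intro!: measurable_past\<close>)
  have eq: "(\<lambda>i t. v i (min t u) \<omega>) i s = path \<omega> i s" if "0 \<le> s" "s \<le> u" for \<omega> i s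
    using that by simp
  have "{\<omega> \<in> space M. event_at k \<omega> < ennreal u \<and> event_at k \<omega> \<le> m} =
      {\<omega> \<in> space (past u). reset_time I (stopped.path \<omega>) k < ennreal u \<and> reset_time I (stopped.path \<omega>) k \<le> m}"
    (is "?A = ?B")
  proof safe
    fix \<omega> assume "\<omega> \<in> space M" "event_at k \<omega> < ennreal u" "event_at k \<omega> \<le> m"
    with reset_time_local_below[OF finite_index paths_process w, of \<omega> \<omega> u k] eq
    show "\<omega> \<in> space (past u)" "reset_time I (stopped.path \<omega>) k < ennreal u" "reset_time I (stopped.path \<omega>) k \<le> m"
      by simp_all
  next
    fix \<omega> assume "\<omega> \<in> space (past u)" "reset_time I (stopped.path \<omega>) k < ennreal u"
      "reset_time I (stopped.path \<omega>) k \<le> m"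
    with reset_time_local_below[OF finite_index w paths_process, of \<omega> \<omega> u k] eq
    show "\<omega> \<in> space M" "event_at k \<omega> < ennreal u" "event_at k \<omega> \<le> m"
      by simp_all
  qed
  also have "?B \<in> sets (past u)"
    using stopped.measurable_reset_time[of k] by measurable
  finally show ?thesis .
qed

end

section \<open>Brownian increments\<close>

text \<open>Adding 0 makes every value of a path that starts at 0 a sum of increments; adding 1
  guarantees at least one increment, since the product representation of independence asks for a
  nonempty index set.\<close>

lemma finite_times_enumeration:
  assumes "finite S" "\<And>t. t \<in> S \<Longrightarrow> 0 \<le> (t :: real)"
  obtains n \<tau> where "\<tau> 0 = 0" "\<And>j k. j < k \<Longrightarrow> k \<le> n \<Longrightarrow> \<tau> j < \<tau> k" "0 < n" "S \<subseteq> \<tau> ` {..n::nat}"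
proof -
  define l where "l = sorted_list_of_set (insert 0 (insert 1 S))"
  have set: "set l = insert 0 (insert 1 S)" unfolding l_def by (rule set_sorted_list_of_set) (use assms in auto)
  have sorted: "sorted_wrt (<) l" unfolding l_def by (rule strict_sorted_list_of_set)
  have pos: "0 < length l" using set by (cases l) auto
  have len: "0 < length l - 1"
  proof (rule ccontr)
    assume "\<not> ?thesis"
    then obtain x where "l = [x]" using pos by (cases l) auto
    with set have "0 \<in> {x}" "1 \<in> {x}" by auto
    then show False by simp
  qed
  have "l ! 0 = 0"
  proof -
    obtain j where j: "j < length l" "l ! j = 0" using set by (metis in_set_conv_nth insertI1)
    have "0 \<le> l ! 0" using nth_mem[OF pos] set assms(2) by auto
    then show ?thesis using sorted_wrt_nth_less[OF sorted, of 0 j] j by (cases "j = 0") auto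
  qed
  moreover have "S \<subseteq> (!) l ` {..length l - 1}"
  proof
    fix t assume "t \<in> S"
    then have "t \<in> set l" using set by auto
    then obtain j where "j < length l" "l ! j = t" by (metis in_set_conv_nth)
    then show "t \<in> (!) l ` {..length l - 1}" by auto
  qed
  ultimately show ?thesis
    using that[of "(!) l" "length l - 1"] sorted_wrt_nth_less[OF sorted] len by auto
qed

context standard_brownian_motion
begin

lemma shifted_brownian_motion:
  assumes "0 \<le> s"
  shows "standard_brownian_motion M (\<lambda>u \<omega>. B (s + u) \<omega> - B s \<omega>)"
proof unfold_locales
  fix t :: real assume "0 \<le> t"
  then show "(\<lambda>\<omega>. B (s + t) \<omega> - B s \<omega>) \<in> borel_measurable M"
    using assms by (intro borel_measurable_diff measurable_at) auto
next
  fix \<omega> assume "\<omega> \<in> space M"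
  then have "continuous_on {0..} (\<lambda>t. B (s + t) \<omega>)"
    using assms by (intro continuous_on_compose2[OF continuous_paths, of \<omega> "{0..}" "\<lambda>u. s + u"]
      continuous_intros) auto
  then show "continuous_on {0..} (\<lambda>t. B (s + t) \<omega> - B s \<omega>)" by (intro continuous_intros)
next
  fix s' t :: real assume "0 \<le> s'" "s' < t"
  then show "distributed M lborel (\<lambda>\<omega>. B (s + t) \<omega> - B s \<omega> - (B (s + s') \<omega> - B s \<omega>))
      (normal_density 0 (sqrt (t - s')))"
    using gaussian_increments[of "s + s'" "s + t"] assms by (simp add: algebra_simps)
next
  fix n and \<tau> :: "nat \<Rightarrow> real"
  assume "0 \<le> \<tau> 0" "\<And>k. k < n \<Longrightarrow> \<tau> k \<le> \<tau> (Suc k)"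
  then show "indep_vars (\<lambda>_. borel) (\<lambda>k \<omega>. B (s + \<tau> (Suc k)) \<omega> - B s \<omega> - (B (s + \<tau> k) \<omega> - B s \<omega>)) {..<n}"
    using independent_increments[of "\<lambda>k. s + \<tau> k" n] assms by simp
qed simp

lemma increments_sum:
  assumes "\<tau> 0 = 0" "\<omega> \<in> space M"
  shows "(\<Sum>l<j. B (\<tau> (Suc l)) \<omega> - B (\<tau> l) \<omega>) = B (\<tau> j) \<omega>"
  using start_zero[OF assms(2)] assms(1) sum_lessThan_telescope[of "\<lambda>l. B (\<tau> l) \<omega>" j] by simp

text \<open>Both random vectors are sums of increments over one common refinement of the times. If
  \<open>m\<close> is the index of \<open>s\<close>, the past uses only the increments below
  \<open>m\<close> and the future only those from \<open>m\<close> on, and these two groups are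
  independent.\<close>

lemma markov_finite_dim:
  assumes s: "0 \<le> s" and J: "finite J" "J \<subseteq> {0..s}" and K: "finite K" "K \<subseteq> {0..}"
    and A: "A \<in> sets (PiM J (\<lambda>_. borel))" and C: "C \<in> sets (PiM K (\<lambda>_. borel))"
  shows "prob {\<omega> \<in> space M. (\<lambda>t\<in>J. B t \<omega>) \<in> A \<and> (\<lambda>u\<in>K. B (s + u) \<omega> - B s \<omega>) \<in> C} =
    prob {\<omega> \<in> space M. (\<lambda>t\<in>J. B t \<omega>) \<in> A} *
    prob {\<omega> \<in> space M. (\<lambda>u\<in>K. B (s + u) \<omega> - B s \<omega>) \<in> C}"
proof -
  define S where "S = insert s (J \<union> (+) s ` K)"
  have "finite S" "\<And>t. t \<in> S \<Longrightarrow> 0 \<le> t" using s J K by (auto simp: S_def)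
  then obtain n \<tau> where \<tau>: "\<tau> 0 = 0" "\<And>j k. j < k \<Longrightarrow> k \<le> n \<Longrightarrow> \<tau> j < \<tau> k" "0 < n"
    "S \<subseteq> \<tau> ` {..n::nat}" by (rule finite_times_enumeration) auto
  have "\<exists>j. j \<le> n \<and> \<tau> j = t" if "t \<in> S" for t using \<tau>(4) that by auto
  then obtain idx where idx: "\<And>t. t \<in> S \<Longrightarrow> idx t \<le> n \<and> \<tau> (idx t) = t" by metis
  define m where "m = idx s"
  have m: "m \<le> n" "\<tau> m = s" using idx by (auto simp: m_def S_def)
  define X where "X = (\<lambda>k \<omega>. B (\<tau> (Suc k)) \<omega> - B (\<tau> k) \<omega>)"
  have ind: "indep_vars (\<lambda>_. borel) X {..<n}"
    unfolding X_def using \<tau>(1) by (intro independent_increments) (simp_all add: less_imp_le \<tau>(2))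
  have idxJ: "idx t \<le> m" if "t \<in> J" for t
  proof (rule ccontr)
    assume "\<not> idx t \<le> m"
    then have "\<tau> m < \<tau> (idx t)" using idx[of t] that by (intro \<tau>(2)) (auto simp: S_def)
    then show False using m idx[of t] that J by (auto simp: S_def)
  qed
  have idxK: "m \<le> idx (s + u)" "idx (s + u) \<le> n" if "u \<in> K" for u
  proof -
    show "m \<le> idx (s + u)"
    proof (rule ccontr)
      assume "\<not> m \<le> idx (s + u)"
      then have "\<tau> (idx (s + u)) < \<tau> m" using m by (intro \<tau>(2)) auto
      then show False using m idx[of "s + u"] that K by (auto simp: S_def)
    qed
  qed (use idx[of "s + u"] that in \<open>auto simp: S_def\<close>)
  define f where "f = (\<lambda>x::nat \<Rightarrow> real. \<lambda>t\<in>J. \<Sum>l<idx t. x l)"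
  define g where "g = (\<lambda>x::nat \<Rightarrow> real. \<lambda>u\<in>K. \<Sum>l\<in>{m..<idx (s + u)}. x l)"
  have f: "f \<in> measurable (PiM {..<m} (\<lambda>_. borel)) (PiM J (\<lambda>_. borel))"
    unfolding f_def using idxJ
    by (intro measurable_restrict borel_measurable_sum measurable_component_singleton) force
  have g: "g \<in> measurable (PiM {m..<n} (\<lambda>_. borel)) (PiM K (\<lambda>_. borel))"
    unfolding g_def using idxK
    by (intro measurable_restrict borel_measurable_sum measurable_component_singleton) force
  have fX: "f (\<lambda>k\<in>{..<m}. X k \<omega>) = (\<lambda>t\<in>J. B t \<omega>)" if "\<omega> \<in> space M" for \<omega>
  proof -
    have "(\<Sum>l<idx t. (\<lambda>k\<in>{..<m}. X k \<omega>) l) = B t \<omega>" if t: "t \<in> J" for t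
    proof -
      have "(\<Sum>l<idx t. (\<lambda>k\<in>{..<m}. X k \<omega>) l) = (\<Sum>l<idx t. X l \<omega>)"
        using idxJ[OF t] by (intro sum.cong) auto
      also have "\<dots> = B t \<omega>"
        unfolding X_def increments_sum[where \<tau>=\<tau>, OF \<tau>(1) \<open>\<omega> \<in> space M\<close>] using idx[of t] t by (simp add: S_def)
      finally show ?thesis .
    qed
    then show ?thesis by (auto simp: f_def)
  qed
  have gX: "g (\<lambda>k\<in>{m..<n}. X k \<omega>) = (\<lambda>u\<in>K. B (s + u) \<omega> - B s \<omega>)" if "\<omega> \<in> space M" for \<omega>
  proof -
    have "(\<Sum>l\<in>{m..<idx (s + u)}. (\<lambda>k\<in>{m..<n}. X k \<omega>) l) = B (s + u) \<omega> - B s \<omega>" if u: "u \<in> K" for u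
    proof -
      have "(\<Sum>l\<in>{m..<idx (s + u)}. (\<lambda>k\<in>{m..<n}. X k \<omega>) l) = (\<Sum>l\<in>{m..<idx (s + u)}. X l \<omega>)"
        using idxK[OF u] by (intro sum.cong) auto
      also have "\<dots> = (\<Sum>l<idx (s + u). X l \<omega>) - (\<Sum>l<m. X l \<omega>)"
        using idxK[OF u] sum.atLeastLessThan_concat[of 0 m "idx (s + u)" "\<lambda>l. X l \<omega>"]
        by (simp add: lessThan_atLeast0)
      also have "\<dots> = B (s + u) \<omega> - B s \<omega>"
        unfolding X_def increments_sum[where \<tau>=\<tau>, OF \<tau>(1) \<open>\<omega> \<in> space M\<close>] using idx[of "s + u"] u m
        by (simp add: S_def)
      finally show ?thesis .
    qed
    then show ?thesis by (auto simp: g_def)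
  qed
  have "indep_var (PiM {..<m} (\<lambda>_. borel)) (\<lambda>\<omega>. \<lambda>k\<in>{..<m}. X k \<omega>)
      (PiM {m..<n} (\<lambda>_. borel)) (\<lambda>\<omega>. \<lambda>k\<in>{m..<n}. X k \<omega>)"
    by (rule indep_var_restrict[OF ind]) (use m in auto)
  from indep_varD[OF indep_var_compose[OF this f g] A C]
  have "prob ((\<lambda>\<omega>. (f (\<lambda>k\<in>{..<m}. X k \<omega>), g (\<lambda>k\<in>{m..<n}. X k \<omega>))) -` (A \<times> C) \<inter> space M) =
    prob ((\<lambda>\<omega>. f (\<lambda>k\<in>{..<m}. X k \<omega>)) -` A \<inter> space M) *
    prob ((\<lambda>\<omega>. g (\<lambda>k\<in>{m..<n}. X k \<omega>)) -` C \<inter> space M)"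
    by (simp add: comp_def)
  also have "(\<lambda>\<omega>. (f (\<lambda>k\<in>{..<m}. X k \<omega>), g (\<lambda>k\<in>{m..<n}. X k \<omega>))) -` (A \<times> C) \<inter> space M =
      {\<omega> \<in> space M. (\<lambda>t\<in>J. B t \<omega>) \<in> A \<and> (\<lambda>u\<in>K. B (s + u) \<omega> - B s \<omega>) \<in> C}"
    using fX gX by auto
  also have "(\<lambda>\<omega>. f (\<lambda>k\<in>{..<m}. X k \<omega>)) -` A \<inter> space M = {\<omega> \<in> space M. (\<lambda>t\<in>J. B t \<omega>) \<in> A}"
    using fX by auto
  also have "(\<lambda>\<omega>. g (\<lambda>k\<in>{m..<n}. X k \<omega>)) -` C \<inter> space M =
      {\<omega> \<in> space M. (\<lambda>u\<in>K. B (s + u) \<omega> - B s \<omega>) \<in> C}"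
    using gX by auto
  finally show ?thesis .
qed

lemma distr_increments:
  assumes "\<tau> 0 = 0" "\<And>j k. j < k \<Longrightarrow> k \<le> n \<Longrightarrow> \<tau> j < \<tau> k" "0 < (n::nat)"
  shows "distr M (PiM {..<n} (\<lambda>_. borel)) (\<lambda>\<omega>. \<lambda>k\<in>{..<n}. B (\<tau> (Suc k)) \<omega> - B (\<tau> k) \<omega>) =
    PiM {..<n} (\<lambda>k. density lborel (normal_density 0 (sqrt (\<tau> (Suc k) - \<tau> k))))"
proof -
  have pos: "0 \<le> \<tau> k" if "k \<le> n" for k
    using assms(1) assms(2)[of 0 k] that by (cases "k = 0") auto
  have m: "(\<lambda>\<omega>. B (\<tau> (Suc k)) \<omega> - B (\<tau> k) \<omega>) \<in> borel_measurable M" if "k \<in> {..<n}" for k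
    using that by (intro borel_measurable_diff measurable_at pos) auto
  have "indep_vars (\<lambda>_. borel) (\<lambda>k \<omega>. B (\<tau> (Suc k)) \<omega> - B (\<tau> k) \<omega>) {..<n}"
    using assms by (intro independent_increments) (simp_all add: less_imp_le)
  moreover have "{..<n} \<noteq> {}" using assms(3) by auto
  ultimately have "distr M (PiM {..<n} (\<lambda>_. borel)) (\<lambda>\<omega>. \<lambda>k\<in>{..<n}. B (\<tau> (Suc k)) \<omega> - B (\<tau> k) \<omega>) =
      PiM {..<n} (\<lambda>k. distr M borel (\<lambda>\<omega>. B (\<tau> (Suc k)) \<omega> - B (\<tau> k) \<omega>))"
    using m by (subst (asm) indep_vars_iff_distr_eq_PiM') auto
  also have "\<dots> = PiM {..<n} (\<lambda>k. density lborel (normal_density 0 (sqrt (\<tau> (Suc k) - \<tau> k))))"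
  proof (rule PiM_cong[OF refl])
    fix k assume "k \<in> {..<n}"
    then have "distributed M lborel (\<lambda>\<omega>. B (\<tau> (Suc k)) \<omega> - B (\<tau> k) \<omega>)
        (normal_density 0 (sqrt (\<tau> (Suc k) - \<tau> k)))"
      by (intro gaussian_increments pos assms(2)) auto
    then have "distr M lborel (\<lambda>\<omega>. B (\<tau> (Suc k)) \<omega> - B (\<tau> k) \<omega>) =
        density lborel (normal_density 0 (sqrt (\<tau> (Suc k) - \<tau> k)))"
      by (simp add: distributed_def)
    then show "distr M borel (\<lambda>\<omega>. B (\<tau> (Suc k)) \<omega> - B (\<tau> k) \<omega>) =
        density lborel (normal_density 0 (sqrt (\<tau> (Suc k) - \<tau> k)))"
      by (simp cong: distr_cong)
  qed
  finally show ?thesis .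
qed

text \<open>The law of the increments depends on the times only, and the values are a fixed function
  of the increments. Applied to the motion restarted at \<open>s\<close> this gives
  stationarity.\<close>

lemma finite_dim_law_unique:
  assumes B': "standard_brownian_motion M B'" and K: "finite K" "K \<subseteq> {0..}"
    and C: "C \<in> sets (PiM K (\<lambda>_. borel))"
  shows "prob {\<omega> \<in> space M. (\<lambda>u\<in>K. B u \<omega>) \<in> C} = prob {\<omega> \<in> space M. (\<lambda>u\<in>K. B' u \<omega>) \<in> C}"
proof -
  have "\<And>t. t \<in> K \<Longrightarrow> 0 \<le> t" using K by auto
  with K(1) obtain n \<tau> where \<tau>: "\<tau> 0 = 0" "\<And>j k. j < k \<Longrightarrow> k \<le> n \<Longrightarrow> \<tau> j < \<tau> k" "0 < n"
    "K \<subseteq> \<tau> ` {..n::nat}" by (rule finite_times_enumeration) auto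
  have "\<exists>j. j \<le> n \<and> \<tau> j = t" if "t \<in> K" for t using \<tau>(4) that by auto
  then obtain idx where idx: "\<And>t. t \<in> K \<Longrightarrow> idx t \<le> n \<and> \<tau> (idx t) = t" by metis
  define g where "g = (\<lambda>x::nat \<Rightarrow> real. \<lambda>u\<in>K. \<Sum>l<idx u. x l)"
  have g: "g \<in> measurable (PiM {..<n} (\<lambda>_. borel)) (PiM K (\<lambda>_. borel))"
    unfolding g_def using idx
    by (intro measurable_restrict borel_measurable_sum measurable_component_singleton) force
  have pos: "0 \<le> \<tau> k" if "k \<le> n" for k
    using \<tau>(1) \<tau>(2)[of 0 k] that by (cases "k = 0") auto
  have law: "prob {\<omega> \<in> space M. (\<lambda>u\<in>K. W u \<omega>) \<in> C} =
      measure (PiM {..<n} (\<lambda>k. density lborel (normal_density 0 (sqrt (\<tau> (Suc k) - \<tau> k)))))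
        (g -` C \<inter> space (PiM {..<n} (\<lambda>_. borel)))"
    if W: "standard_brownian_motion M W" for W
  proof -
    interpret W: standard_brownian_motion M W by fact
    let ?X = "\<lambda>\<omega>. \<lambda>k\<in>{..<n}. W (\<tau> (Suc k)) \<omega> - W (\<tau> k) \<omega>"
    have X: "?X \<in> measurable M (PiM {..<n} (\<lambda>_. borel))"
      by (intro measurable_restrict borel_measurable_diff W.measurable_at pos) auto
    have gX: "g (?X \<omega>) = (\<lambda>u\<in>K. W u \<omega>)" if "\<omega> \<in> space M" for \<omega>
    proof -
      have "(\<Sum>l<idx u. ?X \<omega> l) = W u \<omega>" if u: "u \<in> K" for u
      proof -
        have "(\<Sum>l<idx u. ?X \<omega> l) = (\<Sum>l<idx u. W (\<tau> (Suc l)) \<omega> - W (\<tau> l) \<omega>)"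
          using idx[OF u] by (intro sum.cong) auto
        also have "\<dots> = W u \<omega>"
          unfolding W.increments_sum[where \<tau>=\<tau>, OF \<tau>(1) \<open>\<omega> \<in> space M\<close>] using idx[OF u] by simp
        finally show ?thesis .
      qed
      then show ?thesis by (auto simp: g_def)
    qed
    have "{\<omega> \<in> space M. (\<lambda>u\<in>K. W u \<omega>) \<in> C} =
        ?X -` (g -` C \<inter> space (PiM {..<n} (\<lambda>_. borel))) \<inter> space M"
      using gX measurable_space[OF X] by auto
    also have "prob \<dots> = measure (distr M (PiM {..<n} (\<lambda>_. borel)) ?X)
        (g -` C \<inter> space (PiM {..<n} (\<lambda>_. borel)))"
      by (rule measure_distr[OF X measurable_sets[OF g C], symmetric])
    also have "distr M (PiM {..<n} (\<lambda>_. borel)) ?X =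
        PiM {..<n} (\<lambda>k. density lborel (normal_density 0 (sqrt (\<tau> (Suc k) - \<tau> k))))"
      using \<tau> by (intro W.distr_increments) auto
    finally show ?thesis .
  qed
  show ?thesis
    using law[OF B'] law[OF standard_brownian_motion_axioms] by simp
qed

end

text \<open>Cylinders over open half-lines form an intersection-stable generator that contains the
  whole space, so a finite measure is determined by them. Open half-lines are used because their
  indicators are limits of the continuous ramps in the strong Markov property.\<close>

lemma PiM_borel_eqI:
  fixes N1 N2 :: "('k \<Rightarrow> real) measure"
  assumes sets: "sets N1 = sets (PiM K (\<lambda>_. borel))" "sets N2 = sets (PiM K (\<lambda>_. borel))"
    and fin: "finite_measure N1"
    and eq: "\<And>J a. finite J \<Longrightarrow> J \<subseteq> K \<Longrightarrow>
      emeasure N1 {p \<in> space (PiM K (\<lambda>_. borel)). \<forall>j\<in>J. a j < p j} =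
      emeasure N2 {p \<in> space (PiM K (\<lambda>_. borel)). \<forall>j\<in>J. a j < p j}"
  shows "N1 = N2"
proof -
  let ?\<Omega> = "\<Pi>\<^sub>E i\<in>K. (UNIV :: real set)"
  define E where "E = (range greaterThan :: real set set)"
  define P where "P = {{f \<in> ?\<Omega>. \<forall>i\<in>j. f i \<in> A i} | A j. j \<in> {J. finite J \<and> J \<subseteq> K} \<and> A \<in> Pi j (\<lambda>_. E)}"
  have space: "space (PiM K (\<lambda>_. borel)) = ?\<Omega>" by (simp add: space_PiM)
  have "sets (\<Pi>\<^sub>M i\<in>K. sigma UNIV E) = sets (sigma ?\<Omega> P)"
    unfolding P_def
  proof (rule sets_PiM_sigma)
    have "(UNIV :: real set) = (\<Union>n::nat. {- real n<..})"
      by (auto intro: reals_Archimedean2[of "- x" for x] simp: minus_less_iff)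
    then show "\<exists>S\<subseteq>E. countable S \<and> UNIV = \<Union>S"
      by (intro exI[of _ "range (\<lambda>n::nat. {- real n<..})"]) (auto simp: E_def)
  qed auto
  then have gen: "sets (PiM K (\<lambda>_. borel)) = sigma_sets ?\<Omega> P"
    unfolding E_def borel_Ioi[symmetric] by (subst (asm) sets_measure_of) (auto simp: P_def)
  have rep: "\<exists>J a. finite J \<and> J \<subseteq> K \<and> X = {p \<in> ?\<Omega>. \<forall>j\<in>J. a j < p j}" if "X \<in> P" for X
  proof -
    from that obtain A J where J: "finite J" "J \<subseteq> K" "A \<in> Pi J (\<lambda>_. E)"
      and X: "X = {p \<in> ?\<Omega>. \<forall>j\<in>J. p j \<in> A j}" by (auto simp: P_def)
    then have "\<forall>j\<in>J. \<exists>a. A j = {a<..}" by (auto simp: E_def Pi_iff)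
    then obtain a where "\<And>j. j \<in> J \<Longrightarrow> A j = {a j<..}" by metis
    with J X show ?thesis by (intro exI[of _ J] exI[of _ a]) auto
  qed
  have mem: "{p \<in> ?\<Omega>. \<forall>j\<in>J. a j < p j} \<in> P" if "finite J" "J \<subseteq> K" for J and a :: "'k \<Rightarrow> real"
    unfolding P_def using that by (auto intro!: exI[of _ "\<lambda>j. {a j<..}"] exI[of _ J] simp: E_def)
  show ?thesis
  proof (rule measure_eqI_generator_eq[where E=P and \<Omega>="?\<Omega>" and A="\<lambda>_. ?\<Omega>"])
    show "Int_stable P"
    proof (rule Int_stableI)
      fix X Y assume "X \<in> P" "Y \<in> P"
      then obtain J a J' b where X: "finite J" "J \<subseteq> K" "X = {p \<in> ?\<Omega>. \<forall>j\<in>J. a j < p j}"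
        and Y: "finite J'" "J' \<subseteq> K" "Y = {p \<in> ?\<Omega>. \<forall>j\<in>J'. b j < p j}"
        using rep by meson
      define c where "c j = (if j \<in> J \<inter> J' then max (a j) (b j) else if j \<in> J then a j else b j)" for j
      have "X \<inter> Y = {p \<in> ?\<Omega>. \<forall>j\<in>J \<union> J'. c j < p j}"
        unfolding X Y c_def by (auto split: if_splits)
      then show "X \<inter> Y \<in> P" using mem[of "J \<union> J'" c] X Y by simp
    qed
    show "P \<subseteq> Pow ?\<Omega>" by (auto simp: P_def)
    show "emeasure N1 X = emeasure N2 X" if "X \<in> P" for X
      using rep[OF that] eq space by auto
    show "sets N1 = sigma_sets ?\<Omega> P" "sets N2 = sigma_sets ?\<Omega> P" using sets gen by auto
    show "range (\<lambda>_. ?\<Omega>) \<subseteq> P" using mem[of "{}"] by auto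
    show "emeasure N1 ?\<Omega> \<noteq> \<infinity>" for i :: nat using fin by (simp add: finite_measure.emeasure_finite)
  qed auto
qed

section \<open>The Markov property of a family of Brownian motions\<close>

text \<open>An independence statement is phrased below as the equality of two image measures: one of
  \<open>M\<close> restricted to an event, one of \<open>M\<close> scaled by its probability. In
  this form the uniqueness of measures on a generator applies.\<close>

lemma emeasure_distr_density_indicator:
  assumes "E \<in> sets M" "f \<in> measurable M N" "D \<in> sets N"
  shows "emeasure (distr (density M (indicator E)) N f) D = emeasure M {\<omega> \<in> E. f \<omega> \<in> D}"
proof -
  have "f -` D \<inter> space M \<in> sets M" using assms by measurable
  moreover have "E \<inter> (f -` D \<inter> space M) = {\<omega> \<in> E. f \<omega> \<in> D}"
    using sets.sets_into_space[OF assms(1)] by auto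
  ultimately show ?thesis
    using assms by (simp add: emeasure_distr emeasure_density nn_integral_indicator
      flip: indicator_inter_arith)
qed

lemma emeasure_distr_density_const:
  assumes "f \<in> measurable M N" "D \<in> sets N"
  shows "emeasure (distr (density M (\<lambda>_. c)) N f) D = c * emeasure M {\<omega> \<in> space M. f \<omega> \<in> D}"
proof -
  have "f -` D \<inter> space M \<in> sets M" using assms by measurable
  moreover have "f -` D \<inter> space M = {\<omega> \<in> space M. f \<omega> \<in> D}" by auto
  ultimately show ?thesis
    using assms by (simp add: emeasure_distr emeasure_density nn_integral_cmult)
qed

locale brownian_family = prob_space M for M :: "'a measure" +
  fixes I :: "'i set" and v :: "'i \<Rightarrow> real \<Rightarrow> 'a \<Rightarrow> real"
  assumes finite_agents: "finite I" and agents_nonempty: "I \<noteq> {}"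
    and brownian: "i \<in> I \<Longrightarrow> standard_brownian_motion M (v i)"
    and independent_paths:
      "indep_vars (\<lambda>_. PiM {0..} (\<lambda>_. borel)) (\<lambda>i \<omega>. \<lambda>t\<in>{0..}. v i t \<omega>) I"

sublocale brownian_family \<subseteq> continuous_process
proof
  show "finite I" by (rule finite_agents)
  show "v i t \<in> borel_measurable M" if "i \<in> I" "0 \<le> t" for i t
    using standard_brownian_motion.measurable_at[OF brownian] that by auto
  show "(\<lambda>i t. v i t \<omega>) \<in> paths I" if "\<omega> \<in> space M" for \<omega>
    using standard_brownian_motion.continuous_paths[OF brownian] that by (auto simp: paths_def)
qed

context brownian_family
begin

lemma start_zero_family: "\<omega> \<in> space M \<Longrightarrow> i \<in> I \<Longrightarrow> v i 0 \<omega> = 0"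
  using standard_brownian_motion.start_zero[OF brownian] by auto

lemma prob_paths:
  assumes "\<And>i. i \<in> I \<Longrightarrow> E i \<in> sets (PiM {0..} (\<lambda>_. borel))"
  shows "prob {\<omega> \<in> space M. \<forall>i\<in>I. (\<lambda>t\<in>{0..}. v i t \<omega>) \<in> E i} =
    (\<Prod>i\<in>I. prob {\<omega> \<in> space M. (\<lambda>t\<in>{0..}. v i t \<omega>) \<in> E i})"
proof -
  have "(\<Inter>i\<in>I. (\<lambda>\<omega>. \<lambda>t\<in>{0..}. v i t \<omega>) -` E i \<inter> space M) =
      {\<omega> \<in> space M. \<forall>i\<in>I. (\<lambda>t\<in>{0..}. v i t \<omega>) \<in> E i}"
    using agents_nonempty by auto
  moreover have "(\<lambda>\<omega>. \<lambda>t\<in>{0..}. v i t \<omega>) -` E i \<inter> space M =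
      {\<omega> \<in> space M. (\<lambda>t\<in>{0..}. v i t \<omega>) \<in> E i}" for i by auto
  ultimately show ?thesis
    using indep_varsD_finite[OF independent_paths agents_nonempty finite_agents, of E] assms by simp
qed

text \<open>For one agent this is the finite-dimensional Markov property together with stationarity.
  Independence of the whole paths multiplies over the agents, and the factors of past and future are
  then regrouped.\<close>

lemma markov_cylinders:
  assumes s: "0 \<le> s" and J: "finite J" "J \<subseteq> I \<times> {0..s}" and K: "finite K" "K \<subseteq> I \<times> {0..}"
    and A: "\<And>j. A j \<in> sets borel" and C: "\<And>k. C k \<in> sets borel"
  shows "prob {\<omega> \<in> space M. (\<forall>(i, t)\<in>J. v i t \<omega> \<in> A (i, t)) \<and>
      (\<forall>(i, u)\<in>K. shift s (path \<omega>) i u \<in> C (i, u))} =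
    prob {\<omega> \<in> space M. \<forall>(i, t)\<in>J. v i t \<omega> \<in> A (i, t)} *
    prob {\<omega> \<in> space M. \<forall>(i, u)\<in>K. v i u \<omega> \<in> C (i, u)}"
proof -
  let ?P = "PiM {0..} (\<lambda>_. borel) :: (real \<Rightarrow> real) measure"
  define Ji where "Ji i = {t. (i, t) \<in> J}" for i
  define Ki where "Ki i = {t. (i, t) \<in> K}" for i
  have Ji: "finite (Ji i)" "Ji i \<subseteq> {0..s}" for i
    using J finite_vimageI[OF J(1), of "Pair i"] by (auto simp: Ji_def vimage_def inj_on_def)
  have Ki: "finite (Ki i)" "Ki i \<subseteq> {0..}" for i
    using K finite_vimageI[OF K(1), of "Pair i"] by (auto simp: Ki_def vimage_def inj_on_def)
  define EA where "EA i = {p \<in> space ?P. \<forall>t\<in>Ji i. p t \<in> A (i, t)}" for i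
  define EC where "EC i = {p \<in> space ?P. \<forall>u\<in>Ki i. p (s + u) - p s \<in> C (i, u)}" for i
  define E0 where "E0 i = {p \<in> space ?P. \<forall>u\<in>Ki i. p u \<in> C (i, u)}" for i
  have comp: "(\<lambda>p. p t) \<in> borel_measurable ?P" if "0 \<le> t" for t
    using that by (intro measurable_component_singleton) auto
  have EA: "EA i \<in> sets ?P" for i
    unfolding EA_def using Ji[of i] A
    by (intro sets.sets_Collect_finite_All measurable_sets_borel)
      (auto intro!: measurable_sets_Collect[OF comp] simp: )
  have EC: "EC i \<in> sets ?P" for i
    unfolding EC_def using Ki[of i] s C
    by (intro sets.sets_Collect_finite_All)
      (auto intro!: measurable_sets_Collect[OF borel_measurable_diff[OF comp comp]])
  have E0: "E0 i \<in> sets ?P" for i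
    unfolding E0_def using Ki[of i] C
    by (intro sets.sets_Collect_finite_All) (auto intro!: measurable_sets_Collect[OF comp])
  have EA_iff: "(\<lambda>t\<in>{0..}. v i t \<omega>) \<in> EA i \<longleftrightarrow> (\<forall>t\<in>Ji i. v i t \<omega> \<in> A (i, t))" for i \<omega>
    using Ji(2)[of i] by (auto simp: EA_def space_PiM subset_iff)
  have EC_iff: "(\<lambda>t\<in>{0..}. v i t \<omega>) \<in> EC i \<longleftrightarrow> (\<forall>u\<in>Ki i. v i (s + u) \<omega> - v i s \<omega> \<in> C (i, u))" for i \<omega>
    using Ki(2)[of i] s by (auto simp: EC_def space_PiM subset_iff)
  have E0_iff: "(\<lambda>t\<in>{0..}. v i t \<omega>) \<in> E0 i \<longleftrightarrow> (\<forall>u\<in>Ki i. v i u \<omega> \<in> C (i, u))" for i \<omega>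
    using Ki(2)[of i] by (auto simp: E0_def space_PiM subset_iff)
  have agent: "prob {\<omega> \<in> space M. (\<lambda>t\<in>{0..}. v i t \<omega>) \<in> EA i \<inter> EC i} =
      prob {\<omega> \<in> space M. (\<lambda>t\<in>{0..}. v i t \<omega>) \<in> EA i} * prob {\<omega> \<in> space M. (\<lambda>t\<in>{0..}. v i t \<omega>) \<in> E0 i}"
    if i: "i \<in> I" for i
  proof -
    interpret B: standard_brownian_motion M "v i" by (rule brownian[OF i])
    let ?A = "\<Pi>\<^sub>E t\<in>Ji i. A (i, t)" and ?C = "\<Pi>\<^sub>E u\<in>Ki i. C (i, u)"
    have sets: "?A \<in> sets (PiM (Ji i) (\<lambda>_. borel))" "?C \<in> sets (PiM (Ki i) (\<lambda>_. borel))"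
      using Ji Ki A C by (auto intro!: sets_PiM_I_finite)
    have "{\<omega> \<in> space M. (\<lambda>t\<in>{0..}. v i t \<omega>) \<in> EA i \<inter> EC i} =
        {\<omega> \<in> space M. (\<lambda>t\<in>Ji i. v i t \<omega>) \<in> ?A \<and> (\<lambda>u\<in>Ki i. v i (s + u) \<omega> - v i s \<omega>) \<in> ?C}"
      by (simp add: EA_iff EC_iff restrict_PiE_iff Pi_iff)
    moreover have "{\<omega> \<in> space M. (\<lambda>t\<in>{0..}. v i t \<omega>) \<in> EA i} = {\<omega> \<in> space M. (\<lambda>t\<in>Ji i. v i t \<omega>) \<in> ?A}"
      by (simp add: EA_iff restrict_PiE_iff Pi_iff)
    moreover have "{\<omega> \<in> space M. (\<lambda>t\<in>{0..}. v i t \<omega>) \<in> E0 i} = {\<omega> \<in> space M. (\<lambda>u\<in>Ki i. v i u \<omega>) \<in> ?C}"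
      by (simp add: E0_iff restrict_PiE_iff Pi_iff)
    ultimately show ?thesis
      using B.markov_finite_dim[OF s Ji Ki sets]
        B.finite_dim_law_unique[OF B.shifted_brownian_motion[OF s] Ki sets(2)] by simp
  qed
  have JI: "(\<forall>(i, t)\<in>J. v i t \<omega> \<in> A (i, t)) \<longleftrightarrow> (\<forall>i\<in>I. (\<lambda>t\<in>{0..}. v i t \<omega>) \<in> EA i)" for \<omega>
    using J by (auto simp: EA_iff Ji_def)
  have KI: "(\<forall>(i, u)\<in>K. shift s (path \<omega>) i u \<in> C (i, u)) \<longleftrightarrow> (\<forall>i\<in>I. (\<lambda>t\<in>{0..}. v i t \<omega>) \<in> EC i)" for \<omega>
    using K by (auto simp: EC_iff Ki_def shift_def)
  have K0: "(\<forall>(i, u)\<in>K. v i u \<omega> \<in> C (i, u)) \<longleftrightarrow> (\<forall>i\<in>I. (\<lambda>t\<in>{0..}. v i t \<omega>) \<in> E0 i)" for \<omega>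
    using K by (auto simp: E0_iff Ki_def)
  have "prob {\<omega> \<in> space M. (\<forall>(i, t)\<in>J. v i t \<omega> \<in> A (i, t)) \<and>
      (\<forall>(i, u)\<in>K. shift s (path \<omega>) i u \<in> C (i, u))} =
    prob {\<omega> \<in> space M. \<forall>i\<in>I. (\<lambda>t\<in>{0..}. v i t \<omega>) \<in> EA i \<inter> EC i}"
    unfolding JI KI by (rule arg_cong[where f=prob]) auto
  also have "\<dots> = (\<Prod>i\<in>I. prob {\<omega> \<in> space M. (\<lambda>t\<in>{0..}. v i t \<omega>) \<in> EA i} *
      prob {\<omega> \<in> space M. (\<lambda>t\<in>{0..}. v i t \<omega>) \<in> E0 i})"
    by (subst prob_paths) (auto intro!: sets.Int EA EC prod.cong simp: agent[simplified])
  also have "\<dots> = prob {\<omega> \<in> space M. \<forall>(i, t)\<in>J. v i t \<omega> \<in> A (i, t)} *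
    prob {\<omega> \<in> space M. \<forall>(i, u)\<in>K. v i u \<omega> \<in> C (i, u)}"
    unfolding JI K0 prod.distrib by (subst (1 2) prob_paths) (auto intro!: EA E0)
  finally show ?thesis .
qed

abbreviation path_space :: "('i \<times> real \<Rightarrow> real) measure" where
  "path_space \<equiv> PiM (I \<times> {0..}) (\<lambda>_. borel)"

text \<open>Makes a family of paths a point of a product space, so that arbitrary Borel functionals
  of a restarted path can be integrated.\<close>

definition path_of :: "('i \<Rightarrow> real \<Rightarrow> real) \<Rightarrow> 'i \<times> real \<Rightarrow> real" where
  "path_of w = (\<lambda>(i, t)\<in>I \<times> {0..}. w i t)"

lemma path_of_space [simp]: "path_of w \<in> space path_space"
  by (simp add: path_of_def space_PiM)

lemma path_of_cylinder:
  assumes "K \<subseteq> I \<times> {0..}"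
  shows "path_of w \<in> {p \<in> space path_space. \<forall>j\<in>K. c j < p j} \<longleftrightarrow> (\<forall>(i, u)\<in>K. w i u \<in> {c (i, u)<..})"
proof -
  have "c j < path_of w j \<longleftrightarrow> (case j of (i, u) \<Rightarrow> w i u \<in> {c (i, u)<..})" if "j \<in> K" for j
    using assms that by (auto simp: path_of_def)
  then show ?thesis by simp
qed

lemma measurable_path_of_shift:
  assumes "\<sigma> \<in> borel_measurable M" "\<And>\<omega>. \<omega> \<in> space M \<Longrightarrow> 0 \<le> \<sigma> \<omega>"
  shows "(\<lambda>\<omega>. path_of (shift (\<sigma> \<omega>) (path \<omega>))) \<in> measurable M path_space"
  unfolding path_of_def
proof (rule measurable_restrict)
  fix k :: "'i \<times> real" assume k: "k \<in> I \<times> {0..}"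
  have "(\<lambda>x. shift (\<sigma> x) (path x) (fst k) (snd k)) \<in> borel_measurable M"
    using k by (intro measurable_shift_random[where X="\<lambda>x. x"] assms) auto
  then show "(\<lambda>x. case k of (i, t) \<Rightarrow> shift (\<sigma> x) (path x) i t) \<in> borel_measurable M"
    by (simp add: case_prod_beta)
qed

lemma shift_0: "\<omega> \<in> space M \<Longrightarrow> path_of (shift 0 (path \<omega>)) = path_of (path \<omega>)"
  by (auto simp: path_of_def shift_def start_zero_family fun_eq_iff)

lemma measurable_path_of [measurable]: "(\<lambda>\<omega>. path_of (path \<omega>)) \<in> measurable M path_space"
  using measurable_path_of_shift[of "\<lambda>_. 0"] by (simp add: shift_0 cong: measurable_cong)

text \<open>Uniqueness of measures is used twice. With a cylinder fixed in the past, both sides are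
  measures in the future event and agree on cylinders; with an arbitrary future event then fixed,
  both sides are measures in the past event.\<close>

lemma markov_sets:
  assumes s: "0 \<le> s" and B: "B \<in> sets (past s)" and C: "C \<in> sets path_space"
  shows "emeasure M {\<omega> \<in> B. path_of (shift s (path \<omega>)) \<in> C} =
    emeasure M B * emeasure M {\<omega> \<in> space M. path_of (path \<omega>) \<in> C}"
proof -
  let ?Q = "path_space" and ?P = "PiM (I \<times> {0..s}) (\<lambda>_. borel) :: ('i \<times> real \<Rightarrow> real) measure"
  let ?Y = "\<lambda>\<omega>. path_of (shift s (path \<omega>))" and ?V = "\<lambda>\<omega>. path_of (path \<omega>)"
  let ?X = "\<lambda>\<omega>. \<lambda>(i, t)\<in>I \<times> {0..s}. v i t \<omega>"
  have Y [measurable]: "?Y \<in> measurable M ?Q"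
    using measurable_path_of_shift[of "\<lambda>_. s"] s by simp
  note em = emeasure_distr_density_indicator and ec = emeasure_distr_density_const
  have fin: "finite_measure (distr (density M (indicator E)) N f)"
    if "E \<in> sets M" "f \<in> measurable M N" for E f and N :: "('i \<times> real \<Rightarrow> real) measure"
    using em[OF that sets.top] by (intro finite_measureI) (simp add: emeasure_eq_measure)
  have sets_cyl: "{p \<in> space (PiM K (\<lambda>_. borel)). \<forall>j\<in>J. a j < (p j :: real)} \<in> sets (PiM K (\<lambda>_. borel))"
    if "finite J" "J \<subseteq> K" for J K and a :: "'i \<times> real \<Rightarrow> real"
    using that by (intro sets.sets_Collect_finite_All borel_measurable_less borel_measurable_const
      measurable_component_singleton) auto
  have cyl: "emeasure M {\<omega> \<in> B. ?Y \<omega> \<in> C} = emeasure M B * emeasure M {\<omega> \<in> space M. ?V \<omega> \<in> C}"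
    if J: "finite J" "J \<subseteq> I \<times> {0..s}" and BJ: "B = {\<omega> \<in> space M. \<forall>(i, t)\<in>J. a (i, t) < v i t \<omega>}"
      and C: "C \<in> sets path_space"
    for B J C and a :: "'i \<times> real \<Rightarrow> real"
  proof -
    have B: "B \<in> sets M"
    proof -
      have "B = ?X -` {p \<in> space ?P. \<forall>j\<in>J. a j < p j} \<inter> space M"
        unfolding BJ using J by (auto simp: space_PiM)
      then show ?thesis using measurable_sets[OF measurable_process_tuple sets_cyl[OF J]] by simp
    qed
    have "distr (density M (indicator B)) ?Q ?Y = distr (density M (\<lambda>_. emeasure M B)) ?Q ?V"
    proof (rule PiM_borel_eqI)
      fix K :: "('i \<times> real) set" and c :: "'i \<times> real \<Rightarrow> real" assume K: "finite K" "K \<subseteq> I \<times> {0..}"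
      let ?C = "{p \<in> space ?Q. \<forall>j\<in>K. c j < p j}"
      have "{\<omega> \<in> B. ?Y \<omega> \<in> ?C} = {\<omega> \<in> space M. (\<forall>(i, t)\<in>J. v i t \<omega> \<in> {a (i, t)<..}) \<and>
          (\<forall>(i, u)\<in>K. shift s (path \<omega>) i u \<in> {c (i, u)<..})}"
        unfolding path_of_cylinder[OF K(2)] BJ by auto
      moreover have "{\<omega> \<in> space M. ?V \<omega> \<in> ?C} = {\<omega> \<in> space M. \<forall>(i, u)\<in>K. v i u \<omega> \<in> {c (i, u)<..}}"
        unfolding path_of_cylinder[OF K(2)] ..
      moreover have "B = {\<omega> \<in> space M. \<forall>(i, t)\<in>J. v i t \<omega> \<in> {a (i, t)<..}}" using BJ by auto
      ultimately have "emeasure M {\<omega> \<in> B. ?Y \<omega> \<in> ?C} = emeasure M B * emeasure M {\<omega> \<in> space M. ?V \<omega> \<in> ?C}"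
        using markov_cylinders[OF s J K, of "\<lambda>j. {a j<..}" "\<lambda>k. {c k<..}"]
        by (simp add: emeasure_eq_measure ennreal_mult)
      then show "emeasure (distr (density M (indicator B)) ?Q ?Y) ?C =
          emeasure (distr (density M (\<lambda>_. emeasure M B)) ?Q ?V) ?C"
        using sets_cyl[OF K] B by (simp add: em ec Y)
    qed (use fin B Y in auto)
    then show ?thesis using em[OF B Y C] ec[OF measurable_path_of C] by simp
  qed
  have YC: "{\<omega> \<in> space M. ?Y \<omega> \<in> C} \<in> sets M" using C by measurable
  have "distr (density M (indicator {\<omega> \<in> space M. ?Y \<omega> \<in> C})) ?P ?X =
      distr (density M (\<lambda>_. emeasure M {\<omega> \<in> space M. ?V \<omega> \<in> C})) ?P ?X"
  proof (rule PiM_borel_eqI)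
    fix J :: "('i \<times> real) set" and a :: "'i \<times> real \<Rightarrow> real" assume J: "finite J" "J \<subseteq> I \<times> {0..s}"
    let ?A = "{p \<in> space ?P. \<forall>j\<in>J. a j < p j}"
    have A: "{\<omega> \<in> space M. ?X \<omega> \<in> ?A} = {\<omega> \<in> space M. \<forall>(i, t)\<in>J. a (i, t) < v i t \<omega>}"
      using J by (auto simp: space_PiM)
    have "{\<omega> \<in> {\<omega> \<in> space M. ?Y \<omega> \<in> C}. ?X \<omega> \<in> ?A} = {\<omega> \<in> {\<omega> \<in> space M. \<forall>(i, t)\<in>J. a (i, t) < v i t \<omega>}. ?Y \<omega> \<in> C}"
      using A by blast
    then show "emeasure (distr (density M (indicator {\<omega> \<in> space M. ?Y \<omega> \<in> C})) ?P ?X) ?A =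
        emeasure (distr (density M (\<lambda>_. emeasure M {\<omega> \<in> space M. ?V \<omega> \<in> C})) ?P ?X) ?A"
      using cyl[OF J refl C, of a] A
      by (simp add: em[OF YC measurable_process_tuple sets_cyl[OF J]]
        ec[OF measurable_process_tuple sets_cyl[OF J]] mult.commute)
  qed (use fin YC in auto)
  moreover obtain D where D: "D \<in> sets ?P" "B = ?X -` D \<inter> space M"
    using B unfolding past_def by (subst (asm) sets_vimage_algebra2) (auto simp: space_PiM)
  ultimately have "emeasure M {\<omega> \<in> {\<omega> \<in> space M. ?Y \<omega> \<in> C}. ?X \<omega> \<in> D} =
      emeasure M {\<omega> \<in> space M. ?V \<omega> \<in> C} * emeasure M {\<omega> \<in> space M. ?X \<omega> \<in> D}"
    using em[OF YC measurable_process_tuple D(1)] ec[OF measurable_process_tuple D(1)] by simp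
  moreover have "{\<omega> \<in> {\<omega> \<in> space M. ?Y \<omega> \<in> C}. ?X \<omega> \<in> D} = {\<omega> \<in> B. ?Y \<omega> \<in> C}"
    "{\<omega> \<in> space M. ?X \<omega> \<in> D} = B"
    using D by auto
  ultimately show ?thesis by (simp add: mult.commute)
qed

end

section \<open>The strong Markov property at event times\<close>

lemma nn_integral_distr_density_indicator:
  assumes "E \<in> sets M" "f \<in> measurable M N" "g \<in> borel_measurable N"
  shows "(\<integral>\<^sup>+p. g p \<partial>distr (density M (indicator E)) N f) = (\<integral>\<^sup>+\<omega>. indicator E \<omega> * g (f \<omega>) \<partial>M)"
  using assms by (simp add: nn_integral_distr nn_integral_density)

lemma nn_integral_distr_density_const:
  assumes "f \<in> measurable M N" "g \<in> borel_measurable N"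
  shows "(\<integral>\<^sup>+p. g p \<partial>distr (density M (\<lambda>_. c)) N f) = c * (\<integral>\<^sup>+\<omega>. g (f \<omega>) \<partial>M)"
  using assms by (simp add: nn_integral_distr nn_integral_density nn_integral_cmult)

definition ramp :: "nat \<Rightarrow> real \<Rightarrow> real \<Rightarrow> real" where
  "ramp m a x = max 0 (min 1 (real m * (x - a)))"

lemma ramp_bounds: "0 \<le> ramp m a x" "ramp m a x \<le> 1"
  by (auto simp: ramp_def)

lemma continuous_ramp: "continuous_on UNIV (ramp m a)"
  unfolding ramp_def by (intro continuous_intros)

lemma ramp_tendsto: "(\<lambda>m. ramp m a x) \<longlonglongrightarrow> indicator {a<..} x"
proof (cases "a < x")
  case True
  then obtain k :: nat where k: "1 < real k * (x - a)" using ex_less_of_nat_mult[of "x - a" 1] by auto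
  have "ramp m a x = 1" if "k \<le> m" for m
  proof -
    have "real k * (x - a) \<le> real m * (x - a)" using that True by (intro mult_right_mono) auto
    then show ?thesis using k by (simp add: ramp_def)
  qed
  then have "\<forall>\<^sub>F m in sequentially. ramp m a x = indicator {a<..} x"
    using True by (auto simp: eventually_sequentially)
  then show ?thesis by (rule tendsto_eventually)
next
  case False
  then have "ramp m a x = indicator {a<..} x" for m
    using mult_nonneg_nonpos[of "real m" "x - a"] by (auto simp: ramp_def)
  then show ?thesis by simp
qed

context brownian_family
begin

lemma nn_integral_markov:
  assumes s: "0 \<le> s" and B: "B \<in> sets (past s)" and g: "g \<in> borel_measurable path_space"
  shows "(\<integral>\<^sup>+\<omega>. indicator B \<omega> * g (path_of (shift s (path \<omega>))) \<partial>M) =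
    emeasure M B * (\<integral>\<^sup>+\<omega>. g (path_of (path \<omega>)) \<partial>M)"
proof -
  have Y: "(\<lambda>\<omega>. path_of (shift s (path \<omega>))) \<in> measurable M path_space"
    using measurable_path_of_shift[of "\<lambda>_. s"] s by simp
  have BM: "B \<in> sets M" using B sets_past_subset by auto
  have "distr (density M (indicator B)) path_space (\<lambda>\<omega>. path_of (shift s (path \<omega>))) =
      distr (density M (\<lambda>_. emeasure M B)) path_space (\<lambda>\<omega>. path_of (path \<omega>))"
    by (rule measure_eqI) (simp_all add: markov_sets[OF s B] emeasure_distr_density_indicator[OF BM Y]
        emeasure_distr_density_const[OF measurable_path_of])
  then show ?thesis
    by (simp flip: nn_integral_distr_density_indicator[OF BM Y g]
      nn_integral_distr_density_const[OF measurable_path_of g])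
qed

text \<open>On the piece \<open>A' k\<close> the rounded time is the constant \<open>s k\<close>,
  and this piece is a difference of two events known by time \<open>s k\<close>; the fixed-time
  property applies and the pieces are summed. Only the joint events with \<open>A\<close> have to be
  known, so off \<open>A\<close> the time \<open>\<sigma>\<close> need not be a stopping
  time.\<close>

lemma strong_markov_grid_above:
  assumes \<sigma>: "\<sigma> \<in> borel_measurable M" "\<And>\<omega>. \<omega> \<in> space M \<Longrightarrow> 0 \<le> \<sigma> \<omega>" and A: "A \<in> sets M"
    and past: "\<And>u. 0 \<le> u \<Longrightarrow> {\<omega> \<in> A. \<sigma> \<omega> < u} \<in> sets (past u)"
    and g: "g \<in> borel_measurable path_space"
  shows "(\<integral>\<^sup>+\<omega>. indicator A \<omega> * g (path_of (shift (grid_above n (\<sigma> \<omega>)) (path \<omega>))) \<partial>M) =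
    emeasure M A * (\<integral>\<^sup>+\<omega>. g (path_of (path \<omega>)) \<partial>M)"
proof -
  have [measurable]: "\<sigma> \<in> borel_measurable M" by fact
  define s where "s k = (real k + 1) / Suc n" for k :: nat
  define A' where "A' k = {\<omega> \<in> A. nat \<lfloor>\<sigma> \<omega> * Suc n\<rfloor> = k}" for k :: nat
  have s: "0 \<le> s k" for k by (simp add: s_def)
  have A_sp: "A \<subseteq> space M" using sets.sets_into_space[OF A] .
  have A': "A' k \<in> sets (past (s k))" for k
  proof -
    have "nat \<lfloor>\<sigma> \<omega> * Suc n\<rfloor> = k \<longleftrightarrow> real k / Suc n \<le> \<sigma> \<omega> \<and> \<sigma> \<omega> < s k" if "\<omega> \<in> A" for \<omega>
    proof -
      have "0 \<le> \<sigma> \<omega> * Suc n" using \<sigma>(2) A_sp that by auto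
      then have "nat \<lfloor>\<sigma> \<omega> * Suc n\<rfloor> = k \<longleftrightarrow> \<lfloor>\<sigma> \<omega> * Suc n\<rfloor> = int k" by auto
      also have "\<dots> \<longleftrightarrow> real k \<le> \<sigma> \<omega> * Suc n \<and> \<sigma> \<omega> * Suc n < real k + 1"
        by (simp add: floor_eq_iff)
      also have "\<dots> \<longleftrightarrow> real k / Suc n \<le> \<sigma> \<omega> \<and> \<sigma> \<omega> < s k"
        by (simp only: s_def pos_less_divide_eq pos_divide_le_eq of_nat_0_less_iff zero_less_Suc)
      finally show ?thesis .
    qed
    then have "A' k = {\<omega> \<in> A. real k / Suc n \<le> \<sigma> \<omega> \<and> \<sigma> \<omega> < s k}" unfolding A'_def by blast
    also have "\<dots> = {\<omega> \<in> A. \<sigma> \<omega> < s k} - {\<omega> \<in> A. \<sigma> \<omega> < real k / Suc n}" by force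
    finally have eq: "A' k = {\<omega> \<in> A. \<sigma> \<omega> < s k} - {\<omega> \<in> A. \<sigma> \<omega> < real k / Suc n}" .
    have "{\<omega> \<in> A. \<sigma> \<omega> < real k / Suc n} \<in> sets (past (real k / Suc n))"
      by (intro past) simp
    then have "{\<omega> \<in> A. \<sigma> \<omega> < real k / Suc n} \<in> sets (past (s k))"
      using sets_past_mono[of "real k / Suc n" "s k"] by (auto simp: s_def divide_right_mono)
    then show ?thesis unfolding eq using past[OF s[of k]] by auto
  qed
  have A'_M: "A' k \<in> sets M" for k using A' sets_past_subset by auto
  have part: "indicator A \<omega> * f (nat \<lfloor>\<sigma> \<omega> * Suc n\<rfloor>) = (\<Sum>k. indicator (A' k) \<omega> * f k)"
    for \<omega> and f :: "nat \<Rightarrow> ennreal"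
  proof -
    have "(\<Sum>k. indicator (A' k) \<omega> * f k) = (\<Sum>k\<in>{nat \<lfloor>\<sigma> \<omega> * Suc n\<rfloor>}. indicator (A' k) \<omega> * f k)"
      by (rule suminf_finite) (auto simp: A'_def)
    then show ?thesis by (auto simp: A'_def indicator_def)
  qed
  have Y: "(\<lambda>\<omega>. path_of (shift (s k) (path \<omega>))) \<in> measurable M path_space" for k
    using measurable_path_of_shift[of "\<lambda>_. s k"] s by simp
  have "(\<integral>\<^sup>+\<omega>. indicator A \<omega> * g (path_of (shift (grid_above n (\<sigma> \<omega>)) (path \<omega>))) \<partial>M) =
      (\<integral>\<^sup>+\<omega>. (\<Sum>k. indicator (A' k) \<omega> * g (path_of (shift (s k) (path \<omega>)))) \<partial>M)"
    using part[of _ "\<lambda>k. g (path_of (shift (s k) (path _)))"]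
    by (intro nn_integral_cong) (simp add: grid_above_def s_def)
  also have "\<dots> = (\<Sum>k. \<integral>\<^sup>+\<omega>. indicator (A' k) \<omega> * g (path_of (shift (s k) (path \<omega>))) \<partial>M)"
    using A'_M measurable_compose[OF Y g]
    by (intro nn_integral_suminf borel_measurable_times_ennreal borel_measurable_indicator) auto
  also have "\<dots> = (\<Sum>k. emeasure M (A' k) * (\<integral>\<^sup>+\<omega>. g (path_of (path \<omega>)) \<partial>M))"
    using nn_integral_markov[OF s A' g] by simp
  also have "\<dots> = (\<Sum>k. emeasure M (A' k)) * (\<integral>\<^sup>+\<omega>. g (path_of (path \<omega>)) \<partial>M)"
    by (rule ennreal_suminf_multc)
  also have "(\<Sum>k. emeasure M (A' k)) = emeasure M (\<Union>k. A' k)"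
    using A'_M by (intro suminf_emeasure) (auto simp: disjoint_family_on_def A'_def)
  also have "(\<Union>k. A' k) = A" by (auto simp: A'_def)
  finally show ?thesis .
qed

text \<open>Rounding \<open>\<sigma>\<close> strictly up to a grid reduces the claim to the Markov property at fixed times, which
  is why only the events \<open>\<sigma> < u\<close> have to belong to the past of \<open>u\<close>. Path continuity removes the rounding
  for continuous test functions of finitely many coordinates.\<close>

theorem strong_markov:
  assumes \<sigma>: "\<sigma> \<in> borel_measurable M" "\<And>\<omega>. \<omega> \<in> space M \<Longrightarrow> 0 \<le> \<sigma> \<omega>" and A: "A \<in> sets M"
    and past: "\<And>u. 0 \<le> u \<Longrightarrow> {\<omega> \<in> A. \<sigma> \<omega> < u} \<in> sets (past u)"
    and g: "g \<in> borel_measurable path_space"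
  shows "(\<integral>\<^sup>+\<omega>. indicator A \<omega> * g (path_of (shift (\<sigma> \<omega>) (path \<omega>))) \<partial>M) =
    emeasure M A * (\<integral>\<^sup>+\<omega>. g (path_of (path \<omega>)) \<partial>M)"
proof -
  note [measurable] = A
  let ?Q = "path_space"
  let ?Z = "\<lambda>\<omega>. path_of (shift (\<sigma> \<omega>) (path \<omega>))" and ?V = "\<lambda>\<omega>. path_of (path \<omega>)"
  have Z [measurable]: "?Z \<in> measurable M ?Q" by (rule measurable_path_of_shift[OF \<sigma>])
  have Zn [measurable]: "(\<lambda>\<omega>. path_of (shift (grid_above n (\<sigma> \<omega>)) (path \<omega>))) \<in> measurable M ?Q" for n
    using \<sigma>(1) by (intro measurable_path_of_shift grid_above_nonneg) (simp add: grid_above_def)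
  have A_le: "(\<integral>\<^sup>+\<omega>. indicator A \<omega> \<partial>M) < \<infinity>"
    by (simp add: emeasure_eq_measure less_top[symmetric])
  have "distr (density M (indicator A)) ?Q ?Z = distr (density M (\<lambda>_. emeasure M A)) ?Q ?V"
  proof (rule PiM_borel_eqI)
    show "finite_measure (distr (density M (indicator A)) ?Q ?Z)"
      using emeasure_distr_density_indicator[OF A Z sets.top]
      by (intro finite_measureI) (simp add: emeasure_eq_measure)
    fix J :: "('i \<times> real) set" and a :: "'i \<times> real \<Rightarrow> real"
    assume J: "finite J" "J \<subseteq> I \<times> {0..}"
    define G where "G m p = ennreal (\<Prod>j\<in>J. ramp m (a j) (p j))" for m and p :: "'i \<times> real \<Rightarrow> real"
    define C where "C = {p \<in> space ?Q. \<forall>j\<in>J. a j < p j}"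
    have comp: "(\<lambda>p. p j) \<in> borel_measurable ?Q" if "j \<in> J" for j
      using that J by (intro measurable_component_singleton) auto
    have C [measurable]: "C \<in> sets ?Q"
      unfolding C_def using J comp
      by (intro sets.sets_Collect_finite_All borel_measurable_less borel_measurable_const) auto
    have G [measurable]: "G m \<in> borel_measurable ?Q" for m
      unfolding G_def using comp borel_measurable_continuous_onI[OF continuous_ramp]
      by (intro measurable_compose[OF _ measurable_ennreal] borel_measurable_prod measurable_compose[OF comp]) auto
    have G_le: "G m p \<le> 1" for m p
      unfolding G_def using ramp_bounds by (subst ennreal_1[symmetric], intro ennreal_leI prod_le_1) auto
    have G_lim: "(\<lambda>m. G m p) \<longlonglongrightarrow> indicator C p" if "p \<in> space ?Q" for p
    proof -
      have "(\<lambda>m. G m p) \<longlonglongrightarrow> ennreal (\<Prod>j\<in>J. indicator {a j<..} (p j))"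
        unfolding G_def by (intro tendsto_ennrealI tendsto_prod ramp_tendsto)
      also have "(\<Prod>j\<in>J. indicator {a j<..} (p j)) = (indicator C p :: real)"
        using that J(1) by (auto simp: C_def indicator_def prod_zero_iff)
      finally show ?thesis by (simp add: ennreal_indicator)
    qed
    \<comment> \<open>The order of the limits matters: rounding is removed for a fixed ramp, because
      the indicator of \<open>C\<close> is discontinuous; only then are the ramps sharpened to the
      indicator.\<close>
    have step1: "(\<integral>\<^sup>+\<omega>. indicator A \<omega> * G m (?Z \<omega>) \<partial>M) = emeasure M A * (\<integral>\<^sup>+\<omega>. G m (?V \<omega>) \<partial>M)" for m
    proof (rule LIMSEQ_unique)
      let ?f = "\<lambda>n \<omega>. indicator A \<omega> * G m (path_of (shift (grid_above n (\<sigma> \<omega>)) (path \<omega>)))"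
      show "(\<lambda>n. \<integral>\<^sup>+\<omega>. ?f n \<omega> \<partial>M) \<longlonglongrightarrow> (\<integral>\<^sup>+\<omega>. indicator A \<omega> * G m (?Z \<omega>) \<partial>M)"
      proof (rule nn_integral_dominated_convergence[where w="indicator A"])
        show "AE \<omega> in M. ?f n \<omega> \<le> indicator A \<omega>" for n
          using G_le by (auto simp: indicator_def)
        have "(\<lambda>n. ?f n \<omega>) \<longlonglongrightarrow> indicator A \<omega> * G m (?Z \<omega>)" if \<omega>: "\<omega> \<in> space M" for \<omega>
        proof -
          have "(\<lambda>n. path_of (shift (grid_above n (\<sigma> \<omega>)) (path \<omega>)) j) \<longlonglongrightarrow> ?Z \<omega> j" if j: "j \<in> J" for j
          proof -
            obtain i u where iu: "j = (i, u)" "i \<in> I" "0 \<le> u" using j J by auto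
            have "(\<lambda>n. shift (grid_above n (\<sigma> \<omega>)) (path \<omega>) i u) \<longlonglongrightarrow> shift (\<sigma> \<omega>) (path \<omega>) i u"
              unfolding shift_def
              using path_tendsto_grid_above[OF continuous_process_path[OF \<omega> iu(2)] \<sigma>(2)[OF \<omega>], of u]
                path_tendsto_grid_above[OF continuous_process_path[OF \<omega> iu(2)] \<sigma>(2)[OF \<omega>], of 0] iu(3)
              by (intro tendsto_diff) auto
            then show ?thesis using iu by (simp add: path_of_def)
          qed
          then have "(\<lambda>n. G m (path_of (shift (grid_above n (\<sigma> \<omega>)) (path \<omega>)))) \<longlonglongrightarrow> G m (?Z \<omega>)"
            unfolding G_def
            by (intro tendsto_ennrealI tendsto_prod continuous_on_tendsto_compose[OF continuous_ramp]) auto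
          then show ?thesis by (cases "\<omega> \<in> A") simp_all
        qed
        then show "AE \<omega> in M. (\<lambda>n. ?f n \<omega>) \<longlonglongrightarrow> indicator A \<omega> * G m (?Z \<omega>)" by (intro AE_I2)
      qed (use A_le in measurable)
      show "(\<lambda>n. \<integral>\<^sup>+\<omega>. ?f n \<omega> \<partial>M) \<longlonglongrightarrow> emeasure M A * (\<integral>\<^sup>+\<omega>. G m (?V \<omega>) \<partial>M)"
        by (simp add: strong_markov_grid_above[OF \<sigma> A past G])
    qed
    have lim1: "(\<lambda>m. \<integral>\<^sup>+\<omega>. indicator A \<omega> * G m (?Z \<omega>) \<partial>M) \<longlonglongrightarrow> (\<integral>\<^sup>+\<omega>. indicator A \<omega> * indicator C (?Z \<omega>) \<partial>M)"
    proof (rule nn_integral_dominated_convergence[where w="indicator A"])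
      show "AE \<omega> in M. indicator A \<omega> * G n (?Z \<omega>) \<le> indicator A \<omega>" for n
        using G_le by (auto simp: indicator_def)
      have "(\<lambda>n. indicator A \<omega> * G n (?Z \<omega>)) \<longlonglongrightarrow> indicator A \<omega> * indicator C (?Z \<omega>)" for \<omega>
        using G_lim[OF path_of_space, of "shift (\<sigma> \<omega>) (path \<omega>)"] by (cases "\<omega> \<in> A") simp_all
      then show "AE \<omega> in M. (\<lambda>n. indicator A \<omega> * G n (?Z \<omega>)) \<longlonglongrightarrow> indicator A \<omega> * indicator C (?Z \<omega>)"
        by (intro AE_I2)
    qed (use A_le in measurable)
    have lim2: "(\<lambda>m. \<integral>\<^sup>+\<omega>. G m (?V \<omega>) \<partial>M) \<longlonglongrightarrow> (\<integral>\<^sup>+\<omega>. indicator C (?V \<omega>) \<partial>M)"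
    proof (rule nn_integral_dominated_convergence[where w="\<lambda>_. 1"])
      show "AE \<omega> in M. (\<lambda>n. G n (?V \<omega>)) \<longlonglongrightarrow> indicator C (?V \<omega>)"
        using G_lim[OF path_of_space] by (intro AE_I2)
      show "(\<integral>\<^sup>+\<omega>. 1 \<partial>M) < \<infinity>" by (simp add: emeasure_space_1)
      show "AE \<omega> in M. G n (?V \<omega>) \<le> 1" for n using G_le by simp
    qed measurable
    have "(\<lambda>m. emeasure M A * (\<integral>\<^sup>+\<omega>. G m (?V \<omega>) \<partial>M)) \<longlonglongrightarrow>
        emeasure M A * (\<integral>\<^sup>+\<omega>. indicator C (?V \<omega>) \<partial>M)"
      by (intro ennreal_tendsto_cmult lim2) (simp add: emeasure_eq_measure)
    with lim1 have "(\<integral>\<^sup>+\<omega>. indicator A \<omega> * indicator C (?Z \<omega>) \<partial>M) =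
        emeasure M A * (\<integral>\<^sup>+\<omega>. indicator C (?V \<omega>) \<partial>M)"
      unfolding step1 by (rule LIMSEQ_unique)
    then have "(\<integral>\<^sup>+p. indicator C p \<partial>distr (density M (indicator A)) ?Q ?Z) =
        (\<integral>\<^sup>+p. indicator C p \<partial>distr (density M (\<lambda>_. emeasure M A)) ?Q ?V)"
      using nn_integral_distr_density_indicator[OF A Z, of "indicator C"]
        nn_integral_distr_density_const[OF measurable_path_of, of "indicator C" "emeasure M A"]
      by simp
    then show "emeasure (distr (density M (indicator A)) ?Q ?Z) {p \<in> space ?Q. \<forall>j\<in>J. a j < p j} =
        emeasure (distr (density M (\<lambda>_. emeasure M A)) ?Q ?V) {p \<in> space ?Q. \<forall>j\<in>J. a j < p j}"
      using C unfolding C_def by simp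
  qed simp_all
  then show ?thesis
    by (simp flip: nn_integral_distr_density_indicator[OF A Z g]
      nn_integral_distr_density_const[OF measurable_path_of g])
qed

end

section \<open>Renewal at event times\<close>

text \<open>Lets \<open>exit_time\<close> be evaluated through \<open>path_of\<close>, which leaves
  the values of the agents at nonnegative times unchanged.\<close>

lemma exit_time_cong:
  assumes "\<And>i q. i \<in> I \<Longrightarrow> 0 \<le> q \<Longrightarrow> w i q = w' i q"
  shows "exit_time I w = exit_time I w'"
proof -
  have "(0 \<le> q \<and> (\<exists>i\<in>I. r < \<bar>w i (of_rat q)\<bar>)) \<longleftrightarrow> (0 \<le> q \<and> (\<exists>i\<in>I. r < \<bar>w' i (of_rat q)\<bar>))" for q r
    using assms[of _ "of_rat q"] by (auto simp: zero_le_of_rat_iff)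
  then show ?thesis unfolding exit_time_def by simp
qed

context brownian_family
begin

text \<open>One functional for three purposes: the reward 1 gives the mean cycle length, the squared
  difference gives the mean cost of a cycle, and the indicator of the ages from \<open>a\<close> on
  gives the part of the mean length beyond \<open>a\<close>.\<close>

definition cycle_mean :: "(real \<times> real \<Rightarrow> ennreal) \<Rightarrow> 'i \<Rightarrow> 'i \<Rightarrow> ennreal" where
  "cycle_mean h i j = (\<integral>\<^sup>+u. (\<integral>\<^sup>+\<omega>. (if 0 \<le> u \<and> ennreal u < first_exit \<omega>
     then h (u, v i u \<omega> - v j u \<omega>) else 0) \<partial>M) \<partial>lborel)"

definition cycle_rate :: "(real \<times> real \<Rightarrow> ennreal) \<Rightarrow> 'i \<Rightarrow> 'i \<Rightarrow> nat \<Rightarrow> real \<Rightarrow> 'a \<Rightarrow> ennreal" where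
  "cycle_rate h i j k t \<omega> = (if 0 \<le> t \<and> event_at k \<omega> \<le> ennreal t \<and> ennreal t < event_at (Suc k) \<omega>
     then h (t - enn2real (event_at k \<omega>),
       shift (enn2real (event_at k \<omega>)) (path \<omega>) i (t - enn2real (event_at k \<omega>)) -
       shift (enn2real (event_at k \<omega>)) (path \<omega>) j (t - enn2real (event_at k \<omega>))) else 0)"

lemma cycle_rate_time:
  assumes "0 \<le> t" "event_at k \<omega> \<le> ennreal t"
  shows "enn2real (event_at k \<omega>) \<le> t"
    "event_at k \<omega> = ennreal (enn2real (event_at k \<omega>))"
proof -
  from assms have "event_at k \<omega> < \<top>" using le_less_trans[OF assms(2) ennreal_less_top] by simp
  then show *: "event_at k \<omega> = ennreal (enn2real (event_at k \<omega>))" by simp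
  show "enn2real (event_at k \<omega>) \<le> t"
    using assms * by (metis ennreal_le_iff)
qed

lemma measurable_cycle_rate:
  assumes ij: "i \<in> I" "j \<in> I" and h [measurable]: "h \<in> borel_measurable (borel \<Otimes>\<^sub>M borel)"
  shows "(\<lambda>(t, \<omega>). cycle_rate h i j k t \<omega>) \<in> borel_measurable (lborel \<Otimes>\<^sub>M M)"
proof -
  note [measurable] = measurable_reset_time[of k] measurable_reset_time[of "Suc k"]
  let ?s = "\<lambda>x. enn2real (reset_time I (path (snd x)) k)"
  let ?u = "\<lambda>x. max 0 (fst x - enn2real (reset_time I (path (snd x)) k))"
  have [measurable]: "(\<lambda>x. shift (?s x) (path (snd x)) i (?u x)) \<in> borel_measurable (lborel \<Otimes>\<^sub>M M)"
    "(\<lambda>x. shift (?s x) (path (snd x)) j (?u x)) \<in> borel_measurable (lborel \<Otimes>\<^sub>M M)"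
    using ij by (intro measurable_shift_random; measurable; simp)+
  have "(\<lambda>x. if 0 \<le> fst x \<and> reset_time I (path (snd x)) k \<le> ennreal (fst x) \<and>
        ennreal (fst x) < reset_time I (path (snd x)) (Suc k)
      then h (?u x, shift (?s x) (path (snd x)) i (?u x) - shift (?s x) (path (snd x)) j (?u x))
      else 0) \<in> borel_measurable (lborel \<Otimes>\<^sub>M M)"
    by measurable
  also have "?this \<longleftrightarrow> ?thesis"
    using cycle_rate_time(1)
    by (intro measurable_cong) (auto simp: cycle_rate_def case_prod_beta max_def simp del: reset_time.simps)
  finally show ?thesis .
qed

lemma measurable_exit_time_path: "(\<lambda>\<omega>. first_exit \<omega>) \<in> borel_measurable M"
  by (intro measurable_exit_time finite_index measurable_process)

lemma measurable_before_exit_time: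
  assumes ij: "i \<in> I" "j \<in> I" and h [measurable]: "h \<in> borel_measurable (borel \<Otimes>\<^sub>M borel)"
  shows "(\<lambda>(u, \<omega>). if 0 \<le> u \<and> ennreal u < first_exit \<omega> then h (u, v i u \<omega> - v j u \<omega>) else 0)
    \<in> borel_measurable (lborel \<Otimes>\<^sub>M M)"
proof -
  have [measurable]: "(\<lambda>x. exit_time I (path (snd x))) \<in> borel_measurable (lborel \<Otimes>\<^sub>M M)"
    using ij by (intro measurable_exit_time finite_index measurable_compose[OF measurable_snd] measurable_process) auto
  have [measurable]: "(\<lambda>x. v i (max 0 (fst x)) (snd x)) \<in> borel_measurable (lborel \<Otimes>\<^sub>M M)"
    "(\<lambda>x. v j (max 0 (fst x)) (snd x)) \<in> borel_measurable (lborel \<Otimes>\<^sub>M M)"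
    using ij by (intro measurable_process_random; measurable; simp)+
  have "(\<lambda>x. (if 0 \<le> fst x \<and> ennreal (fst x) < exit_time I (path (snd x))
      then h (fst x, v i (max 0 (fst x)) (snd x) - v j (max 0 (fst x)) (snd x)) else 0))
      \<in> borel_measurable (lborel \<Otimes>\<^sub>M M)"
    by measurable
  also have "?this \<longleftrightarrow> ?thesis"
    by (intro measurable_cong) (auto simp: max_def)
  finally show ?thesis .
qed

text \<open>Wald's identity for a single cycle: whether it begins by time \<open>m\<close> is
  decided at its beginning, and from there the path restarts afresh. The cycle is counted in full,
  also where it extends beyond \<open>m\<close>.\<close>

lemma renewal:
  assumes ij: "i \<in> I" "j \<in> I" and h [measurable]: "h \<in> borel_measurable (borel \<Otimes>\<^sub>M borel)" and m: "0 \<le> m"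
  shows "(\<integral>\<^sup>+t. \<integral>\<^sup>+\<omega>. (if event_at k \<omega> \<le> ennreal m then cycle_rate h i j k t \<omega> else 0) \<partial>M \<partial>lborel) =
    emeasure M {\<omega> \<in> space M. event_at k \<omega> \<le> ennreal m} * cycle_mean h i j"
proof -
  note [measurable] = measurable_reset_time[of k] measurable_cycle_rate[OF ij h]
  interpret P: pair_sigma_finite lborel M ..
  define \<sigma> where "\<sigma> \<omega> = enn2real (event_at k \<omega>)" for \<omega>
  define A where "A = {\<omega> \<in> space M. event_at k \<omega> \<le> ennreal m}"
  \<comment> \<open>The reward at a fixed age \<open>u\<close> as a functional on path space, the
    form that the strong Markov property asks for.\<close>
  define F where "F u p = (if 0 \<le> u \<and> ennreal u < exit_time I (\<lambda>i t. p (i, t)) then h (u, p (i, u) - p (j, u)) else 0)"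
    for u and p :: "'i \<times> real \<Rightarrow> real"
  have [measurable]: "\<sigma> \<in> borel_measurable M" unfolding \<sigma>_def by measurable
  have A [measurable]: "A \<in> sets M" unfolding A_def by measurable
  have fin: "event_at k \<omega> = ennreal (\<sigma> \<omega>)" "0 \<le> \<sigma> \<omega>" if "\<omega> \<in> A" for \<omega>
    using cycle_rate_time(2)[OF m] that by (auto simp: A_def \<sigma>_def)
  have past: "{\<omega> \<in> A. \<sigma> \<omega> < u} \<in> sets (past u)" if "0 \<le> u" for u
  proof -
    have "{\<omega> \<in> A. \<sigma> \<omega> < u} = {\<omega> \<in> space M. event_at k \<omega> < ennreal u \<and> event_at k \<omega> \<le> ennreal m}"
      using fin by (fastforce simp: A_def ennreal_less_iff)
    then show ?thesis using reset_time_less_in_past[OF that, of k "ennreal m"] by simp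
  qed
  have F: "F u \<in> borel_measurable path_space" for u
  proof (cases "0 \<le> u")
    case True
    have comp: "(\<lambda>p. p (i, q)) \<in> borel_measurable path_space" if "i \<in> I" "0 \<le> q" for i q
      using that by (intro measurable_component_singleton) auto
    have [measurable]: "(\<lambda>p. exit_time I (\<lambda>i t. p (i, t))) \<in> borel_measurable path_space"
      by (intro measurable_exit_time finite_index comp)
    note [measurable] = comp[OF ij(1) True] comp[OF ij(2) True]
    show ?thesis unfolding F_def
      by measurable
  qed (simp add: F_def[abs_def])
  have F_path: "F u (path_of w) = (if 0 \<le> u \<and> ennreal u < exit_time I w then h (u, w i u - w j u) else 0)" for u w
  proof -
    have "exit_time I (\<lambda>i t. path_of w (i, t)) = exit_time I w" by (rule exit_time_cong) (simp add: path_of_def)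
    then show ?thesis using ij by (auto simp: F_def path_of_def)
  qed
  have [measurable]: "(\<lambda>x. exit_time I (shift (\<sigma> (snd x)) (path (snd x)))) \<in> borel_measurable (lborel \<Otimes>\<^sub>M M)"
    by (intro measurable_exit_time_shift) (auto simp: \<sigma>_def)
  have [measurable]: "(\<lambda>x. shift (\<sigma> (snd x)) (path (snd x)) i (max 0 (fst x))) \<in> borel_measurable (lborel \<Otimes>\<^sub>M M)"
    "(\<lambda>x. shift (\<sigma> (snd x)) (path (snd x)) j (max 0 (fst x))) \<in> borel_measurable (lborel \<Otimes>\<^sub>M M)"
    using ij by (intro measurable_shift_random; measurable; simp add: \<sigma>_def)+
  have "(\<lambda>x. indicator A (snd x) * (if 0 \<le> fst x \<and> ennreal (fst x) < exit_time I (shift (\<sigma> (snd x)) (path (snd x)))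
      then h (fst x, shift (\<sigma> (snd x)) (path (snd x)) i (max 0 (fst x)) -
        shift (\<sigma> (snd x)) (path (snd x)) j (max 0 (fst x))) else 0)) \<in> borel_measurable (lborel \<Otimes>\<^sub>M M)"
    by measurable
  also have "?this \<longleftrightarrow> (\<lambda>(u, \<omega>). indicator A \<omega> * F u (path_of (shift (\<sigma> \<omega>) (path \<omega>))))
      \<in> borel_measurable (lborel \<Otimes>\<^sub>M M)"
    by (intro measurable_cong) (auto simp: F_path max_def)
  finally have joint: "(\<lambda>(u, \<omega>). indicator A \<omega> * F u (path_of (shift (\<sigma> \<omega>) (path \<omega>))))
      \<in> borel_measurable (lborel \<Otimes>\<^sub>M M)" .
  have inner: "(\<integral>\<^sup>+t. (if event_at k \<omega> \<le> ennreal m then cycle_rate h i j k t \<omega> else 0) \<partial>lborel) =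
      (\<integral>\<^sup>+u. indicator A \<omega> * F u (path_of (shift (\<sigma> \<omega>) (path \<omega>))) \<partial>lborel)"
    if \<omega>: "\<omega> \<in> space M" for \<omega>
  proof (cases "\<omega> \<in> A")
    case True
    note st = fin[OF True]
    \<comment> \<open>Calendar time \<open>\<sigma> \<omega> + u\<close> becomes the age
      \<open>u\<close>. For negative \<open>u\<close> both sides are 0, so the translation is valid
      on the whole line.\<close>
    have rate: "cycle_rate h i j k (\<sigma> \<omega> + u) \<omega> = F u (path_of (shift (\<sigma> \<omega>) (path \<omega>)))" for u
    proof (cases "0 \<le> u")
      case True
      have "ennreal (\<sigma> \<omega>) \<le> ennreal (\<sigma> \<omega> + u)" using True by (intro ennreal_leI) simp
      then show ?thesis
        using True st less_reset_time_Suc_iff_exit_time[OF finite_index paths_process[OF \<omega>] st(2,1), of "\<sigma> \<omega> + u"]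
        by (simp add: cycle_rate_def F_path \<sigma>_def[symmetric] del: reset_time.simps)
    next
      case False
      then have "\<not> (0 \<le> \<sigma> \<omega> + u \<and> ennreal (\<sigma> \<omega>) \<le> ennreal (\<sigma> \<omega> + u))" by auto
      then show ?thesis using False st by (auto simp: cycle_rate_def F_path simp del: reset_time.simps)
    qed
    have [measurable]: "(\<lambda>t. cycle_rate h i j k t \<omega>) \<in> borel_measurable lborel"
      using measurable_compose[OF measurable_Pair2'[OF \<omega>] measurable_cycle_rate[OF ij h]] by simp
    have "(\<integral>\<^sup>+t. cycle_rate h i j k t \<omega> \<partial>lborel) = (\<integral>\<^sup>+u. cycle_rate h i j k (\<sigma> \<omega> + u) \<omega> \<partial>lborel)"
      using nn_integral_real_affine[of "\<lambda>t. cycle_rate h i j k t \<omega>" 1 "\<sigma> \<omega>"] by simp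
    then show ?thesis using True by (simp add: rate A_def)
  qed (use \<omega> in \<open>simp add: A_def\<close>)
  \<comment> \<open>The integrals are exchanged twice: the translation by the random start needs a
    fixed outcome, the strong Markov property a fixed age.\<close>
  have "(\<integral>\<^sup>+t. \<integral>\<^sup>+\<omega>. (if event_at k \<omega> \<le> ennreal m then cycle_rate h i j k t \<omega> else 0) \<partial>M \<partial>lborel) =
      (\<integral>\<^sup>+\<omega>. \<integral>\<^sup>+t. (if event_at k \<omega> \<le> ennreal m then cycle_rate h i j k t \<omega> else 0) \<partial>lborel \<partial>M)"
    by (rule P.Fubini'[symmetric]) measurable
  also have "\<dots> = (\<integral>\<^sup>+\<omega>. \<integral>\<^sup>+u. indicator A \<omega> * F u (path_of (shift (\<sigma> \<omega>) (path \<omega>))) \<partial>lborel \<partial>M)"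
    by (intro nn_integral_cong inner)
  also have "\<dots> = (\<integral>\<^sup>+u. \<integral>\<^sup>+\<omega>. indicator A \<omega> * F u (path_of (shift (\<sigma> \<omega>) (path \<omega>))) \<partial>M \<partial>lborel)"
    using joint by (rule P.Fubini')
  also have "\<dots> = (\<integral>\<^sup>+u. emeasure M A * (\<integral>\<^sup>+\<omega>. F u (path_of (path \<omega>)) \<partial>M) \<partial>lborel)"
    using past by (intro nn_integral_cong strong_markov F) (auto simp: \<sigma>_def)
  also have "\<dots> = emeasure M A * (\<integral>\<^sup>+u. (\<integral>\<^sup>+\<omega>. F u (path_of (path \<omega>)) \<partial>M) \<partial>lborel)"
  proof (rule nn_integral_cmult)
    have [measurable]: "(\<lambda>(u, \<omega>). F u (path_of (path \<omega>))) \<in> borel_measurable (lborel \<Otimes>\<^sub>M M)"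
      using measurable_before_exit_time[OF ij h] by (simp add: F_path)
    show "(\<lambda>u. \<integral>\<^sup>+\<omega>. F u (path_of (path \<omega>)) \<partial>M) \<in> borel_measurable lborel" by measurable
  qed
  finally show ?thesis by (simp add: cycle_mean_def F_path A_def)
qed

end

text \<open>Here \<open>u m\<close> stands for the expected number of cycles begun by time
  \<open>m\<close>, \<open>\<mu>\<close> for their mean length and \<open>\<kappa>\<close> for their
  mean cost. The excess beyond the horizon is at most \<open>a + u m * \<epsilon>\<close>: the
  second term is absorbed into \<open>u m * \<mu>\<close> as long as
  \<open>\<epsilon> < \<mu>\<close>, and the constant \<open>a\<close> disappears after division by
  \<open>m\<close>.\<close>

lemma renewal_limit_real:
  fixes c u :: "real \<Rightarrow> real" and \<mu> \<kappa> C :: real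
  assumes \<mu>: "0 < \<mu>" and nonneg: "0 \<le> \<kappa>" "0 \<le> C"
    and lower: "\<And>m. 0 < m \<Longrightarrow> m \<le> u m * \<mu>"
    and upper: "\<And>\<epsilon>. 0 < \<epsilon> \<Longrightarrow> \<exists>a. \<forall>m>0. u m * \<mu> \<le> m + a + u m * \<epsilon> \<and> u m * \<kappa> \<le> c m + C * (a + u m * \<epsilon>)"
    and cost: "\<And>m. 0 < m \<Longrightarrow> c m \<le> u m * \<kappa>"
  shows "((\<lambda>m. c m / m) \<longlongrightarrow> \<kappa> / \<mu>) at_top"
proof (rule order_tendstoI)
  have lim_a: "((\<lambda>m. a / m) \<longlongrightarrow> 0) at_top" for a :: real
    by (intro tendsto_divide_0[OF tendsto_const]) (simp add: filterlim_ident filterlim_at_top_imp_at_infinity)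
  have u_le: "u m / m \<le> (1 + a / m) / (\<mu> - \<epsilon>)"
    if "u m * \<mu> \<le> m + a + u m * \<epsilon>" "0 < m" "\<epsilon> < \<mu>" for m a \<epsilon>
  proof -
    have "u m * (\<mu> - \<epsilon>) \<le> m + a" using that by (simp add: algebra_simps)
    then have "u m \<le> (m + a) / (\<mu> - \<epsilon>)" using that by (simp add: pos_le_divide_eq)
    then have "u m / m \<le> (m + a) / (\<mu> - \<epsilon>) / m" using that by (intro divide_right_mono) auto
    also have "\<dots> = (1 + a / m) / (\<mu> - \<epsilon>)" using that by (simp add: field_simps)
    finally show ?thesis .
  qed
  show "\<forall>\<^sub>F m in at_top. c m / m < b" if b: "\<kappa> / \<mu> < b" for b
  proof -
    \<comment> \<open>The parameter \<open>\<epsilon>\<close> is fixed before \<open>m\<close>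
      grows, since \<open>a\<close> depends on it; it is chosen so small that the limit in
      \<open>m\<close> stays below \<open>b\<close>.\<close>
    have "((\<lambda>\<epsilon>. \<kappa> / (\<mu> - \<epsilon>)) \<longlongrightarrow> \<kappa> / (\<mu> - 0)) (at_right 0)"
      using \<mu> by (intro tendsto_intros) auto
    then have "\<forall>\<^sub>F \<epsilon> in at_right 0. \<kappa> / (\<mu> - \<epsilon>) < b" using b by (intro order_tendstoD(2)) auto
    moreover have "\<forall>\<^sub>F \<epsilon> in at_right 0. 0 < \<epsilon> \<and> \<epsilon> < \<mu>"
      using eventually_at_right_real[OF \<mu>] by (auto elim: eventually_mono)
    ultimately have "\<forall>\<^sub>F \<epsilon> in at_right 0. \<kappa> / (\<mu> - \<epsilon>) < b \<and> 0 < \<epsilon> \<and> \<epsilon> < \<mu>"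
      by (rule eventually_conj)
    then obtain \<epsilon> where \<epsilon>: "\<kappa> / (\<mu> - \<epsilon>) < b" "0 < \<epsilon>" "\<epsilon> < \<mu>"
      using eventually_happens[of _ "at_right (0::real)"] by auto
    obtain a where a: "\<And>m. 0 < m \<Longrightarrow> u m * \<mu> \<le> m + a + u m * \<epsilon>" using upper[OF \<epsilon>(2)] by auto
    have "((\<lambda>m. (1 + a / m) / (\<mu> - \<epsilon>) * \<kappa>) \<longlongrightarrow> (1 + 0) / (\<mu> - \<epsilon>) * \<kappa>) at_top"
      using \<epsilon> by (intro tendsto_intros lim_a) auto
    then have "\<forall>\<^sub>F m in at_top. (1 + a / m) / (\<mu> - \<epsilon>) * \<kappa> < b" using \<epsilon> by (intro order_tendstoD(2)) auto
    then show ?thesis using eventually_gt_at_top[of 0]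
    proof eventually_elim
      case (elim m)
      have "c m / m \<le> u m * \<kappa> / m" using cost[of m] elim by (intro divide_right_mono) auto
      also have "\<dots> = u m / m * \<kappa>" by simp
      also have "\<dots> \<le> (1 + a / m) / (\<mu> - \<epsilon>) * \<kappa>"
        using u_le[OF a] elim \<epsilon> nonneg by (intro mult_right_mono) auto
      finally show ?case using elim by simp
    qed
  qed
  show "\<forall>\<^sub>F m in at_top. b < c m / m" if b: "b < \<kappa> / \<mu>" for b
  proof -
    have "((\<lambda>\<epsilon>. \<kappa> / \<mu> - C * (\<epsilon> / (\<mu> - \<epsilon>))) \<longlongrightarrow> \<kappa> / \<mu> - C * (0 / (\<mu> - 0))) (at_right 0)"
      using \<mu> by (intro tendsto_intros) auto
    then have "\<forall>\<^sub>F \<epsilon> in at_right 0. b < \<kappa> / \<mu> - C * (\<epsilon> / (\<mu> - \<epsilon>))" using b by (intro order_tendstoD(1)) auto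
    moreover have "\<forall>\<^sub>F \<epsilon> in at_right 0. 0 < \<epsilon> \<and> \<epsilon> < \<mu>"
      using eventually_at_right_real[OF \<mu>] by (auto elim: eventually_mono)
    ultimately have "\<forall>\<^sub>F \<epsilon> in at_right 0. b < \<kappa> / \<mu> - C * (\<epsilon> / (\<mu> - \<epsilon>)) \<and> 0 < \<epsilon> \<and> \<epsilon> < \<mu>"
      by (rule eventually_conj)
    then obtain \<epsilon> where \<epsilon>: "b < \<kappa> / \<mu> - C * (\<epsilon> / (\<mu> - \<epsilon>))" "0 < \<epsilon>" "\<epsilon> < \<mu>"
      using eventually_happens[of _ "at_right (0::real)"] by auto
    obtain a where a: "\<And>m. 0 < m \<Longrightarrow> u m * \<mu> \<le> m + a + u m * \<epsilon>"
      "\<And>m. 0 < m \<Longrightarrow> u m * \<kappa> \<le> c m + C * (a + u m * \<epsilon>)" using upper[OF \<epsilon>(2)] by auto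
    have "((\<lambda>m. \<kappa> / \<mu> - C * (a / m + (1 + a / m) / (\<mu> - \<epsilon>) * \<epsilon>)) \<longlongrightarrow>
        \<kappa> / \<mu> - C * (0 + (1 + 0) / (\<mu> - \<epsilon>) * \<epsilon>)) at_top"
      using \<epsilon> by (intro tendsto_intros lim_a) auto
    then have "\<forall>\<^sub>F m in at_top. b < \<kappa> / \<mu> - C * (a / m + (1 + a / m) / (\<mu> - \<epsilon>) * \<epsilon>)"
      using \<epsilon> by (intro order_tendstoD(1)) auto
    then show ?thesis using eventually_gt_at_top[of 0]
    proof eventually_elim
      case (elim m)
      have "1 / \<mu> \<le> u m / m" using lower[of m] elim \<mu> by (simp add: field_simps)
      then have "1 / \<mu> * \<kappa> \<le> u m / m * \<kappa>" using nonneg by (intro mult_right_mono) auto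
      moreover have "u m / m * \<epsilon> \<le> (1 + a / m) / (\<mu> - \<epsilon>) * \<epsilon>"
        using u_le[OF a(1)] elim \<epsilon> by (intro mult_right_mono) auto
      then have "C * (a / m + u m / m * \<epsilon>) \<le> C * (a / m + (1 + a / m) / (\<mu> - \<epsilon>) * \<epsilon>)"
        using nonneg by (intro mult_left_mono) auto
      moreover have "u m / m * \<kappa> \<le> c m / m + C * (a / m + u m / m * \<epsilon>)"
        using a(2)[of m] elim by (simp add: field_simps)
      ultimately show ?case using elim by simp
    qed
  qed
qed

section \<open>Expected number of cycles and the excess of the last one\<close>

context brownian_family
begin

text \<open>Summed over \<open>k\<close> this is the renewal function, the expected number of cycles
  begun by time \<open>m\<close>.\<close>

definition renewals :: "real \<Rightarrow> nat \<Rightarrow> ennreal" where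
  "renewals m k = emeasure M {\<omega> \<in> space M. event_at k \<omega> \<le> ennreal m}"

lemma measurable_integral_rate:
  assumes "i \<in> I" "j \<in> I" "h \<in> borel_measurable (borel \<Otimes>\<^sub>M borel)"
  shows "(\<lambda>t. \<integral>\<^sup>+\<omega>. cycle_rate h i j k t \<omega> \<partial>M) \<in> borel_measurable lborel"
    "(\<lambda>t. \<integral>\<^sup>+\<omega>. (if event_at k \<omega> \<le> m then cycle_rate h i j k t \<omega> else 0) \<partial>M) \<in> borel_measurable lborel"
  using measurable_cycle_rate[OF assms, of k] measurable_reset_time[of k] by measurable

lemma measurable_rate_section:
  assumes "i \<in> I" "j \<in> I" "h \<in> borel_measurable (borel \<Otimes>\<^sub>M borel)"
  shows "cycle_rate h i j k t \<in> borel_measurable M"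
  using measurable_compose[OF measurable_Pair1'[of t lborel M] measurable_cycle_rate[OF assms, of k]] by simp

lemma suminf_cycle_rate:
  assumes \<omega>: "\<omega> \<in> space M" and t: "0 \<le> t" and k: "event_at k \<omega> \<le> ennreal t" "ennreal t < event_at (Suc k) \<omega>"
  shows "(\<Sum>k. cycle_rate h i j k t \<omega>) = cycle_rate h i j k t \<omega>"
proof -
  have "cycle_rate h i j l t \<omega> = 0" if "l \<noteq> k" for l
    using reset_time_unique_index[OF _ _ k, of l] that by (auto simp: cycle_rate_def simp del: reset_time.simps)
  then have "(\<Sum>k. cycle_rate h i j k t \<omega>) = (\<Sum>k\<in>{k}. cycle_rate h i j k t \<omega>)"
    by (intro suminf_finite) auto
  then show ?thesis by simp
qed

lemma suminf_cycle_rate_1: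
  assumes \<omega>: "\<omega> \<in> space M" and t: "0 \<le> t"
  shows "(\<Sum>k. cycle_rate (\<lambda>_. 1) i j k t \<omega>) = 1"
proof -
  obtain k where k: "event_at k \<omega> \<le> ennreal t" "ennreal t < event_at (Suc k) \<omega>"
    using reset_time_exists_index[OF finite_index paths_process[OF \<omega>] t] by blast
  show ?thesis unfolding suminf_cycle_rate[OF \<omega> t k] using k t by (simp add: cycle_rate_def del: reset_time.simps)
qed

definition running_cost :: "(real \<times> real \<Rightarrow> ennreal) \<Rightarrow> 'i \<Rightarrow> 'i \<Rightarrow> real \<Rightarrow> ennreal" where
  "running_cost h i j m = (\<integral>\<^sup>+t\<in>{0..m}. (\<integral>\<^sup>+\<omega>. (\<Sum>k. cycle_rate h i j k t \<omega>) \<partial>M) \<partial>lborel)"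

lemma running_cost_suminf:
  assumes "i \<in> I" "j \<in> I" "h \<in> borel_measurable (borel \<Otimes>\<^sub>M borel)"
  shows "running_cost h i j m = (\<Sum>k. \<integral>\<^sup>+t\<in>{0..m}. (\<integral>\<^sup>+\<omega>. cycle_rate h i j k t \<omega> \<partial>M) \<partial>lborel)"
proof -
  note [measurable] = measurable_integral_rate(1)[OF assms]
  have "running_cost h i j m = (\<integral>\<^sup>+t. (\<Sum>k. (\<integral>\<^sup>+\<omega>. cycle_rate h i j k t \<omega> \<partial>M) * indicator {0..m} t) \<partial>lborel)"
    unfolding running_cost_def
    by (simp add: nn_integral_suminf measurable_rate_section[OF assms] ennreal_suminf_multc)
  also have "\<dots> = (\<Sum>k. \<integral>\<^sup>+t\<in>{0..m}. (\<integral>\<^sup>+\<omega>. cycle_rate h i j k t \<omega> \<partial>M) \<partial>lborel)"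
    by (intro nn_integral_suminf) measurable
  finally show ?thesis .
qed

text \<open>The integral up to \<open>m\<close> sees only cycles begun by \<open>m\<close>; counting
  each of them in full gives an upper bound.\<close>

lemma running_cost_le:
  assumes "i \<in> I" "j \<in> I" "h \<in> borel_measurable (borel \<Otimes>\<^sub>M borel)" "0 \<le> m"
  shows "running_cost h i j m \<le> (\<Sum>k. renewals m k) * cycle_mean h i j"
proof -
  have "(\<integral>\<^sup>+t\<in>{0..m}. (\<integral>\<^sup>+\<omega>. cycle_rate h i j k t \<omega> \<partial>M) \<partial>lborel) \<le> renewals m k * cycle_mean h i j" for k
    unfolding renewals_def renewal[OF assms, of k, symmetric]
  proof (intro nn_integral_mono)
    fix t
    show "(\<integral>\<^sup>+\<omega>. cycle_rate h i j k t \<omega> \<partial>M) * indicator {0..m} t \<le>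
        (\<integral>\<^sup>+\<omega>. (if event_at k \<omega> \<le> ennreal m then cycle_rate h i j k t \<omega> else 0) \<partial>M)"
    proof (cases "t \<in> {0..m}")
      case True
      then have "ennreal t \<le> ennreal m" by (intro ennreal_leI) auto
      then have "event_at k \<omega> \<le> ennreal m" if "event_at k \<omega> \<le> ennreal t" for \<omega>
        using order_trans[OF that] by simp
      then show ?thesis using True
        by (auto intro!: nn_integral_mono simp: cycle_rate_def simp del: reset_time.simps)
    qed simp
  qed
  then show ?thesis
    unfolding running_cost_suminf[OF assms(1-3)] ennreal_suminf_multc[symmetric]
    by (intro suminf_le) auto
qed

text \<open>The excess over the horizon; for each outcome only the cycle in progress at time
  \<open>m\<close> contributes.\<close>

definition residual :: "(real \<times> real \<Rightarrow> ennreal) \<Rightarrow> 'i \<Rightarrow> 'i \<Rightarrow> real \<Rightarrow> nat \<Rightarrow> ennreal" where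
  "residual h i j m k = (\<integral>\<^sup>+t\<in>{m<..}.
     (\<integral>\<^sup>+\<omega>. (if event_at k \<omega> \<le> ennreal m then cycle_rate h i j k t \<omega> else 0) \<partial>M) \<partial>lborel)"

lemma renewal_split:
  assumes "i \<in> I" "j \<in> I" "h \<in> borel_measurable (borel \<Otimes>\<^sub>M borel)" "0 \<le> m"
  shows "renewals m k * cycle_mean h i j \<le>
    (\<integral>\<^sup>+t\<in>{0..m}. (\<integral>\<^sup>+\<omega>. cycle_rate h i j k t \<omega> \<partial>M) \<partial>lborel) + residual h i j m k"
proof -
  note [measurable] = measurable_integral_rate[OF assms(1-3)]
  let ?R = "\<lambda>t. \<integral>\<^sup>+\<omega>. cycle_rate h i j k t \<omega> \<partial>M"
  let ?Rm = "\<lambda>t. \<integral>\<^sup>+\<omega>. (if event_at k \<omega> \<le> ennreal m then cycle_rate h i j k t \<omega> else 0) \<partial>M"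
  have "renewals m k * cycle_mean h i j = (\<integral>\<^sup>+t. ?Rm t \<partial>lborel)"
    unfolding renewals_def using renewal[OF assms] by simp
  also have "\<dots> \<le> (\<integral>\<^sup>+t. ?R t * indicator {0..m} t + ?Rm t * indicator {m<..} t \<partial>lborel)"
  proof (rule nn_integral_mono)
    fix t
    consider "t < 0" | "t \<in> {0..m}" | "m < t" using assms(4) by force
    then show "?Rm t \<le> ?R t * indicator {0..m} t + ?Rm t * indicator {m<..} t"
    proof cases
      case 1
      then have "cycle_rate h i j k t \<omega> = 0" for \<omega> by (simp add: cycle_rate_def)
      then show ?thesis by (simp cong: if_cong)
    next
      case 2
      then show ?thesis by (auto intro!: nn_integral_mono)
    qed auto
  qed
  also have "\<dots> = (\<integral>\<^sup>+t\<in>{0..m}. ?R t \<partial>lborel) + residual h i j m k"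
    unfolding residual_def by (rule nn_integral_add) measurable
  finally show ?thesis .
qed

text \<open>During a cycle both agents stay within distance 1 of the reset point, so their
  difference is below 2 and the reward is at most \<open>C\<close>.\<close>

lemma residual_bounded:
  assumes ij: "i \<in> I" "j \<in> I" and h: "\<And>u d. \<bar>d\<bar> < 2 \<Longrightarrow> h (u, d) \<le> C"
  shows "residual h i j m k \<le> C * residual (\<lambda>_. 1) i j m k"
proof -
  note [measurable] = measurable_integral_rate[OF ij, of "\<lambda>_. 1"]
  have rate: "cycle_rate h i j k t \<omega> \<le> C * cycle_rate (\<lambda>_. 1) i j k t \<omega>" if \<omega>: "\<omega> \<in> space M" for t \<omega>
  proof (cases "0 \<le> t \<and> event_at k \<omega> \<le> ennreal t \<and> ennreal t < event_at (Suc k) \<omega>")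
    case True
    note st = cycle_rate_time[of t \<omega> k]
    let ?s = "enn2real (event_at k \<omega>)"
    have "\<bar>v l t \<omega> - v l ?s \<omega>\<bar> < 1" if "l \<in> I" for l
      using True st less_reset_time_Suc_iff[OF finite_index paths_process[OF \<omega>], of ?s k t] that
      by (auto simp del: reset_time.simps)
    from this[OF ij(1)] this[OF ij(2)] have "\<bar>shift ?s (path \<omega>) i (t - ?s) - shift ?s (path \<omega>) j (t - ?s)\<bar> < 2"
      by (simp add: shift_def)
    then show ?thesis using True h by (simp add: cycle_rate_def del: reset_time.simps)
  qed (auto simp: cycle_rate_def simp del: reset_time.simps)
  have "residual h i j m k \<le> (\<integral>\<^sup>+t. C * ((\<integral>\<^sup>+\<omega>. (if event_at k \<omega> \<le> ennreal m
      then cycle_rate (\<lambda>_. 1) i j k t \<omega> else 0) \<partial>M) * indicator {m<..} t) \<partial>lborel)"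
    unfolding residual_def mult.assoc[symmetric]
  proof (intro nn_integral_mono mult_right_mono)
    fix t
    have "(\<integral>\<^sup>+\<omega>. (if event_at k \<omega> \<le> ennreal m then cycle_rate h i j k t \<omega> else 0) \<partial>M) \<le>
      (\<integral>\<^sup>+\<omega>. C * (if event_at k \<omega> \<le> ennreal m then cycle_rate (\<lambda>_. 1) i j k t \<omega> else 0) \<partial>M)"
      using rate by (intro nn_integral_mono) auto
    also have "\<dots> = C * (\<integral>\<^sup>+\<omega>. (if event_at k \<omega> \<le> ennreal m then cycle_rate (\<lambda>_. 1) i j k t \<omega> else 0) \<partial>M)"
      using measurable_rate_section[OF ij, of "\<lambda>_. 1" k t] measurable_reset_time[of k]
      by (intro nn_integral_cmult measurable_If) auto
    finally show "(\<integral>\<^sup>+\<omega>. (if event_at k \<omega> \<le> ennreal m then cycle_rate h i j k t \<omega> else 0) \<partial>M) \<le>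
      C * (\<integral>\<^sup>+\<omega>. (if event_at k \<omega> \<le> ennreal m then cycle_rate (\<lambda>_. 1) i j k t \<omega> else 0) \<partial>M)" .
  qed simp
  also have "\<dots> = C * residual (\<lambda>_. 1) i j m k"
    unfolding residual_def by (rule nn_integral_cmult) measurable
  finally show ?thesis .
qed

text \<open>The cycles are disjoint in time, so for each outcome at most one summand is
  nonzero.\<close>

lemma sum_integral_rate_1_le:
  assumes ij: "i \<in> I" "j \<in> I" and t: "0 \<le> t"
  shows "(\<Sum>k<n. \<integral>\<^sup>+\<omega>. cycle_rate (\<lambda>_. 1) i j k t \<omega> \<partial>M) \<le> 1"
proof -
  have "(\<Sum>k<n. \<integral>\<^sup>+\<omega>. cycle_rate (\<lambda>_. 1) i j k t \<omega> \<partial>M) = (\<integral>\<^sup>+\<omega>. (\<Sum>k<n. cycle_rate (\<lambda>_. 1) i j k t \<omega>) \<partial>M)"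
    by (intro nn_integral_sum[symmetric] measurable_rate_section ij) simp
  also have "\<dots> \<le> (\<integral>\<^sup>+\<omega>. 1 \<partial>M)"
  proof (rule nn_integral_mono)
    fix \<omega> assume "\<omega> \<in> space M"
    from suminf_cycle_rate_1[OF this t, of i j]
    show "(\<Sum>k<n. cycle_rate (\<lambda>_. 1) i j k t \<omega>) \<le> 1"
      using sum_le_suminf[of "\<lambda>k. cycle_rate (\<lambda>_. 1) i j k t \<omega>" "{..<n}"] by simp
  qed
  finally show ?thesis by (simp add: emeasure_space_1)
qed

text \<open>The cycle in progress at \<open>m\<close> is biased towards long ones, so its excess
  cannot be compared with the mean length directly; it is cut at \<open>m + a\<close>. Up to there
  at most one cycle runs at each time, which gives \<open>a\<close> for all cycles together. Later
  on, a cycle begun by \<open>m\<close> has age above \<open>a\<close>, and \<open>renewal\<close>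
  bounds this part by a tail of the mean length for each cycle.\<close>

lemma sum_residual_le:
  assumes ij: "i \<in> I" "j \<in> I" and m: "0 \<le> m" and a: "0 \<le> a"
  shows "(\<Sum>k<n. residual (\<lambda>_. 1) i j m k) \<le>
    ennreal a + (\<Sum>k<n. renewals m k) * cycle_mean (\<lambda>(u, _). indicator {a..} u) i j"
proof -
  let ?h = "\<lambda>(u, _::real). indicator {a..} u :: ennreal"
  have h: "?h \<in> borel_measurable (borel \<Otimes>\<^sub>M borel)" by measurable
  note [measurable] = measurable_integral_rate[OF ij, of "\<lambda>_. 1"] measurable_integral_rate[OF ij h]
  let ?R = "\<lambda>k t. \<integral>\<^sup>+\<omega>. cycle_rate (\<lambda>_. 1) i j k t \<omega> \<partial>M"
  have "residual (\<lambda>_. 1) i j m k \<le>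
      (\<integral>\<^sup>+t\<in>{m<..m + a}. ?R k t \<partial>lborel) + renewals m k * cycle_mean ?h i j" for k
  proof -
    let ?Rm = "\<lambda>h t. \<integral>\<^sup>+\<omega>. (if event_at k \<omega> \<le> ennreal m then cycle_rate h i j k t \<omega> else 0) \<partial>M"
    have "residual (\<lambda>_. 1) i j m k \<le> (\<integral>\<^sup>+t. ?R k t * indicator {m<..m + a} t + ?Rm ?h t \<partial>lborel)"
      unfolding residual_def
    proof (rule nn_integral_mono)
      fix t
      consider "t \<le> m" | "t \<in> {m<..m + a}" | "m + a < t" by force
      then show "?Rm (\<lambda>_. 1) t * indicator {m<..} t \<le> ?R k t * indicator {m<..m + a} t + ?Rm ?h t"
      proof cases
        case 2
        have "?Rm (\<lambda>_. 1) t \<le> ?R k t" by (auto intro!: nn_integral_mono)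
        then show ?thesis using 2 by (simp add: add_increasing2)
      next
        case 3
        have "?Rm (\<lambda>_. 1) t \<le> ?Rm ?h t"
        proof (intro nn_integral_mono)
          fix \<omega>
          have "enn2real (event_at k \<omega>) \<le> m" if "event_at k \<omega> \<le> ennreal m"
            using cycle_rate_time(1)[OF m that] .
          then show "(if event_at k \<omega> \<le> ennreal m then cycle_rate (\<lambda>_. 1) i j k t \<omega> else 0) \<le>
              (if event_at k \<omega> \<le> ennreal m then cycle_rate ?h i j k t \<omega> else 0)"
            using 3 by (auto simp: cycle_rate_def simp del: reset_time.simps)
        qed
        then show ?thesis using 3 a by simp
      qed simp
    qed
    also have "\<dots> = (\<integral>\<^sup>+t\<in>{m<..m + a}. ?R k t \<partial>lborel) + (\<integral>\<^sup>+t. ?Rm ?h t \<partial>lborel)"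
      by (rule nn_integral_add) measurable
    finally show ?thesis using renewal[OF ij h m, of k] by (simp add: renewals_def)
  qed
  then have "(\<Sum>k<n. residual (\<lambda>_. 1) i j m k) \<le>
      (\<Sum>k<n. (\<integral>\<^sup>+t\<in>{m<..m + a}. ?R k t \<partial>lborel) + renewals m k * cycle_mean ?h i j)"
    by (rule sum_mono)
  also have "\<dots> = (\<Sum>k<n. \<integral>\<^sup>+t\<in>{m<..m + a}. ?R k t \<partial>lborel) + (\<Sum>k<n. renewals m k) * cycle_mean ?h i j"
    by (simp add: sum.distrib sum_distrib_right)
  also have "(\<Sum>k<n. \<integral>\<^sup>+t\<in>{m<..m + a}. ?R k t \<partial>lborel) = (\<integral>\<^sup>+t. (\<Sum>k<n. ?R k t) * indicator {m<..m + a} t \<partial>lborel)"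
    unfolding sum_distrib_right by (rule nn_integral_sum[symmetric]) measurable
  also have "\<dots> \<le> (\<integral>\<^sup>+t. indicator {m<..m + a} t \<partial>lborel)"
    using sum_integral_rate_1_le[OF ij] m by (intro nn_integral_mono) (auto simp: indicator_def)
  also have "\<dots> = ennreal a" using a by simp
  finally show ?thesis by (simp add: add_right_mono)
qed

text \<open>The cycles cover the time axis, so the reward 1 has an exactly known cost; comparing it
  with the general bounds calibrates the expected number of cycles.\<close>

lemma running_cost_1:
  assumes "i \<in> I" "j \<in> I" "0 \<le> m"
  shows "running_cost (\<lambda>_. 1) i j m = ennreal m"
proof -
  have "running_cost (\<lambda>_. 1) i j m = (\<integral>\<^sup>+t. indicator {0..m} t \<partial>lborel)"
    unfolding running_cost_def
  proof (rule nn_integral_cong)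
    fix t :: real
    have "(\<integral>\<^sup>+\<omega>. (\<Sum>k. cycle_rate (\<lambda>_. 1) i j k t \<omega>) \<partial>M) = (\<integral>\<^sup>+\<omega>. 1 \<partial>M)" if "0 \<le> t"
      using suminf_cycle_rate_1[OF _ that] by (intro nn_integral_cong) auto
    then show "(\<integral>\<^sup>+\<omega>. (\<Sum>k. cycle_rate (\<lambda>_. 1) i j k t \<omega>) \<partial>M) * indicator {0..m} t = indicator {0..m} t"
      by (auto simp: indicator_def emeasure_space_1)
  qed
  then show ?thesis using assms by simp
qed

lemma exit_time_difference_less:
  assumes "\<omega> \<in> space M" "i \<in> I" "j \<in> I" "0 \<le> u" "ennreal u < first_exit \<omega>"
  shows "\<bar>v i u \<omega> - v j u \<omega>\<bar> < 2"
proof -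
  have "\<forall>i\<in>I. \<forall>s\<in>{0..u}. \<bar>v i s \<omega>\<bar> < 1"
    using less_exit_time_iff[OF finite_index paths_process assms(4)] assms by auto
  then have "\<bar>v i u \<omega>\<bar> < 1" "\<bar>v j u \<omega>\<bar> < 1" using assms by auto
  then show ?thesis by linarith
qed

lemma cycle_mean_bounded:
  assumes ij: "i \<in> I" "j \<in> I" and h: "\<And>u d. \<bar>d\<bar> < 2 \<Longrightarrow> h (u, d) \<le> C"
  shows "cycle_mean h i j \<le> C * cycle_mean (\<lambda>_. 1) i j"
proof -
  let ?f = "\<lambda>u \<omega>. if 0 \<le> u \<and> ennreal u < first_exit \<omega> then 1 else (0 :: ennreal)"
  have [measurable]: "(\<lambda>(u, \<omega>). ?f u \<omega>) \<in> borel_measurable (lborel \<Otimes>\<^sub>M M)"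
    using measurable_before_exit_time[OF ij, of "\<lambda>_. 1"] by simp
  have "cycle_mean h i j \<le> (\<integral>\<^sup>+u. (\<integral>\<^sup>+\<omega>. C * ?f u \<omega> \<partial>M) \<partial>lborel)"
    unfolding cycle_mean_def
  proof (intro nn_integral_mono)
    fix u \<omega> assume "\<omega> \<in> space M"
    from exit_time_difference_less[OF this ij]
    show "(if 0 \<le> u \<and> ennreal u < first_exit \<omega> then h (u, v i u \<omega> - v j u \<omega>) else 0) \<le> C * ?f u \<omega>"
      by (cases "0 \<le> u \<and> ennreal u < first_exit \<omega>") (auto intro!: h)
  qed
  also have "\<dots> = (\<integral>\<^sup>+u. C * (\<integral>\<^sup>+\<omega>. ?f u \<omega> \<partial>M) \<partial>lborel)"
  proof (intro nn_integral_cong nn_integral_cmult)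
    fix u :: real
    show "?f u \<in> borel_measurable M"
      using measurable_exit_time_path by measurable
  qed
  also have "\<dots> = C * (\<integral>\<^sup>+u. (\<integral>\<^sup>+\<omega>. ?f u \<omega> \<partial>M) \<partial>lborel)"
    by (intro nn_integral_cmult) measurable
  also have "\<dots> = C * cycle_mean (\<lambda>_. 1) i j" by (simp only: cycle_mean_def)
  finally show ?thesis .
qed

text \<open>Dominated convergence: the survival function is an integrable majorant because the mean
  length is finite. The limit supplies the small \<open>\<epsilon>\<close> in the bound of the
  excess.\<close>

lemma cycle_mean_tail_tendsto:
  assumes ij: "i \<in> I" "j \<in> I" and fin: "cycle_mean (\<lambda>_. 1) i j < \<infinity>"
  shows "(\<lambda>n. cycle_mean (\<lambda>(u, _). indicator {real n..} u) i j) \<longlonglongrightarrow> 0"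
proof -
  let ?f = "\<lambda>u. \<integral>\<^sup>+\<omega>. (if 0 \<le> u \<and> ennreal u < first_exit \<omega> then 1 else (0 :: ennreal)) \<partial>M"
  have [measurable]: "(\<lambda>(u, \<omega>). if 0 \<le> u \<and> ennreal u < first_exit \<omega> then 1 else (0 :: ennreal))
      \<in> borel_measurable (lborel \<Otimes>\<^sub>M M)"
    using measurable_before_exit_time[OF ij, of "\<lambda>_. 1"] by simp
  have "(\<lambda>n. \<integral>\<^sup>+u. ?f u * indicator {real n..} u \<partial>lborel) \<longlonglongrightarrow> (\<integral>\<^sup>+u. 0 \<partial>(lborel :: real measure))"
  proof (rule nn_integral_dominated_convergence[where w="?f"])
    show "(\<integral>\<^sup>+u. ?f u \<partial>lborel) < \<infinity>" using fin by (simp add: cycle_mean_def)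
    show "AE u in lborel. (\<lambda>n. ?f u * indicator {real n..} u) \<longlonglongrightarrow> 0"
    proof (rule AE_I2)
      fix u :: real
      obtain N :: nat where "u < real N" using reals_Archimedean2 by blast
      then have "\<forall>\<^sub>F n in sequentially. ?f u * indicator {real n..} u = 0"
        by (auto simp: eventually_sequentially indicator_def intro!: exI[of _ N])
      then show "(\<lambda>n. ?f u * indicator {real n..} u) \<longlonglongrightarrow> 0" by (rule tendsto_eventually)
    qed
  qed (auto simp: indicator_def)
  also have "(\<lambda>n. \<integral>\<^sup>+u. ?f u * indicator {real n..} u \<partial>lborel) =
      (\<lambda>n. cycle_mean (\<lambda>(u, _). indicator {real n..} u) i j)"
    unfolding cycle_mean_def
    by (intro ext nn_integral_cong) (auto simp: indicator_def cong: if_cong)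
  finally show ?thesis by simp
qed

text \<open>With mean length 0 the bound of \<open>running_cost_le\<close> would be 0 even for
  infinitely many renewals, while the cost of the reward 1 over a unit horizon is 1.\<close>

lemma cycle_mean_1_pos:
  assumes ij: "i \<in> I" "j \<in> I"
  shows "0 < cycle_mean (\<lambda>_. 1) i j"
proof (rule ccontr)
  assume "\<not> ?thesis"
  then have "cycle_mean (\<lambda>_. 1) i j = 0" by simp
  with running_cost_le[OF ij, of "\<lambda>_. 1" 1] running_cost_1[OF ij, of 1] show False by simp
qed

text \<open>The renewal bounds live in \<open>ennreal\<close>, whereas the limit argument needs
  subtraction; most of the work is the transfer to finite reals. The result is a genuine limit, so
  the limsup in the cost can be evaluated and summed over the edges.\<close>

theorem running_cost_limit:
  assumes ij: "i \<in> I" "j \<in> I" and h: "h \<in> borel_measurable (borel \<Otimes>\<^sub>M borel)"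
    and C: "0 \<le> C" "\<And>u d. \<bar>d\<bar> < 2 \<Longrightarrow> h (u, d) \<le> ennreal C"
    and fin: "cycle_mean (\<lambda>_. 1) i j < \<infinity>"
  shows "((\<lambda>m. running_cost h i j m / ennreal m) \<longlongrightarrow> cycle_mean h i j / cycle_mean (\<lambda>_. 1) i j) at_top"
proof -
  let ?r = "\<lambda>n. cycle_mean (\<lambda>(u, _). indicator {real n..} u) i j"
  let ?U = "\<lambda>m. \<Sum>k. renewals m k"
  have "cycle_mean h i j \<le> ennreal C * cycle_mean (\<lambda>_. 1) i j"
    using C(2) by (intro cycle_mean_bounded ij) auto
  also have "\<dots> < \<infinity>" using fin by (simp add: ennreal_mult_less_top)
  finally have "cycle_mean h i j < \<infinity>" .
  then obtain \<kappa> where \<kappa>: "cycle_mean h i j = ennreal \<kappa>" "0 \<le> \<kappa>" by (cases "cycle_mean h i j") auto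
  obtain \<mu> where \<mu>: "cycle_mean (\<lambda>_. 1) i j = ennreal \<mu>" "0 < \<mu>"
    using cycle_mean_1_pos[OF ij] fin by (cases "cycle_mean (\<lambda>_. 1) i j") auto
  have small: "\<exists>a r. ?r a = ennreal r \<and> 0 \<le> r \<and> r < \<epsilon>" if "0 < \<epsilon>" for \<epsilon>
  proof -
    have "\<forall>\<^sub>F n in sequentially. ?r n < ennreal \<epsilon>"
      using cycle_mean_tail_tendsto[OF ij fin] that by (intro order_tendstoD(2)) auto
    then obtain a where "?r a < ennreal \<epsilon>" by (auto simp: eventually_sequentially)
    then show ?thesis
      by (intro exI[of _ a] exI[of _ "enn2real (?r a)"])
        (cases "?r a"; auto simp: ennreal_less_iff)
  qed
  \<comment> \<open>Stated for finite partial sums: the full sum is not yet known to be finite, so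
    its tail term could not be moved to the other side.\<close>
  have partial: "(\<Sum>k<n. renewals m k) * ennreal \<mu> \<le>
      ennreal m + (ennreal a + (\<Sum>k<n. renewals m k) * ?r a)" if m: "0 < m" for m n and a :: nat
  proof -
    have "(\<Sum>k<n. renewals m k) * ennreal \<mu> \<le>
        (\<Sum>k<n. (\<integral>\<^sup>+t\<in>{0..m}. (\<integral>\<^sup>+\<omega>. cycle_rate (\<lambda>_. 1) i j k t \<omega> \<partial>M) \<partial>lborel) + residual (\<lambda>_. 1) i j m k)"
      unfolding \<mu>(1)[symmetric] sum_distrib_right using m ij by (intro sum_mono renewal_split) auto
    also have "\<dots> = (\<Sum>k<n. \<integral>\<^sup>+t\<in>{0..m}. (\<integral>\<^sup>+\<omega>. cycle_rate (\<lambda>_. 1) i j k t \<omega> \<partial>M) \<partial>lborel) +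
        (\<Sum>k<n. residual (\<lambda>_. 1) i j m k)" by (rule sum.distrib)
    also have "\<dots> \<le> running_cost (\<lambda>_. 1) i j m + (ennreal a + (\<Sum>k<n. renewals m k) * ?r a)"
      using m ij by (intro add_mono sum_residual_le)
        (auto simp: running_cost_suminf intro!: sum_le_suminf)
    finally show ?thesis using running_cost_1[OF ij, of m] m by simp
  qed
  have ren_le: "renewals m k \<le> 1" for m k
    by (simp add: renewals_def emeasure_le_1)
  have U_fin: "?U m < \<infinity>" if m: "0 < m" for m
  proof -
    \<comment> \<open>A tail \<open>r < \<mu>\<close> lets the term \<open>u * r\<close> be absorbed
      on the left; the resulting bound does not depend on \<open>n\<close>.\<close>
    obtain a r where r: "?r a = ennreal r" "0 \<le> r" "r < \<mu>" using small[OF \<mu>(2)] by blast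
    have "(\<Sum>k<n. renewals m k) \<le> ennreal ((m + a) / (\<mu> - r))" for n
    proof -
      have "(\<Sum>k<n. renewals m k) \<le> (\<Sum>k<n. 1)" by (intro sum_mono ren_le)
      also have "\<dots> < \<infinity>" by (simp add: ennreal_of_nat_eq_real_of_nat)
      finally obtain u where u: "(\<Sum>k<n. renewals m k) = ennreal u" "0 \<le> u"
        by (cases "\<Sum>k<n. renewals m k") auto
      have "ennreal (u * \<mu>) \<le> ennreal (m + (a + u * r))"
        using partial[OF m, of n a] u r m \<mu> by (simp add: ennreal_mult ennreal_plus)
      then have "u * \<mu> \<le> m + (a + u * r)" using m u r by (subst (asm) ennreal_le_iff) auto
      then have "u * (\<mu> - r) \<le> m + a" by (simp add: algebra_simps)
      then show ?thesis unfolding u using r by (intro ennreal_leI) (simp add: pos_le_divide_eq)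
    qed
    then have "?U m \<le> ennreal ((m + a) / (\<mu> - r))" by (intro suminf_le_const) auto
    also have "\<dots> < \<infinity>" by simp
    finally show ?thesis .
  qed
  define u where "u m = enn2real (?U m)" for m
  define c where "c m = enn2real (running_cost h i j m)" for m
  have u: "?U m = ennreal (u m)" "0 \<le> u m" if "0 < m" for m
    using U_fin[OF that] by (auto simp: u_def)
  have c_le: "running_cost h i j m \<le> ennreal (u m * \<kappa>)" if "0 < m" for m
    using running_cost_le[OF ij h, of m] that u[OF that] \<kappa> by (simp add: ennreal_mult)
  have c: "running_cost h i j m = ennreal (c m)" "0 \<le> c m" if "0 < m" for m
    using le_less_trans[OF c_le[OF that] ennreal_less_top] by (auto simp: c_def)
  have "((\<lambda>m. c m / m) \<longlongrightarrow> \<kappa> / \<mu>) at_top"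
  proof (rule renewal_limit_real[where u=u and C=C])
    show "m \<le> u m * \<mu>" if "0 < m" for m
    proof -
      have "ennreal m \<le> ennreal (u m * \<mu>)"
        using running_cost_le[OF ij, of "\<lambda>_. 1" m] running_cost_1[OF ij, of m] that u[OF that] \<mu>
        by (simp add: ennreal_mult)
      then show ?thesis using u[OF that] \<mu> by (subst (asm) ennreal_le_iff) auto
    qed
    show "c m \<le> u m * \<kappa>" if "0 < m" for m
      using c_le[OF that] unfolding c[OF that] using u[OF that] \<kappa> by (subst (asm) ennreal_le_iff) auto
    fix \<epsilon> :: real assume "0 < \<epsilon>"
    from small[OF this] obtain a r where r: "?r a = ennreal r" "0 \<le> r" "r < \<epsilon>" by blast
    show "\<exists>a. \<forall>m>0. u m * \<mu> \<le> m + a + u m * \<epsilon> \<and> u m * \<kappa> \<le> c m + C * (a + u m * \<epsilon>)"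
    proof (intro exI allI impI conjI)
      fix m :: real assume m: "0 < m"
      have sum_le: "(\<Sum>k<n. renewals m k) \<le> ?U m" for n
        by (intro sum_le_suminf) auto
      have "(\<Sum>k<n. renewals m k * ennreal \<mu>) \<le> ennreal (m + a + u m * r)" for n
      proof -
        have "(\<Sum>k<n. renewals m k * ennreal \<mu>) \<le> ennreal m + (ennreal a + (\<Sum>k<n. renewals m k) * ?r a)"
          using partial[OF m, of n a] by (simp add: sum_distrib_right)
        also have "\<dots> \<le> ennreal m + (ennreal a + ?U m * ?r a)"
          by (intro add_left_mono mult_right_mono sum_le) simp
        also have "\<dots> = ennreal (m + a + u m * r)"
          using u[OF m] r m by (simp add: ennreal_mult ennreal_plus add.assoc)
        finally show ?thesis .
      qed
      then have "(\<Sum>k. renewals m k * ennreal \<mu>) \<le> ennreal (m + a + u m * r)"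
        by (intro suminf_le_const) auto
      then have "ennreal (u m * \<mu>) \<le> ennreal (m + a + u m * r)"
        using u[OF m] \<mu> by (simp add: ennreal_suminf_multc ennreal_mult)
      then have "u m * \<mu> \<le> m + a + u m * r" using u[OF m] r m by (subst (asm) ennreal_le_iff) auto
      also have "u m * r \<le> u m * \<epsilon>" using u[OF m] r by (intro mult_left_mono) auto
      finally show "u m * \<mu> \<le> m + a + u m * \<epsilon>" by simp
      have res: "(\<Sum>k. residual (\<lambda>_. 1) i j m k) \<le> ennreal (a + u m * r)"
      proof (rule suminf_le_const)
        fix n
        have "(\<Sum>k<n. residual (\<lambda>_. 1) i j m k) \<le> ennreal a + (\<Sum>k<n. renewals m k) * ?r a"
          using m ij by (intro sum_residual_le) auto
        also have "\<dots> \<le> ennreal a + ?U m * ?r a"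
          by (intro add_left_mono mult_right_mono sum_le) simp
        also have "\<dots> = ennreal (a + u m * r)"
          using u[OF m] r by (simp add: ennreal_mult ennreal_plus)
        finally show "(\<Sum>k<n. residual (\<lambda>_. 1) i j m k) \<le> ennreal (a + u m * r)" .
      qed auto
      have "ennreal (u m * \<kappa>) = (\<Sum>k. renewals m k * ennreal \<kappa>)"
        using u[OF m] \<kappa> by (simp add: ennreal_suminf_multc ennreal_mult)
      also have "\<dots> \<le> (\<Sum>k. (\<integral>\<^sup>+t\<in>{0..m}. (\<integral>\<^sup>+\<omega>. cycle_rate h i j k t \<omega> \<partial>M) \<partial>lborel) +
          ennreal C * residual (\<lambda>_. 1) i j m k)"
      proof (intro suminf_le)
        fix k
        have "renewals m k * ennreal \<kappa> \<le>
            (\<integral>\<^sup>+t\<in>{0..m}. (\<integral>\<^sup>+\<omega>. cycle_rate h i j k t \<omega> \<partial>M) \<partial>lborel) + residual h i j m k"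
          unfolding \<kappa>(1)[symmetric] using m by (intro renewal_split ij h) auto
        also have "\<dots> \<le> (\<integral>\<^sup>+t\<in>{0..m}. (\<integral>\<^sup>+\<omega>. cycle_rate h i j k t \<omega> \<partial>M) \<partial>lborel) +
            ennreal C * residual (\<lambda>_. 1) i j m k"
          by (intro add_left_mono residual_bounded ij C(2))
        finally show "renewals m k * ennreal \<kappa> \<le> \<dots>" .
      qed auto
      also have "\<dots> = running_cost h i j m + ennreal C * (\<Sum>k. residual (\<lambda>_. 1) i j m k)"
        unfolding running_cost_suminf[OF ij h]
        by (subst suminf_add[symmetric]) (auto simp: ennreal_suminf_cmult)
      also have "\<dots> \<le> ennreal (c m) + ennreal C * ennreal (a + u m * r)"
        unfolding c(1)[OF m] by (intro add_left_mono mult_left_mono res) simp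
      also have "\<dots> = ennreal (c m + C * (a + u m * r))"
        using c(2)[OF m] u[OF m] r C(1) by (simp add: ennreal_mult[symmetric] ennreal_plus[symmetric] del: ennreal_plus)
      finally have "u m * \<kappa> \<le> c m + C * (a + u m * r)"
        using c(2)[OF m] u[OF m] r C(1) by (subst (asm) ennreal_le_iff) auto
      also have "C * (a + u m * r) \<le> C * (a + u m * \<epsilon>)"
        using u[OF m] r C(1) by (intro mult_left_mono add_left_mono) auto
      finally show "u m * \<kappa> \<le> c m + C * (a + u m * \<epsilon>)" by simp
    qed
  qed (use \<mu> \<kappa> C(1) in auto)
  then have "((\<lambda>m. ennreal (c m / m)) \<longlongrightarrow> ennreal (\<kappa> / \<mu>)) at_top" by (rule tendsto_ennrealI)
  moreover have "ennreal (\<kappa> / \<mu>) = cycle_mean h i j / cycle_mean (\<lambda>_. 1) i j"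
    using \<mu> \<kappa> by (simp add: divide_ennreal)
  moreover have "\<forall>\<^sub>F m in at_top. running_cost h i j m / ennreal m = ennreal (c m / m)"
    using eventually_gt_at_top[of 0] by eventually_elim (simp add: c divide_ennreal)
  ultimately show ?thesis by (simp add: tendsto_cong)
qed

end

section \<open>The two costs\<close>

context standard_brownian_motion
begin

lemma increment_moments:
  assumes st: "0 \<le> s" "s < t"
  shows "integrable M (\<lambda>\<omega>. (B t \<omega> - B s \<omega>) ^ k)"
    and "expectation (\<lambda>\<omega>. B t \<omega> - B s \<omega>) = 0"
    and "expectation (\<lambda>\<omega>. (B t \<omega> - B s \<omega>) ^ 2) = t - s"
    and "expectation (\<lambda>\<omega>. (B t \<omega> - B s \<omega>) ^ 4) = 3 * (t - s)\<^sup>2"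
proof -
  let ?\<sigma> = "sqrt (t - s)"
  have \<sigma>: "0 < ?\<sigma>" using st by simp
  note D = gaussian_increments[OF st]
  have E: "expectation (\<lambda>\<omega>. (B t \<omega> - B s \<omega>) ^ k) = (\<integral>x. normal_density 0 ?\<sigma> x * (x - 0) ^ k \<partial>lborel)" for k
    using distributed_integral[OF D, of "\<lambda>x. x ^ k"] by simp
  show "integrable M (\<lambda>\<omega>. (B t \<omega> - B s \<omega>) ^ k)"
    using distributed_integrable[OF D, of "\<lambda>x. x ^ k"] integrable_normal_moment[OF \<sigma>, of 0 k] by simp
  show "expectation (\<lambda>\<omega>. B t \<omega> - B s \<omega>) = 0"
    using E[of 1] integral_normal_moment_odd[OF \<sigma>, of 0 0] by simp
  show "expectation (\<lambda>\<omega>. (B t \<omega> - B s \<omega>) ^ 2) = t - s"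
    using E[of 2] integral_normal_moment_even[OF \<sigma>, of 0 1] st by (simp add: fact_numeral)
  show "expectation (\<lambda>\<omega>. (B t \<omega> - B s \<omega>) ^ 4) = 3 * (t - s)\<^sup>2"
    using E[of 4] integral_normal_moment_even[OF \<sigma>, of 0 2] st
    by (simp add: fact_numeral power_divide field_simps)
qed

end

context brownian_family
begin

text \<open>The increments of two agents are independent and centred, so the mixed term vanishes and
  the variances add.\<close>

lemma second_moment_difference:
  assumes ij: "i \<in> I" "j \<in> I" "i \<noteq> j" and st: "0 \<le> s" "s \<le> t"
  shows "(\<integral>\<^sup>+\<omega>. ennreal ((v i t \<omega> - v i s \<omega> - (v j t \<omega> - v j s \<omega>))\<^sup>2) \<partial>M) = ennreal (2 * (t - s))"
proof (cases "s = t")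
  case False
  with st have lt: "s < t" by simp
  let ?X = "\<lambda>i \<omega>. v i t \<omega> - v i s \<omega>"
  note mi = standard_brownian_motion.increment_moments[OF brownian[OF ij(1)] st(1) lt]
  note mj = standard_brownian_motion.increment_moments[OF brownian[OF ij(2)] st(1) lt]
  have "indep_vars (\<lambda>_. borel) (\<lambda>i \<omega>. (\<lambda>p. p t - p s) (\<lambda>t\<in>{0..}. v i t \<omega>)) I"
    by (rule indep_vars_compose2[OF independent_paths])
      (use st in \<open>intro borel_measurable_diff measurable_component_singleton, auto\<close>)
  then have "indep_vars (\<lambda>_. borel) ?X I" using st by simp
  then have ind: "indep_vars (\<lambda>_. borel) ?X {i, j}" by (rule indep_vars_subset) (use ij in auto)
  have int: "integrable M (?X l)" if "l \<in> {i, j}" for l using mi(1)[of 1] mj(1)[of 1] that by auto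
  have cross: "integrable M (\<lambda>\<omega>. ?X i \<omega> * ?X j \<omega>)" "expectation (\<lambda>\<omega>. ?X i \<omega> * ?X j \<omega>) = 0"
    using indep_vars_integrable[OF _ ind int] indep_vars_lebesgue_integral[OF _ ind int] ij(3) mi(2) by auto
  have eq: "(?X i \<omega> - ?X j \<omega>)\<^sup>2 = (?X i \<omega>)^2 + (?X j \<omega>)^2 - 2 * (?X i \<omega> * ?X j \<omega>)" for \<omega>
    by (simp add: power2_diff)
  have "integrable M (\<lambda>\<omega>. (?X i \<omega> - ?X j \<omega>)\<^sup>2)"
    unfolding eq using mi(1)[of 2] mj(1)[of 2] cross(1) by auto
  moreover have "expectation (\<lambda>\<omega>. (?X i \<omega> - ?X j \<omega>)\<^sup>2) = 2 * (t - s)"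
    unfolding eq using mi(1)[of 2] mj(1)[of 2] cross mi(3) mj(3)
    by (simp add: Bochner_Integration.integral_diff Bochner_Integration.integral_add)
  ultimately show ?thesis by (subst nn_integral_eq_integral) auto
qed simp

end

lemma closed_loop_state_eq:
  assumes "\<tau> k \<omega> \<le> ennreal t" "ennreal t < \<tau> (Suc k) \<omega>"
    and "\<And>l. \<tau> l \<omega> \<le> ennreal t \<Longrightarrow> ennreal t < \<tau> (Suc l) \<omega> \<Longrightarrow> l = k"
  shows "closed_loop_state v \<tau> c i t \<omega> = c k \<omega> + (v i t \<omega> - v i (enn2real (\<tau> k \<omega>)) \<omega>)"
proof -
  have "(THE k. \<tau> k \<omega> \<le> ennreal t \<and> ennreal t < \<tau> (Suc k) \<omega>) = k"
    by (rule the_equality, simp add: assms(1,2)) (elim conjE, rule assms(3))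
  then show ?thesis by (simp add: closed_loop_state_def Let_def free_state_def)
qed

lemma ennreal_laplacian_form:
  assumes "pair_graph G"
  shows "ennreal (laplacian_form G x) = (\<Sum>(i, j)\<in>parcs G. ennreal (1/2) * ennreal ((x i - x j)\<^sup>2))"
proof -
  have "laplacian_form G x = (\<Sum>(i, j)\<in>parcs G. 1/2 * (x i - x j)\<^sup>2)"
    unfolding laplacian_form_edges[OF assms] by (simp add: sum_distrib_left case_prod_beta)
  also have "ennreal \<dots> = (\<Sum>(i, j)\<in>parcs G. ennreal (1/2 * (x i - x j)\<^sup>2))"
    by (subst sum_ennreal[symmetric]) (auto simp: case_prod_beta)
  also have "\<dots> = (\<Sum>(i, j)\<in>parcs G. ennreal (1/2) * ennreal ((x i - x j)\<^sup>2))"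
    by (simp only: ennreal_mult zero_le_power2 zero_le_divide_1_iff zero_le_numeral)
  finally show ?thesis .
qed

abbreviation square_rate :: "real \<times> real \<Rightarrow> ennreal" where
  "square_rate \<equiv> \<lambda>(_, d). ennreal (d\<^sup>2)"

lemma measurable_square_rate: "square_rate \<in> borel_measurable (borel \<Otimes>\<^sub>M borel)"
  by measurable

context brownian_family
begin

lemma edge_agents:
  assumes "pair_graph G" "pverts G = I" "(i, j) \<in> parcs G"
  shows "i \<in> I" "j \<in> I" "i \<noteq> j"
proof -
  interpret pair_graph G by fact
  show "i \<in> I" "j \<in> I" using in_arcsD1[of i j] in_arcsD2[of i j] assms by auto
  show "i \<noteq> j" using pair_no_loops[OF assms(3)] by simp
qed

text \<open>Layer cake: the mean is the integral over time of the probability that the first cycle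
  still runs. Infinite exit times are covered, since nothing is known about finiteness at this
  point.\<close>

lemma mean_T_ET_eq:
  assumes ij: "i \<in> I" "j \<in> I"
  shows "mean_T_ET M I v 1 = cycle_mean (\<lambda>_. 1) i j"
proof -
  interpret P: pair_sigma_finite lborel M ..
  let ?f = "\<lambda>(u, \<omega>). if 0 \<le> u \<and> ennreal u < first_exit \<omega> then 1 else (0 :: ennreal)"
  have [measurable]: "?f \<in> borel_measurable (lborel \<Otimes>\<^sub>M M)"
    using measurable_before_exit_time[OF ij, of "\<lambda>_. 1"] by simp
  have exit_time: "T_ET I v 1 \<omega> = first_exit \<omega>" if \<omega>: "\<omega> \<in> space M" for \<omega>
  proof -
    have "event_time I v (\<lambda>_ _. 0) 1 1 \<omega> = T_ET I v 1 \<omega>"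
      by (rule event_time_1_eq_T_ET) (use brownian \<omega> in auto)
    then have "T_ET I v 1 \<omega> = event_time I v (\<lambda>_ _. 0) 1 (Suc 0) \<omega>"
      by (simp only: One_nat_def)
    also have "\<dots> = reset_time I (path \<omega>) (Suc 0)" by (rule event_time_eq_reset_time)
    also have "\<dots> = exit_time I (shift 0 (path \<omega>))"
      using reset_time_Suc[OF finite_index paths_process[OF \<omega>], of 0 0] by simp
    also have "\<dots> = first_exit \<omega>"
      by (rule exit_time_cong) (simp add: shift_def start_zero_family[OF \<omega>])
    finally show ?thesis .
  qed
  have layer: "x = (\<integral>\<^sup>+u. (if 0 \<le> u \<and> ennreal u < x then 1 else 0) \<partial>lborel)" for x
  proof (cases x)
    case (real r)
    have "(\<integral>\<^sup>+u. (if 0 \<le> u \<and> ennreal u < x then 1 else 0) \<partial>lborel) = (\<integral>\<^sup>+u. indicator {0..<r} u \<partial>lborel)"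
      using real by (intro nn_integral_cong) (auto simp: ennreal_less_iff)
    then show ?thesis using real by simp
  next
    case top
    have "(\<integral>\<^sup>+u. (if 0 \<le> u \<and> ennreal u < x then 1 else 0) \<partial>lborel) = (\<integral>\<^sup>+u. indicator {0::real..} u \<partial>lborel)"
      using top by (intro nn_integral_cong) (auto simp: indicator_def)
    also have "\<dots> = emeasure lborel {0::real..}" by (rule nn_integral_indicator) simp
    also have "\<dots> = \<infinity>"
    proof (rule ccontr)
      assume "emeasure lborel {0::real..} \<noteq> \<infinity>"
      then obtain r where r: "0 \<le> r" "emeasure lborel {0::real..} = ennreal r"
        by (cases "emeasure lborel {0::real..}") auto
      have "emeasure lborel {0..r + 1} \<le> emeasure lborel {0::real..}" by (rule emeasure_mono) auto
      then have "r + 1 \<le> r" using r by (simp add: ennreal_plus[symmetric] del: ennreal_plus)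
      then show False by simp
    qed
    finally show ?thesis using top by simp
  qed
  have "mean_T_ET M I v 1 = (\<integral>\<^sup>+\<omega>. \<integral>\<^sup>+u. ?f (u, \<omega>) \<partial>lborel \<partial>M)"
    unfolding mean_T_ET_def using exit_time layer by (intro nn_integral_cong) simp
  also have "\<dots> = (\<integral>\<^sup>+u. \<integral>\<^sup>+\<omega>. ?f (u, \<omega>) \<partial>M \<partial>lborel)"
    by (rule P.Fubini') measurable
  finally show ?thesis by (simp add: cycle_mean_def)
qed

text \<open>The common consensus point cancels in every difference, so the integrand is a function
  of the noise alone and \<open>c\<close> may be any process, measurable or not. The renewal limit
  is applied to each edge, and the finite sum of the limits is the limit of the cost.\<close>

theorem J_ET_eq:
  assumes G: "pair_graph G" "pverts G = I" and fin: "mean_T_ET M I v 1 < \<infinity>"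
  shows "J_ET M G v c 1 = (\<Sum>(i, j)\<in>parcs G. ennreal (1/2) * (cycle_mean square_rate i j / mean_T_ET M I v 1))"
proof -
  interpret G: pair_graph G by fact
  have agents: "i \<in> I" "j \<in> I" if "(i, j) \<in> parcs G" for i j
    using edge_agents[OF G that] by auto
  have agents': "fst e \<in> I" "snd e \<in> I" if "e \<in> parcs G" for e
    using agents[of "fst e" "snd e"] that by simp_all
  let ?\<tau> = "event_time I v c 1"
  let ?L = "\<lambda>t. \<integral>\<^sup>+\<omega>. ennreal (laplacian_form G (\<lambda>i. closed_loop_state v ?\<tau> c i t \<omega>)) \<partial>M"
  have state: "ennreal (laplacian_form G (\<lambda>i. closed_loop_state v ?\<tau> c i t \<omega>)) =
      (\<Sum>(i, j)\<in>parcs G. ennreal (1/2) * (\<Sum>k. cycle_rate square_rate i j k t \<omega>))"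
    if t: "0 \<le> t" and \<omega>: "\<omega> \<in> space M" for t \<omega>
  proof -
    obtain k where k: "event_at k \<omega> \<le> ennreal t" "ennreal t < event_at (Suc k) \<omega>"
      using reset_time_exists_index[OF finite_index paths_process[OF \<omega>] t] by blast
    have cl: "closed_loop_state v ?\<tau> c i t \<omega> =
        c k \<omega> + (v i t \<omega> - v i (enn2real (event_at k \<omega>)) \<omega>)" for i
      unfolding event_time_eq_reset_time[symmetric, where c=c]
    proof (rule closed_loop_state_eq)
      show "event_time I v c 1 k \<omega> \<le> ennreal t" "ennreal t < event_time I v c 1 (Suc k) \<omega>"
        unfolding event_time_eq_reset_time by (rule k)+
      show "l = k" if "event_time I v c 1 l \<omega> \<le> ennreal t" "ennreal t < event_time I v c 1 (Suc l) \<omega>" for l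
        using that unfolding event_time_eq_reset_time by (rule reset_time_unique_index[OF _ _ k])
    qed
    show ?thesis
      unfolding ennreal_laplacian_form[OF G(1)] suminf_cycle_rate[OF \<omega> t k] cl
      using k t by (intro sum.cong refl) (auto simp: cycle_rate_def shift_def simp del: reset_time.simps)
  qed
  have cost: "(\<integral>\<^sup>+t\<in>{0..m}. ?L t \<partial>lborel) =
      (\<Sum>(i, j)\<in>parcs G. ennreal (1/2) * running_cost square_rate i j m)" for m
  proof -
    let ?r = "\<lambda>e t \<omega>. \<Sum>k. cycle_rate square_rate (fst e) (snd e) k t \<omega>"
    have m1: "?r e t \<in> borel_measurable M" if "e \<in> parcs G" for e t
    proof -
      have [measurable]: "cycle_rate square_rate (fst e) (snd e) k t \<in> borel_measurable M" for k
        using that by (intro measurable_rate_section measurable_square_rate agents')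
      show ?thesis by measurable
    qed
    have m2: "(\<lambda>t. (\<integral>\<^sup>+\<omega>. ?r e t \<omega> \<partial>M) * indicator {0..m} t) \<in> borel_measurable lborel" if "e \<in> parcs G" for e
    proof -
      have "(\<lambda>(t, \<omega>). cycle_rate square_rate (fst e) (snd e) k t \<omega>) \<in> borel_measurable (lborel \<Otimes>\<^sub>M M)" for k
        using that by (intro measurable_cycle_rate measurable_square_rate agents')
      note [measurable] = this
      show ?thesis by measurable
    qed
    have "(\<integral>\<^sup>+t\<in>{0..m}. ?L t \<partial>lborel) =
        (\<integral>\<^sup>+t. (\<Sum>e\<in>parcs G. ennreal (1/2) * ((\<integral>\<^sup>+\<omega>. ?r e t \<omega> \<partial>M) * indicator {0..m} t)) \<partial>lborel)"
    proof (rule nn_integral_cong)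
      fix t :: real
      show "?L t * indicator {0..m} t =
        (\<Sum>e\<in>parcs G. ennreal (1/2) * ((\<integral>\<^sup>+\<omega>. ?r e t \<omega> \<partial>M) * indicator {0..m} t))"
      proof (cases "t \<in> {0..m}")
        case True
        have "?L t =
            (\<integral>\<^sup>+\<omega>. (\<Sum>e\<in>parcs G. ennreal (1/2) * ?r e t \<omega>) \<partial>M)"
          using True by (intro nn_integral_cong) (simp add: state case_prod_beta)
        also have "\<dots> = (\<Sum>e\<in>parcs G. ennreal (1/2) * (\<integral>\<^sup>+\<omega>. ?r e t \<omega> \<partial>M))"
          using m1 by (simp add: nn_integral_sum nn_integral_cmult del: ennreal_half)
        finally show ?thesis using True by simp
      qed simp
    qed
    also have "\<dots> = (\<Sum>e\<in>parcs G. ennreal (1/2) * (\<integral>\<^sup>+t. (\<integral>\<^sup>+\<omega>. ?r e t \<omega> \<partial>M) * indicator {0..m} t \<partial>lborel))"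
      using m2 by (simp add: nn_integral_sum nn_integral_cmult)
    finally show ?thesis by (simp add: running_cost_def case_prod_beta)
  qed
  \<comment> \<open>The constant 4 is the square of 2, the bound for the distance of two agents
    within a cycle.\<close>
  have lim: "((\<lambda>m. running_cost square_rate i j m / ennreal m) \<longlongrightarrow> cycle_mean square_rate i j / mean_T_ET M I v 1) at_top"
    if ij: "i \<in> I" "j \<in> I" for i j
    unfolding mean_T_ET_eq[OF ij]
  proof (rule running_cost_limit[OF ij measurable_square_rate, where C=4])
    show "square_rate (u, d) \<le> ennreal 4" if "\<bar>d\<bar> < 2" for u d :: real
    proof -
      have "d\<^sup>2 \<le> 2\<^sup>2" using that by (intro power2_le_iff_abs_le[THEN iffD2]) auto
      then have "ennreal (d\<^sup>2) \<le> ennreal 4" by (intro ennreal_leI) simp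
      then show ?thesis by simp
    qed
    show "cycle_mean (\<lambda>_. 1) i j < \<infinity>" using fin mean_T_ET_eq[OF ij] by simp
  qed simp
  have "((\<lambda>m. (\<Sum>(i, j)\<in>parcs G. ennreal (1/2) * running_cost square_rate i j m) / ennreal m) \<longlongrightarrow>
      (\<Sum>(i, j)\<in>parcs G. ennreal (1/2) * (cycle_mean square_rate i j / mean_T_ET M I v 1))) at_top"
  proof -
    have "(\<Sum>(i, j)\<in>parcs G. ennreal (1/2) * running_cost square_rate i j m) / ennreal m =
        (\<Sum>(i, j)\<in>parcs G. ennreal (1/2) * (running_cost square_rate i j m / ennreal m))" for m
      by (simp add: divide_ennreal_def sum_distrib_right case_prod_beta mult.assoc)
    moreover have "((\<lambda>m. \<Sum>(i, j)\<in>parcs G. ennreal (1/2) * (running_cost square_rate i j m / ennreal m)) \<longlongrightarrow>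
        (\<Sum>(i, j)\<in>parcs G. ennreal (1/2) * (cycle_mean square_rate i j / mean_T_ET M I v 1))) at_top"
      unfolding case_prod_beta
      by (intro tendsto_sum ennreal_tendsto_cmult lim[unfolded case_prod_beta] agents' ennreal_less_top)
    ultimately show ?thesis by (simp only:)
  qed
  then show ?thesis
    unfolding J_ET_def consensus_cost_def G(2) cost by (intro lim_imp_Limsup) auto
qed

section \<open>The time-triggered cost as the mean of a sawtooth\<close>

lemma integral_sawtooth:
  assumes T: "0 < T"
  shows "(\<integral>\<^sup>+t. ennreal (t - of_int \<lfloor>t / T\<rfloor> * T) * indicator {0..<real n * T} t \<partial>lborel) = ennreal (n * (T\<^sup>2 / 2))"
proof -
  have period: "(\<integral>\<^sup>+t. ennreal (t - real k * T) * indicator {real k * T..<real (Suc k) * T} t \<partial>lborel) = ennreal (T\<^sup>2 / 2)" for k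
  proof -
    have "(\<integral>\<^sup>+t. ennreal (t - real k * T) * indicator {real k * T..<real (Suc k) * T} t \<partial>lborel) =
        (\<integral>\<^sup>+t. ennreal t * indicator {0..<T} t \<partial>lborel)"
      by (subst nn_integral_real_affine[where c=1 and t="real k * T"])
        (auto simp: algebra_simps indicator_def intro!: nn_integral_cong)
    also have "\<dots> = (\<integral>\<^sup>+t. ennreal t * indicator {0..T} t \<partial>lborel)"
      using AE_lborel_singleton[of T] by (intro nn_integral_cong_AE) (auto simp: indicator_def elim!: eventually_mono)
    also have "\<dots> = ennreal (T\<^sup>2 / 2 - 0\<^sup>2 / 2)"
      using T by (intro nn_integral_FTC_Icc) (auto intro!: derivative_eq_intros)
    finally show ?thesis by simp
  qed
  \<comment> \<open>Half-open periods tile the interval, and on the period starting at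
    \<open>real k * T\<close> the floor is constantly \<open>k\<close>.\<close>
  have "ennreal (t - of_int \<lfloor>t / T\<rfloor> * T) * indicator {0..<real n * T} t =
      (\<Sum>k<n. ennreal (t - real k * T) * indicator {real k * T..<real (Suc k) * T} t)" for t
  proof (induction n)
    case (Suc n)
    have split: "indicator {0..<real (Suc n) * T} t = indicator {0..<real n * T} t +
        (indicator {real n * T..<real (Suc n) * T} t :: ennreal)"
    proof -
      have "0 \<le> real n * T" "real (Suc n) * T = real n * T + T" using T by (auto simp: algebra_simps)
      moreover from this have "0 \<le> t" if "real n * T \<le> t" using that by linarith
      ultimately show ?thesis
        using T unfolding indicator_def by (cases "real n * T \<le> t") (simp_all add: not_le del: of_nat_Suc)
    qed
    have "\<lfloor>t / T\<rfloor> = int n" if "t \<in> {real n * T..<real (Suc n) * T}"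
      using that T by (intro floor_unique) (auto simp: field_simps)
    then have "ennreal (t - of_int \<lfloor>t / T\<rfloor> * T) * indicator {real n * T..<real (Suc n) * T} t =
        ennreal (t - real n * T) * indicator {real n * T..<real (Suc n) * T} t"
      by (cases "t \<in> {real n * T..<real (Suc n) * T}") simp_all
    then show ?case unfolding split distrib_left Suc.IH by simp
  qed simp
  then have "(\<integral>\<^sup>+t. ennreal (t - of_int \<lfloor>t / T\<rfloor> * T) * indicator {0..<real n * T} t \<partial>lborel) =
      (\<Sum>k<n. \<integral>\<^sup>+t. ennreal (t - real k * T) * indicator {real k * T..<real (Suc k) * T} t \<partial>lborel)"
    by (simp only: nn_integral_sum) (intro nn_integral_sum, measurable)
  also have "\<dots> = ennreal (n * (T\<^sup>2 / 2))"
    unfolding period by (simp add: ennreal_mult[symmetric] ennreal_of_nat_eq_real_of_nat)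
  finally show ?thesis .
qed

text \<open>The horizon lies between two consecutive multiples of the period, and the incomplete
  period is negligible after division by \<open>m\<close>.\<close>

lemma mean_sawtooth:
  assumes T: "0 < T"
  shows "((\<lambda>m. (\<integral>\<^sup>+t\<in>{0..m}. ennreal (t - of_int \<lfloor>t / T\<rfloor> * T) \<partial>lborel) / ennreal m) \<longlongrightarrow> ennreal (T / 2)) at_top"
proof (rule tendsto_sandwich)
  let ?F = "\<lambda>m. \<integral>\<^sup>+t\<in>{0..m}. ennreal (t - of_int \<lfloor>t / T\<rfloor> * T) \<partial>lborel"
  have lower: "ennreal ((m / T - 1) * (T\<^sup>2 / 2)) \<le> ?F m" and upper: "?F m \<le> ennreal ((m / T + 1) * (T\<^sup>2 / 2))"
    if m: "0 < m" for m
  proof -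
    define n where "n = nat \<lfloor>m / T\<rfloor>"
    have n: "real n \<le> m / T" "m / T < real n + 1" using m T by (auto simp: n_def)
    then have nT: "real n * T \<le> m" "m < real (Suc n) * T" using T by (auto simp: field_simps)
    have "(m / T - 1) * (T\<^sup>2 / 2) \<le> n * (T\<^sup>2 / 2)" using n by (intro mult_right_mono) auto
    then have "ennreal ((m / T - 1) * (T\<^sup>2 / 2)) \<le> ennreal (n * (T\<^sup>2 / 2))" by (rule ennreal_leI)
    also have "\<dots> \<le> ?F m" unfolding integral_sawtooth[OF T, symmetric]
      using nT by (intro nn_integral_mono mult_left_mono) (auto simp: indicator_def)
    finally show "ennreal ((m / T - 1) * (T\<^sup>2 / 2)) \<le> ?F m" .
    have "?F m \<le> ennreal (Suc n * (T\<^sup>2 / 2))" unfolding integral_sawtooth[OF T, symmetric]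
      using nT by (intro nn_integral_mono mult_left_mono) (auto simp: indicator_def)
    also have "\<dots> \<le> ennreal ((m / T + 1) * (T\<^sup>2 / 2))"
      using n by (intro ennreal_leI mult_right_mono) auto
    finally show "?F m \<le> ennreal ((m / T + 1) * (T\<^sup>2 / 2))" .
  qed
  show "\<forall>\<^sub>F m in at_top. ennreal ((m / T - 1) * (T\<^sup>2 / 2) / m) \<le> ?F m / ennreal m"
    \<comment> \<open>Beyond one period the lower bound is nonnegative, so that
      \<open>ennreal\<close> does not truncate it before the division.\<close>
    using eventually_gt_at_top[of T]
  proof eventually_elim
    case (elim m)
    then have "0 < m" "0 \<le> (m / T - 1) * (T\<^sup>2 / 2)" using T by (auto simp: field_simps)
    then show ?case
      using divide_right_mono_ennreal[OF lower[of m], of "ennreal m"] divide_ennreal[of "(m / T - 1) * (T\<^sup>2 / 2)" m]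
      by simp
  qed
  show "\<forall>\<^sub>F m in at_top. ?F m / ennreal m \<le> ennreal ((m / T + 1) * (T\<^sup>2 / 2) / m)"
    using eventually_gt_at_top[of 0]
  proof eventually_elim
    case (elim m)
    then have "0 \<le> (m / T + 1) * (T\<^sup>2 / 2)" using T by auto
    then show ?case
      using elim divide_right_mono_ennreal[OF upper[of m], of "ennreal m"]
        divide_ennreal[of "(m / T + 1) * (T\<^sup>2 / 2)" m] by simp
  qed
  have "((\<lambda>m. (m / T - 1) * (T\<^sup>2 / 2) / m) \<longlongrightarrow> T / 2) at_top"
    using T by (real_asymp; simp add: power2_eq_square field_simps)
  then show "((\<lambda>m. ennreal ((m / T - 1) * (T\<^sup>2 / 2) / m)) \<longlongrightarrow> ennreal (T / 2)) at_top"
    by (rule tendsto_ennrealI)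
  have "((\<lambda>m. (m / T + 1) * (T\<^sup>2 / 2) / m) \<longlongrightarrow> T / 2) at_top"
    using T by (real_asymp; simp add: power2_eq_square field_simps)
  then show "((\<lambda>m. ennreal ((m / T + 1) * (T\<^sup>2 / 2) / m)) \<longlongrightarrow> ennreal (T / 2)) at_top"
    by (rule tendsto_ennrealI)
qed

text \<open>At time \<open>t\<close> half the mean squared difference along an edge equals the time
  since the last reset, whose long-run mean is \<open>T / 2\<close>; every ordered edge contributes
  the same amount.\<close>

theorem J_TT_eq:
  fixes T :: real
  assumes G: "pair_graph G" "pverts G = I" and T: "0 < T"
  shows "J_TT M G v c T = ennreal (card (parcs G) * T / 2)"
proof -
  interpret G: pair_graph G by fact
  let ?\<tau> = "\<lambda>k \<omega>. ennreal (real k * T)"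
  let ?L = "\<lambda>t. \<integral>\<^sup>+\<omega>. ennreal (laplacian_form G (\<lambda>i. closed_loop_state v ?\<tau> c i t \<omega>)) \<partial>M"
  let ?saw = "\<lambda>t::real. t - of_int \<lfloor>t / T\<rfloor> * T"
  have mean: "?L t =
      ennreal (card (parcs G)) * ennreal (?saw t)" if t: "0 \<le> t" for t
  proof -
    define k where "k = nat \<lfloor>t / T\<rfloor>"
    have k: "real k = of_int \<lfloor>t / T\<rfloor>" using t T by (simp add: k_def)
    have "real k \<le> t / T" "t / T < real k + 1" unfolding k by linarith+
    then have kT: "real k * T \<le> t" "t < real (Suc k) * T" using T by (auto simp: field_simps)
    have uniq: "l = k" if "real l * T \<le> t" "t < real (Suc l) * T" for l
    proof -
      have "real l \<le> t / T" "t / T < real l + 1" using that T by (auto simp: field_simps)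
      then have "\<lfloor>t / T\<rfloor> = int l" by (intro floor_unique) auto
      then show ?thesis by (simp add: k_def)
    qed
    have cl: "closed_loop_state v ?\<tau> c i t \<omega> = c k \<omega> + (v i t \<omega> - v i (real k * T) \<omega>)" for i \<omega>
    proof -
      have "closed_loop_state v ?\<tau> c i t \<omega> = c k \<omega> + (v i t \<omega> - v i (enn2real (ennreal (real k * T))) \<omega>)"
      proof (rule closed_loop_state_eq)
        show "ennreal (real k * T) \<le> ennreal t" "ennreal t < ennreal (real (Suc k) * T)"
          using kT t by (auto simp: ennreal_less_iff intro: ennreal_leI)
        show "l = k" if "ennreal (real l * T) \<le> ennreal t" "ennreal t < ennreal (real (Suc l) * T)" for l
          using that t T by (intro uniq) (auto simp: ennreal_less_iff)
      qed
      then show ?thesis using T by simp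
    qed
    have edge: "(\<integral>\<^sup>+\<omega>. ennreal (1/2) * ennreal ((closed_loop_state v ?\<tau> c i t \<omega> - closed_loop_state v ?\<tau> c j t \<omega>)\<^sup>2) \<partial>M) =
        ennreal (?saw t)"
      and edge_meas: "(\<lambda>\<omega>. ennreal (1/2) * ennreal ((closed_loop_state v ?\<tau> c i t \<omega> - closed_loop_state v ?\<tau> c j t \<omega>)\<^sup>2)) \<in> borel_measurable M"
      if e: "(i, j) \<in> parcs G" for i j
    proof -
      note ij = edge_agents[OF G e]
      have [measurable]: "v i t \<in> borel_measurable M" "v j t \<in> borel_measurable M"
        "v i (real k * T) \<in> borel_measurable M" "v j (real k * T) \<in> borel_measurable M"
        using ij t T by (auto intro!: measurable_process)
      have "closed_loop_state v ?\<tau> c i t \<omega> - closed_loop_state v ?\<tau> c j t \<omega> =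
          v i t \<omega> - v i (real k * T) \<omega> - (v j t \<omega> - v j (real k * T) \<omega>)" for \<omega>
        by (simp add: cl)
      note diff = this
      show "(\<lambda>\<omega>. ennreal (1/2) * ennreal ((closed_loop_state v ?\<tau> c i t \<omega> - closed_loop_state v ?\<tau> c j t \<omega>)\<^sup>2)) \<in> borel_measurable M"
        unfolding diff by measurable
      have "(\<integral>\<^sup>+\<omega>. ennreal (1/2) * ennreal ((closed_loop_state v ?\<tau> c i t \<omega> - closed_loop_state v ?\<tau> c j t \<omega>)\<^sup>2) \<partial>M) =
          ennreal (1/2) * ennreal (2 * (t - real k * T))"
        unfolding diff using second_moment_difference[OF ij, of "real k * T" t] kT T
        by (subst nn_integral_cmult) auto
      also have "\<dots> = ennreal (?saw t)"
        using kT by (subst ennreal_mult[symmetric]) (auto simp: k)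
      finally show "(\<integral>\<^sup>+\<omega>. ennreal (1/2) * ennreal ((closed_loop_state v ?\<tau> c i t \<omega> - closed_loop_state v ?\<tau> c j t \<omega>)\<^sup>2) \<partial>M) =
        ennreal (?saw t)" .
    qed
    have "?L t =
        (\<Sum>(i, j)\<in>parcs G. ennreal (?saw t))"
      unfolding ennreal_laplacian_form[OF G(1)]
      using edge edge_meas by (subst nn_integral_sum) (auto intro!: sum.cong simp: case_prod_beta)
    also have "\<dots> = ennreal (card (parcs G)) * ennreal (?saw t)"
      by (simp add: case_prod_beta ennreal_of_nat_eq_real_of_nat)
    finally show ?thesis .
  qed
  have "(\<integral>\<^sup>+t\<in>{0..m}. ?L t \<partial>lborel) =
      ennreal (card (parcs G)) * (\<integral>\<^sup>+t\<in>{0..m}. ennreal (?saw t) \<partial>lborel)" for m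
  proof -
    have "(\<integral>\<^sup>+t\<in>{0..m}. ?L t \<partial>lborel) =
        (\<integral>\<^sup>+t. ennreal (card (parcs G)) * (ennreal (?saw t) * indicator {0..m} t) \<partial>lborel)"
      using mean by (intro nn_integral_cong) (auto simp: indicator_def)
    then show ?thesis by (simp add: nn_integral_cmult)
  qed
  note cost = this
  have "((\<lambda>m. ennreal (card (parcs G)) * ((\<integral>\<^sup>+t\<in>{0..m}. ennreal (?saw t) \<partial>lborel) / ennreal m)) \<longlongrightarrow>
      ennreal (card (parcs G)) * ennreal (T / 2)) at_top"
    by (intro ennreal_tendsto_cmult mean_sawtooth T) simp
  then have "J_TT M G v c T = ennreal (card (parcs G)) * ennreal (T / 2)"
    unfolding J_TT_def consensus_cost_def cost ennreal_times_divide by (intro lim_imp_Limsup) auto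
  also have "\<dots> = ennreal (card (parcs G) * T / 2)"
    using T by (simp add: ennreal_mult[symmetric] del: ennreal_of_nat_eq_real_of_nat)
  finally show ?thesis .
qed

end

section \<open>The first exit time of many Brownian motions\<close>

text \<open>The standard normal density at \<open>x + 1\<close>, a lower bound for the mass of \<open>{x<..x + 1}\<close> if \<open>0 \<le> x\<close>.\<close>

definition gauss_lower :: "real \<Rightarrow> real" where
  "gauss_lower x = exp (- (x + 1)\<^sup>2 / 2) / sqrt (2 * pi)"

lemma gauss_lower_pos: "0 < gauss_lower x"
  by (simp add: gauss_lower_def)

context standard_brownian_motion
begin

lemma measurable_marginal: "0 \<le> s \<Longrightarrow> {\<omega> \<in> space M. P (B s \<omega>)} \<in> sets M" if "{x. P x} \<in> sets borel"
  using measurable_sets[OF measurable_at that, of s] by (simp add: vimage_def Int_def conj_commute)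

lemma marginal:
  assumes s: "0 < s" and P: "{x. P x} \<in> sets borel"
  shows "emeasure M {\<omega> \<in> space M. P (B s \<omega>)} =
    (\<integral>\<^sup>+x. ennreal (normal_density 0 (sqrt s) x) * indicator {x. P x} x \<partial>lborel)"
proof -
  have [measurable]: "B s \<in> borel_measurable M" using s by (intro measurable_at) simp
  have D: "distributed M lborel (\<lambda>\<omega>. B s \<omega> - B 0 \<omega>) (normal_density 0 (sqrt s))"
    using gaussian_increments[of 0 s] s by simp
  have "emeasure M {\<omega> \<in> space M. P (B s \<omega>)} = (\<integral>\<^sup>+\<omega>. indicator {\<omega> \<in> space M. P (B s \<omega>)} \<omega> \<partial>M)"
    using measurable_marginal[OF P, of s] s by simp
  also have "\<dots> = (\<integral>\<^sup>+\<omega>. indicator {x. P x} (B s \<omega> - B 0 \<omega>) \<partial>M)"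
    by (intro nn_integral_cong) (simp add: start_zero indicator_def)
  also have "\<dots> = (\<integral>\<^sup>+x. ennreal (normal_density 0 (sqrt s) x) * indicator {x. P x} x \<partial>lborel)"
    using P by (intro distributed_nn_integral[OF D, symmetric]) simp
  finally show ?thesis .
qed

text \<open>If \<open>\<eta> < \<bar>x\<bar>\<close>, the centre \<open>m\<close> among
  \<open>\<eta>\<close> and \<open>- \<eta>\<close> that lies on the side of \<open>x\<close>
  satisfies \<open>\<eta>\<^sup>2 + (x - m)\<^sup>2 \<le> x\<^sup>2\<close>. The centred density is
  thus at most the exponential factor times a shifted density, and two shifted densities of mass 1
  give the factor 2.\<close>

lemma prob_marginal_upper:
  assumes s: "0 < s" and \<eta>: "0 \<le> \<eta>"
  shows "prob {\<omega> \<in> space M. \<eta> < \<bar>B s \<omega>\<bar>} \<le> 2 * exp (- \<eta>\<^sup>2 / (2 * s))"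
proof -
  let ?e = "exp (- \<eta>\<^sup>2 / (2 * s))" and ?n = "\<lambda>m. normal_density m (sqrt s)"
  have one: "(\<integral>\<^sup>+x. ennreal (?n m x) \<partial>lborel) = 1" for m
    using s by (subst nn_integral_eq_integral) auto
  have point: "?n 0 x * indicator {x. \<eta> < \<bar>x\<bar>} x \<le> ?e * (?n \<eta> x + ?n (- \<eta>) x)" for x
  proof (cases "\<eta> < \<bar>x\<bar>")
    case True
    have "\<exists>m\<in>{\<eta>, - \<eta>}. \<eta>\<^sup>2 + (x - m)\<^sup>2 \<le> x\<^sup>2"
    proof (cases "0 \<le> x")
      case True
      with \<open>\<eta> < \<bar>x\<bar>\<close> \<eta> have "\<eta> * \<eta> \<le> \<eta> * x" by (intro mult_left_mono) auto
      then show ?thesis by (intro bexI[of _ \<eta>]) (auto simp: power2_eq_square algebra_simps)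
    next
      case False
      with \<open>\<eta> < \<bar>x\<bar>\<close> \<eta> have "\<eta> * \<eta> \<le> \<eta> * - x" by (intro mult_left_mono) auto
      then show ?thesis by (intro bexI[of _ "- \<eta>"]) (auto simp: power2_eq_square algebra_simps)
    qed
    then obtain m where m: "m \<in> {\<eta>, - \<eta>}" "\<eta>\<^sup>2 + (x - m)\<^sup>2 \<le> x\<^sup>2" by blast
    have "(\<eta>\<^sup>2 + (x - m)\<^sup>2) / (2 * s) \<le> x\<^sup>2 / (2 * s)"
      using m(2) s by (intro divide_right_mono) auto
    then have "- x\<^sup>2 / (2 * s) \<le> - \<eta>\<^sup>2 / (2 * s) + - (x - m)\<^sup>2 / (2 * s)"
      by (simp add: add_divide_distrib)
    then have "exp (- x\<^sup>2 / (2 * s)) \<le> ?e * exp (- (x - m)\<^sup>2 / (2 * s))"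
      by (simp add: exp_add[symmetric])
    then have "?n 0 x \<le> ?e * ?n m x"
      using s by (simp add: normal_density_def divide_right_mono)
    also have "\<dots> \<le> ?e * (?n \<eta> x + ?n (- \<eta>) x)"
      using m(1) by (intro mult_left_mono) auto
    finally show ?thesis using True by simp
  qed (simp add: add_nonneg_nonneg)
  have "emeasure M {\<omega> \<in> space M. \<eta> < \<bar>B s \<omega>\<bar>} \<le> (\<integral>\<^sup>+x. ennreal (?e * (?n \<eta> x + ?n (- \<eta>) x)) \<partial>lborel)"
  proof (subst marginal[OF s], measurable, intro nn_integral_mono)
    fix x
    have "ennreal (?n 0 x) * indicator {x. \<eta> < \<bar>x\<bar>} x = ennreal (?n 0 x * indicator {x. \<eta> < \<bar>x\<bar>} x)"
      by (simp add: indicator_def)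
    also have "\<dots> \<le> ennreal (?e * (?n \<eta> x + ?n (- \<eta>) x))" by (intro ennreal_leI point)
    finally show "ennreal (?n 0 x) * indicator {x. \<eta> < \<bar>x\<bar>} x \<le> ennreal (?e * (?n \<eta> x + ?n (- \<eta>) x))" .
  qed
  also have "\<dots> = (\<integral>\<^sup>+x. ennreal ?e * (ennreal (?n \<eta> x) + ennreal (?n (- \<eta>) x)) \<partial>lborel)"
    by (simp add: ennreal_mult ennreal_plus add_nonneg_nonneg)
  also have "\<dots> = ennreal ?e * 2"
    by (simp add: nn_integral_cmult nn_integral_add one)
  also have "\<dots> = ennreal (2 * ?e)" by (simp add: ennreal_mult mult.commute)
  finally show ?thesis by (simp add: emeasure_eq_measure)
qed

text \<open>Only the window from \<open>r\<close> to \<open>r + sqrt s\<close> is used, where the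
  density is at least its value at the right end. A window of one standard deviation makes the bound
  depend on \<open>r / sqrt s\<close> alone.\<close>

lemma prob_marginal_lower:
  assumes s: "0 < s" and r: "0 \<le> r"
  shows "gauss_lower (r / sqrt s) \<le> prob {\<omega> \<in> space M. r < \<bar>B s \<omega>\<bar>}"
proof -
  let ?\<sigma> = "sqrt s"
  let ?c = "exp (- (r + ?\<sigma>)\<^sup>2 / (2 * s)) / (sqrt (2 * pi) * ?\<sigma>)"
  have \<sigma>: "0 < ?\<sigma>" "?\<sigma>\<^sup>2 = s" using s by auto
  have "r + ?\<sigma> = (r / ?\<sigma> + 1) * ?\<sigma>" using \<sigma> by (simp add: field_simps)
  then have "(r + ?\<sigma>)\<^sup>2 = (r / ?\<sigma> + 1)\<^sup>2 * s" using \<sigma> by (simp add: power_mult_distrib)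
  then have c: "?c * ?\<sigma> = gauss_lower (r / ?\<sigma>)"
    using s by (simp add: gauss_lower_def)
  have "ennreal (gauss_lower (r / ?\<sigma>)) = ennreal ?c * emeasure lborel {r<..r + ?\<sigma>}"
    using \<sigma> c by (simp add: ennreal_mult[symmetric])
  also have "\<dots> = (\<integral>\<^sup>+x. ennreal ?c * indicator {r<..r + ?\<sigma>} x \<partial>lborel)"
    by (simp add: nn_integral_cmult)
  also have "\<dots> \<le> (\<integral>\<^sup>+x. ennreal (normal_density 0 ?\<sigma> x) * indicator {x. r < \<bar>x\<bar>} x \<partial>lborel)"
  proof (intro nn_integral_mono)
    fix x
    have "?c \<le> normal_density 0 ?\<sigma> x" if "r < x" "x \<le> r + ?\<sigma>"
    proof -
      have "x\<^sup>2 \<le> (r + ?\<sigma>)\<^sup>2" using that r by (intro power_mono) auto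
      then have "exp (- (r + ?\<sigma>)\<^sup>2 / (2 * s)) \<le> exp (- x\<^sup>2 / (2 * s))"
        using s by (simp add: divide_right_mono)
      then show ?thesis using s
        by (simp add: normal_density_def real_sqrt_mult divide_right_mono)
    qed
    then show "ennreal ?c * indicator {r<..r + ?\<sigma>} x \<le> ennreal (normal_density 0 ?\<sigma> x) * indicator {x. r < \<bar>x\<bar>} x"
      using r by (auto simp: indicator_def intro!: ennreal_leI)
  qed
  also have "\<dots> = emeasure M {\<omega> \<in> space M. r < \<bar>B s \<omega>\<bar>}" by (rule marginal[OF s, symmetric]) measurable
  finally show ?thesis by (simp add: emeasure_eq_measure)
qed

text \<open>Reflection gives both signs the same probability, and together they cover the space.
  Time 0 is included because in Levy's inequality the last grid time may be the end of the
  interval.\<close>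

lemma prob_marginal_sign:
  assumes s: "0 \<le> s"
  shows "1 / 2 \<le> prob {\<omega> \<in> space M. 0 \<le> B s \<omega>}" "1 / 2 \<le> prob {\<omega> \<in> space M. B s \<omega> \<le> 0}"
proof -
  let ?P = "{\<omega> \<in> space M. 0 \<le> B s \<omega>}" and ?N = "{\<omega> \<in> space M. B s \<omega> \<le> 0}"
  have sets: "?P \<in> sets M" "?N \<in> sets M" using s by (auto intro!: measurable_marginal)
  have "emeasure M ?P = emeasure M ?N"
  proof (cases "s = 0")
    case True
    then have "?P = ?N" using start_zero by auto
    then show ?thesis by simp
  next
    case False
    then have s: "0 < s" using assms by simp
    have "emeasure M ?P = (\<integral>\<^sup>+x. ennreal (normal_density 0 (sqrt s) x) * indicator {x. 0 \<le> x} x \<partial>lborel)"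
      by (rule marginal[OF s]) measurable
    also have "\<dots> = (\<integral>\<^sup>+x. ennreal (normal_density 0 (sqrt s) (- x)) * indicator {x. 0 \<le> x} (- x) \<partial>lborel)"
      by (subst nn_integral_real_affine[where c="-1" and t=0]) auto
    also have "\<dots> = (\<integral>\<^sup>+x. ennreal (normal_density 0 (sqrt s) x) * indicator {x. x \<le> 0} x \<partial>lborel)"
      by (intro nn_integral_cong) (simp add: normal_density_def indicator_def)
    also have "\<dots> = emeasure M ?N" by (rule marginal[OF s, symmetric]) measurable
    finally show ?thesis .
  qed
  then have eq: "prob ?P = prob ?N" by (simp add: measure_def)
  have "?P \<union> ?N = space M" by auto
  then have "1 = prob (?P \<union> ?N)" by (simp add: prob_space)
  also have "\<dots> \<le> prob ?P + prob ?N" using sets by (rule measure_Un_le)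
  finally show "1 / 2 \<le> prob ?P" "1 / 2 \<le> prob ?N" using eq by auto
qed

end

section \<open>Survival probability of the first cycle\<close>

context brownian_family
begin

text \<open>Levy's inequality: at the first grid time where the path exceeds the level, the remaining
  increment is independent and has the favourable sign with probability at least one half.\<close>

lemma levy_inequality:
  assumes i: "i \<in> I" and F: "finite F" "F \<subseteq> {0..s}" and \<eta>: "0 \<le> \<eta>"
  shows "prob {\<omega> \<in> space M. \<exists>t\<in>F. \<eta> < \<bar>v i t \<omega>\<bar>} \<le> 2 * prob {\<omega> \<in> space M. (\<exists>t\<in>F. \<eta> < \<bar>v i t \<omega>\<bar>) \<and> \<eta> < \<bar>v i s \<omega>\<bar>}"
  using F
proof (induction F rule: finite_linorder_max_induct)
  \<comment> \<open>Times are inserted in increasing order, so \<open>D\<close> below is the event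
    of a first exceedance at \<open>b\<close>. The event on the right retains the exceedance over
    the grid so that the contributions of these disjoint events add up.\<close>
  case (insert b F)
  interpret B: standard_brownian_motion M "v i" by (rule brownian[OF i])
  have b: "0 \<le> b" "b \<le> s" using insert by auto
  let ?X = "\<lambda>F. {\<omega> \<in> space M. \<exists>t\<in>F. \<eta> < \<bar>v i t \<omega>\<bar>}" and ?E = "{\<omega> \<in> space M. \<eta> < \<bar>v i s \<omega>\<bar>}"
  have mp: "v i t \<in> borel_measurable (past b)" if "t \<in> Set.insert b F" for t
    using insert that b by (intro measurable_past i) (auto intro: less_imp_le)
  have X_past: "?X F' \<in> sets (past b)" if "F' \<subseteq> Set.insert b F" for F'
  proof -
    have "finite F'" using insert.hyps(1) that by (auto intro: finite_subset)
    have "{\<omega> \<in> space (past b). \<exists>t\<in>F'. \<eta> < \<bar>v i t \<omega>\<bar>} \<in> sets (past b)"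
      using mp that \<open>finite F'\<close>
      by (intro sets.sets_Collect_finite_Ex borel_measurable_less borel_measurable_const borel_measurable_abs) auto
    then show ?thesis by simp
  qed
  have X: "?X F' \<in> sets M" if "F' \<subseteq> Set.insert b F" for F' using X_past[OF that] sets_past_subset by auto
  have E: "?E \<in> sets M" using b by (intro B.measurable_marginal) auto
  define D where "D = ?X {b} - ?X F"
  \<comment> \<open>The sign of the path at \<open>b\<close> decides which sign of the remaining
    increment keeps it beyond the level.\<close>
  define Dp where "Dp = D \<inter> {\<omega> \<in> space M. \<eta> < v i b \<omega>}"
  define Dm where "Dm = D \<inter> {\<omega> \<in> space M. v i b \<omega> < - \<eta>}"
  have D_past: "D \<in> sets (past b)" unfolding D_def using X_past[of "{b}"] X_past[of F] by (intro sets.Diff) auto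
  have [measurable]: "v i b \<in> borel_measurable (past b)" by (rule mp) simp
  have "{\<omega> \<in> space (past b). \<eta> < v i b \<omega>} \<in> sets (past b)" "{\<omega> \<in> space (past b). v i b \<omega> < - \<eta>} \<in> sets (past b)"
    by measurable
  then have Dpm: "Dp \<in> sets (past b)" "Dm \<in> sets (past b)" using D_past by (auto simp: Dp_def Dm_def)
  then have Dpm_M: "Dp \<in> sets M" "Dm \<in> sets M" using sets_past_subset by auto
  have D_split: "D = Dp \<union> Dm" "Dp \<inter> Dm = {}" using \<eta> by (auto simp: D_def Dp_def Dm_def)
  have half: "prob A \<le> 2 * prob (A \<inter> ?E)"
    if A: "A \<in> sets (past b)" and C: "{x. C x} \<in> sets borel" "1 / 2 \<le> prob {\<omega> \<in> space M. C (v i (s - b) \<omega>)}"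
      and sub: "\<And>\<omega>. \<omega> \<in> A \<Longrightarrow> C (v i s \<omega> - v i b \<omega>) \<Longrightarrow> \<eta> < \<bar>v i s \<omega>\<bar>" for A C
  proof -
    let ?C = "{p \<in> space path_space. C (p (i, s - b))}"
    have "(\<lambda>p. p (i, s - b)) \<in> borel_measurable path_space"
      using i b by (intro measurable_component_singleton) auto
    from measurable_sets[OF this C(1)] have C': "?C \<in> sets path_space"
      by (simp add: vimage_def Int_def conj_commute)
    have A_M: "A \<in> sets M" using A sets_past_subset by auto
    have val: "path_of w (i, s - b) = w i (s - b)" for w using i b by (simp add: path_of_def)
    have "prob A * (1 / 2) \<le> prob A * prob {\<omega> \<in> space M. C (v i (s - b) \<omega>)}"
      using C(2) by (intro mult_left_mono) auto
    also have "\<dots> = prob {\<omega> \<in> A. path_of (shift b (path \<omega>)) \<in> ?C}"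
      using markov_sets[OF b(1) A C'] by (simp add: val emeasure_eq_measure ennreal_mult[symmetric])
    also have "\<dots> \<le> prob (A \<inter> ?E)"
    proof (rule finite_measure_mono)
      show "{\<omega> \<in> A. path_of (shift b (path \<omega>)) \<in> ?C} \<subseteq> A \<inter> ?E"
        using sub sets.sets_into_space[OF A_M] by (auto simp: val shift_def)
    qed (use A_M E in auto)
    finally show ?thesis by simp
  qed
  have "prob Dp \<le> 2 * prob (Dp \<inter> ?E)"
    by (rule half[OF Dpm(1), of "\<lambda>x. 0 \<le> x"])
      (use b \<eta> B.prob_marginal_sign[of "s - b"] in \<open>auto simp: Dp_def\<close>)
  moreover have "prob Dm \<le> 2 * prob (Dm \<inter> ?E)"
    by (rule half[OF Dpm(2), of "\<lambda>x. x \<le> 0"])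
      (use b \<eta> B.prob_marginal_sign[of "s - b"] in \<open>auto simp: Dm_def\<close>)
  moreover have "prob D = prob Dp + prob Dm"
    unfolding D_split(1) using Dpm_M D_split(2) by (intro finite_measure_Union) auto
  moreover have "prob (D \<inter> ?E) = prob (Dp \<inter> ?E) + prob (Dm \<inter> ?E)"
    unfolding D_split(1) Int_Un_distrib2 using Dpm_M E D_split(2) by (intro finite_measure_Union) auto
  ultimately have D_le: "prob D \<le> 2 * prob (D \<inter> ?E)" by simp
  have D_M: "D \<in> sets M" using D_past sets_past_subset by auto
  have un: "?X (Set.insert b F) = ?X F \<union> D" "?X F \<inter> D = {}" by (auto simp: D_def)
  have "prob (?X (Set.insert b F)) = prob (?X F) + prob D"
    unfolding un(1) using X[of F] D_M un(2) by (intro finite_measure_Union) auto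
  also have "\<dots> \<le> 2 * prob (?X F \<inter> ?E) + 2 * prob (D \<inter> ?E)"
    using insert D_le by (auto simp: Int_def conj_commute conj_left_commute)
  also have "\<dots> = 2 * prob (?X (Set.insert b F) \<inter> ?E)"
  proof -
    have "prob ((?X F \<union> D) \<inter> ?E) = prob (?X F \<inter> ?E) + prob (D \<inter> ?E)"
      unfolding Int_Un_distrib2 using X[of F] D_M E un(2) by (intro finite_measure_Union) auto
    then show ?thesis unfolding un(1) by simp
  qed
  also have "?X (Set.insert b F) \<inter> ?E = {\<omega> \<in> space M. (\<exists>t\<in>Set.insert b F. \<eta> < \<bar>v i t \<omega>\<bar>) \<and> \<eta> < \<bar>v i s \<omega>\<bar>}"
    by auto
  finally show ?case .
qed simp

definition survival :: "real \<Rightarrow> real" where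
  "survival u = prob {\<omega> \<in> space M. ennreal u < first_exit \<omega>}"

lemma survival_sets [measurable]: "{\<omega> \<in> space M. ennreal u < first_exit \<omega>} \<in> sets M"
  using measurable_exit_time_path by measurable

lemma survival_bounds: "0 \<le> survival u" "survival u \<le> 1"
  by (auto simp: survival_def)

lemma survival_antimono: "u \<le> u' \<Longrightarrow> survival u' \<le> survival u"
  unfolding survival_def
  by (intro finite_measure_mono) (auto intro: le_less_trans[OF ennreal_leI])

text \<open>A union bound over the agents. Of the factor 4, one 2 comes from Levy's inequality and
  the other from the two-sided Gaussian tail. Since that inequality concerns finite sets of times,
  an exit at level 1 is replaced by exceeding \<open>\<eta> < 1\<close> at some rational
  time.\<close>

lemma survival_lower:
  assumes s: "0 < s" and \<eta>: "0 < \<eta>" "\<eta> < 1"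
  shows "1 - 4 * card I * exp (- \<eta>\<^sup>2 / (2 * s)) \<le> survival s"
proof -
  let ?e = "exp (- \<eta>\<^sup>2 / (2 * s))"
  define F where "F n = (\<lambda>k. real_of_rat (from_nat k)) ` {..<n} \<inter> {0..s}" for n :: nat
  define X where "X i n = {\<omega> \<in> space M. \<exists>t\<in>F n. \<eta> < \<bar>v i t \<omega>\<bar>}" for i n
  have F: "finite (F n)" "F n \<subseteq> {0..s}" "mono F" for n by (auto simp: F_def mono_def)
  have X: "X i n \<in> sets M" if "i \<in> I" for i n
    unfolding X_def using F(1,2)[of n] measurable_process[OF that]
    by (intro sets.sets_Collect_finite_Ex borel_measurable_less borel_measurable_const borel_measurable_abs) auto
  have X_le: "prob (X i n) \<le> 4 * ?e" if i: "i \<in> I" for i n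
  proof -
    interpret B: standard_brownian_motion M "v i" by (rule brownian[OF i])
    have "prob (X i n) \<le> 2 * prob {\<omega> \<in> space M. (\<exists>t\<in>F n. \<eta> < \<bar>v i t \<omega>\<bar>) \<and> \<eta> < \<bar>v i s \<omega>\<bar>}"
      unfolding X_def using \<eta> by (intro levy_inequality i F) simp
    also have "\<dots> \<le> 2 * prob {\<omega> \<in> space M. \<eta> < \<bar>v i s \<omega>\<bar>}"
      using s by (intro mult_left_mono finite_measure_mono B.measurable_marginal) auto
    also have "\<dots> \<le> 2 * (2 * ?e)" using s \<eta> by (intro mult_left_mono B.prob_marginal_upper) auto
    finally show ?thesis by simp
  qed
  have UX_le: "prob (\<Union>n. X i n) \<le> 4 * ?e" if i: "i \<in> I" for i
  proof (rule LIMSEQ_le_const2)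
    show "(\<lambda>n. prob (X i n)) \<longlonglongrightarrow> prob (\<Union>n. X i n)"
      using X[OF i] F(3) by (intro finite_Lim_measure_incseq) (fastforce simp: X_def incseq_def mono_def)+
  qed (use X_le[OF i] in auto)
  have sub: "{\<omega> \<in> space M. \<not> ennreal s < first_exit \<omega>} \<subseteq> (\<Union>i\<in>I. \<Union>n. X i n)"
  proof safe
    fix \<omega> assume \<omega>: "\<omega> \<in> space M" "\<not> ennreal s < first_exit \<omega>"
    then have "\<not> (\<forall>i\<in>I. \<forall>u\<in>{0..s}. \<bar>v i u \<omega>\<bar> < 1)"
      using less_exit_time_iff[OF finite_index paths_process[OF \<omega>(1)], of s] s by simp
    then obtain i u where i: "i \<in> I" and u: "u \<in> {0..s}" "1 \<le> \<bar>v i u \<omega>\<bar>"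
      by (meson not_less)
    have "u \<noteq> 0" using u start_zero_family[OF \<omega>(1) i] by auto
    then have "0 < u" using u by auto
    have "continuous_on {0..} (\<lambda>t. \<bar>v i t \<omega>\<bar>)"
      using continuous_process_path[OF \<omega>(1) i] by (intro continuous_intros)
    moreover have "0 \<le> u" "0 < 1 - \<eta>" using u \<eta> by auto
    ultimately obtain d where d: "0 < d" "\<And>t. 0 \<le> t \<Longrightarrow> \<bar>t - u\<bar> < d \<Longrightarrow> \<bar>\<bar>v i t \<omega>\<bar> - \<bar>v i u \<omega>\<bar>\<bar> < 1 - \<eta>"
      by (rule continuous_on_pathD) auto
    \<comment> \<open>The rational is taken to the left of \<open>u\<close> to stay in
      \<open>{0..s}\<close>; there is room because the path starts at 0 and so \<open>u\<close> is
      positive.\<close>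
    have "max 0 (u - d) < u" using \<open>0 < u\<close> d by auto
    then obtain q where q: "max 0 (u - d) < of_rat q" "of_rat q < u" using of_rat_dense by blast
    have "\<eta> < \<bar>v i (of_rat q) \<omega>\<bar>"
      using d(2)[of "of_rat q"] q u(2) by (auto simp: abs_less_iff)
    moreover have "real_of_rat q \<in> F (Suc (to_nat q))"
      using q u by (auto simp: F_def intro!: image_eqI[of _ _ "to_nat q"])
    ultimately show "\<omega> \<in> (\<Union>i\<in>I. \<Union>n. X i n)"
      using \<omega> i by (auto simp: X_def)
  qed
  have "1 - survival s = prob {\<omega> \<in> space M. \<not> ennreal s < first_exit \<omega>}"
    unfolding survival_def by (rule prob_neg[symmetric]) measurable
  also have "\<dots> \<le> prob (\<Union>i\<in>I. \<Union>n. X i n)"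
    using sub X finite_agents by (intro finite_measure_mono) auto
  also have "\<dots> \<le> (\<Sum>i\<in>I. prob (\<Union>n. X i n))"
    using X finite_agents by (intro finite_measure_subadditive_finite) auto
  also have "\<dots> \<le> (\<Sum>i\<in>I. 4 * ?e)" by (intro sum_mono UX_le)
  finally show ?thesis by (simp add: algebra_simps)
qed

text \<open>Independence gives a product over the agents, and \<open>1 - x \<le> exp (- x)\<close>
  turns it into a single exponential.\<close>

lemma prob_all_small:
  assumes s: "0 < s" and r: "0 \<le> r"
  shows "prob {\<omega> \<in> space M. \<forall>i\<in>I. \<bar>v i s \<omega>\<bar> \<le> r} \<le> exp (- card I * gauss_lower (r / sqrt s))"
proof -
  define E where "E = {p \<in> space (PiM {0..} (\<lambda>_. borel)). \<bar>p s :: real\<bar> \<le> r}"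
  have "(\<lambda>p. p s) \<in> borel_measurable (PiM {0..} (\<lambda>_. borel :: real measure))"
    using s by (intro measurable_component_singleton) auto
  then have E: "E \<in> sets (PiM {0..} (\<lambda>_. borel))" unfolding E_def by measurable
  have path_E: "(\<lambda>t\<in>{0..}. v i t \<omega>) \<in> E \<longleftrightarrow> \<bar>v i s \<omega>\<bar> \<le> r" for i \<omega>
    using s by (auto simp: E_def space_PiM)
  have "prob {\<omega> \<in> space M. \<forall>i\<in>I. \<bar>v i s \<omega>\<bar> \<le> r} = (\<Prod>i\<in>I. prob {\<omega> \<in> space M. \<bar>v i s \<omega>\<bar> \<le> r})"
    using prob_paths[of "\<lambda>_. E"] E by (simp add: path_E)
  also have "\<dots> \<le> (\<Prod>i\<in>I. exp (- gauss_lower (r / sqrt s)))"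
  proof (intro prod_mono conjI)
    fix i assume i: "i \<in> I"
    interpret B: standard_brownian_motion M "v i" by (rule brownian[OF i])
    have "prob {\<omega> \<in> space M. \<not> r < \<bar>v i s \<omega>\<bar>} = 1 - prob {\<omega> \<in> space M. r < \<bar>v i s \<omega>\<bar>}"
      using s by (intro prob_neg B.measurable_marginal) auto
    also have "\<dots> \<le> 1 + - gauss_lower (r / sqrt s)" using B.prob_marginal_lower[OF s r] by simp
    also have "\<dots> \<le> exp (- gauss_lower (r / sqrt s))" by (rule exp_ge_add_one_self)
    finally show "prob {\<omega> \<in> space M. \<bar>v i s \<omega>\<bar> \<le> r} \<le> exp (- gauss_lower (r / sqrt s))"
      by (simp add: not_less)
  qed simp
  also have "\<dots> = exp (- card I * gauss_lower (r / sqrt s))"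
    by (simp add: exp_of_nat_mult[symmetric])
  finally show ?thesis .
qed

lemma survival_upper:
  assumes s: "0 < s"
  shows "survival s \<le> exp (- card I * gauss_lower (1 / sqrt s))"
proof -
  have m: "{\<omega> \<in> space M. \<forall>i\<in>I. \<bar>v i s \<omega>\<bar> \<le> 1} \<in> sets M"
    using measurable_process s finite_agents
    by (intro sets.sets_Collect_finite_All borel_measurable_le borel_measurable_const borel_measurable_abs) auto
  have "survival s \<le> prob {\<omega> \<in> space M. \<forall>i\<in>I. \<bar>v i s \<omega>\<bar> \<le> 1}"
    unfolding survival_def using s
    by (intro finite_measure_mono m) (auto simp: less_exit_time_iff[OF finite_index paths_process] intro: less_imp_le)
  also have "\<dots> \<le> exp (- card I * gauss_lower (1 / sqrt s))" using s by (intro prob_all_small) auto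
  finally show ?thesis .
qed

text \<open>The bound from one observation time does not tend to 0 as that time grows, so it cannot
  give a finite mean. Observing at all integers does: staying within 1 at two consecutive integers
  forces, for every agent, a unit increment of size at most 2 that is independent of the
  past.\<close>

lemma survival_geometric: "survival (real k) \<le> exp (- card I * gauss_lower 2) ^ k"
proof -
  define A where "A k = {\<omega> \<in> space M. \<forall>j\<in>{..k}. \<forall>i\<in>I. \<bar>v i (real j) \<omega>\<bar> \<le> 1}" for k :: nat
  have A_past: "A k \<in> sets (past (real k))" for k
  proof -
    have "{\<omega> \<in> space (past (real k)). \<forall>j\<in>{..k}. \<forall>i\<in>I. \<bar>v i (real j) \<omega>\<bar> \<le> 1} \<in> sets (past (real k))"
      using finite_agents measurable_past[of _ _ "real k"]
      by (intro sets.sets_Collect_finite_All borel_measurable_le borel_measurable_const borel_measurable_abs) auto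
    then show ?thesis by (simp add: A_def)
  qed
  have A_M: "A k \<in> sets M" for k using A_past sets_past_subset by auto
  have "prob (A k) \<le> exp (- card I * gauss_lower 2) ^ k"
  proof (induction k)
    case (Suc k)
    let ?C = "{p \<in> space path_space. \<forall>i\<in>I. \<bar>p (i, 1)\<bar> \<le> 2}"
    have comp: "(\<lambda>p. p (i, 1)) \<in> borel_measurable path_space" if "i \<in> I" for i
      using that by (intro measurable_component_singleton) auto
    have C: "?C \<in> sets path_space"
      using comp finite_agents
      by (intro sets.sets_Collect_finite_All borel_measurable_le borel_measurable_const borel_measurable_abs) auto
    have val: "path_of w \<in> ?C \<longleftrightarrow> (\<forall>i\<in>I. \<bar>w i 1\<bar> \<le> 2)" for w
      using path_of_space[of w] by (auto simp: path_of_def)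
    have Ck: "{\<omega> \<in> A k. path_of (shift (real k) (path \<omega>)) \<in> ?C} \<in> sets M"
    proof -
      have "(\<lambda>\<omega>. path_of (shift (real k) (path \<omega>))) \<in> measurable M path_space"
        using measurable_path_of_shift[of "\<lambda>_. real k"] by simp
      then have "{\<omega> \<in> space M. path_of (shift (real k) (path \<omega>)) \<in> ?C} \<in> sets M" using C by measurable
      then have "A k \<inter> {\<omega> \<in> space M. path_of (shift (real k) (path \<omega>)) \<in> ?C} \<in> sets M" using A_M by auto
      also have "A k \<inter> {\<omega> \<in> space M. path_of (shift (real k) (path \<omega>)) \<in> ?C} =
          {\<omega> \<in> A k. path_of (shift (real k) (path \<omega>)) \<in> ?C}" by (auto simp: A_def)
      finally show ?thesis .
    qed
    have "A (Suc k) \<subseteq> {\<omega> \<in> A k. path_of (shift (real k) (path \<omega>)) \<in> ?C}"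
    proof
      fix \<omega> assume \<omega>: "\<omega> \<in> A (Suc k)"
      have "\<bar>shift (real k) (path \<omega>) i 1\<bar> \<le> 2" if "i \<in> I" for i
      proof -
        have *: "\<bar>v i (real j) \<omega>\<bar> \<le> 1" if "j \<le> Suc k" for j
          using \<omega> that \<open>i \<in> I\<close> unfolding A_def by blast
        show ?thesis using *[of k] *[of "Suc k"] by (simp add: shift_def add.commute)
      qed
      then show "\<omega> \<in> {\<omega> \<in> A k. path_of (shift (real k) (path \<omega>)) \<in> ?C}"
        using \<omega> unfolding val by (auto simp: A_def)
    qed
    then have "prob (A (Suc k)) \<le> prob {\<omega> \<in> A k. path_of (shift (real k) (path \<omega>)) \<in> ?C}"
      by (rule finite_measure_mono[OF _ Ck])
    also have "\<dots> = prob (A k) * prob {\<omega> \<in> space M. \<forall>i\<in>I. \<bar>v i 1 \<omega>\<bar> \<le> 2}"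
      using markov_sets[OF _ A_past C, of k] unfolding val by (simp add: emeasure_eq_measure ennreal_mult[symmetric])
    also have "\<dots> \<le> exp (- card I * gauss_lower 2) ^ k * exp (- card I * gauss_lower 2)"
      using prob_all_small[of 1 2] Suc by (intro mult_mono) auto
    finally show ?case by (simp add: mult.commute)
  qed simp
  moreover have "survival (real k) \<le> prob (A k)"
    unfolding survival_def
  proof (intro finite_measure_mono A_M subsetI, clarify)
    fix \<omega> assume \<omega>: "\<omega> \<in> space M" "ennreal (real k) < first_exit \<omega>"
    then have "\<forall>i\<in>I. \<forall>s\<in>{0..real k}. \<bar>v i s \<omega>\<bar> < 1"
      using less_exit_time_iff[OF finite_index paths_process[OF \<omega>(1)], of "real k"] by simp
    then show "\<omega> \<in> A k" using \<omega>(1) by (auto simp: A_def intro!: less_imp_le)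
  qed
  ultimately show ?thesis by simp
qed

text \<open>Bounds the mean time spent in the first cycle after \<open>s\<close>: the first summand
  is for the times up to 1, the second is the geometric series over unit intervals from 1
  on.\<close>

definition survival_tail :: "real \<Rightarrow> real" where
  "survival_tail s = exp (- card I * gauss_lower (1 / sqrt s)) +
     exp (- card I * gauss_lower 2) / (1 - exp (- card I * gauss_lower 2))"

lemma survival_tail_nonneg: "0 \<le> survival_tail s"
  by (auto simp: survival_tail_def gauss_lower_pos less_imp_le intro!: add_nonneg_nonneg divide_nonneg_nonneg)

lemma measurable_survival [measurable]: "survival \<in> borel_measurable borel"
proof -
  have "mono (\<lambda>u. - survival u)" using survival_antimono by (auto simp: mono_def)
  then have "(\<lambda>u. - survival u) \<in> borel_measurable borel" by (rule borel_measurable_mono)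
  then have "(\<lambda>u. - (- survival u)) \<in> borel_measurable borel" by (rule borel_measurable_uminus)
  then show ?thesis by simp
qed

lemma survival_tail_bound:
  assumes s: "0 < s" "s \<le> 1"
  shows "(\<integral>\<^sup>+u. ennreal (survival u) * indicator {s..} u \<partial>lborel) \<le> ennreal (survival_tail s)"
proof -
  let ?\<rho> = "exp (- card I * gauss_lower 2)" and ?b = "exp (- card I * gauss_lower (1 / sqrt s))"
  have card: "0 < card I" using finite_agents agents_nonempty by (simp add: card_gt_0_iff)
  then have \<rho>: "0 < ?\<rho>" "?\<rho> < 1" using gauss_lower_pos[of 2] by auto
  have "ennreal (survival u) * indicator {s..} u \<le>
      ennreal ?b * indicator {s..<1} u + (\<Sum>k. ennreal (?\<rho> ^ Suc k) * indicator {real (Suc k)..<real (Suc (Suc k))} u)" for u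
  proof -
    consider "u < s" | "s \<le> u" "u < 1" | "1 \<le> u" by linarith
    then show ?thesis
    proof cases
      case 2
      then have "survival u \<le> ?b" using survival_antimono[of s u] survival_upper[OF s(1)] by linarith
      then show ?thesis using 2 by (simp add: add_increasing2 ennreal_leI)
    next
      case 3
      \<comment> \<open>The unit interval containing \<open>u\<close> is the one starting at
        \<open>Suc k\<close>: times below 1 belong to the other summand, so the series begins with
        exponent 1.\<close>
      define k where "k = nat \<lfloor>u\<rfloor> - 1"
      have k: "real (Suc k) \<le> u" "u < real (Suc (Suc k))" using 3 by (auto simp: k_def of_nat_diff; linarith)+
      have "ennreal (survival u) \<le> ennreal (?\<rho> ^ Suc k)"
        using survival_antimono[OF k(1)] survival_geometric[of "Suc k"] by (intro ennreal_leI) linarith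
      also have "\<dots> = (\<Sum>k\<in>{k}. ennreal (?\<rho> ^ Suc k) * indicator {real (Suc k)..<real (Suc (Suc k))} u)"
        using k by (simp del: of_nat_Suc)
      also have "\<dots> \<le> (\<Sum>k. ennreal (?\<rho> ^ Suc k) * indicator {real (Suc k)..<real (Suc (Suc k))} u)"
        by (rule sum_le_suminf) auto
      finally show ?thesis using 3 s by (simp add: add_increasing)
    qed simp
  qed
  then have "(\<integral>\<^sup>+u. ennreal (survival u) * indicator {s..} u \<partial>lborel) \<le>
      (\<integral>\<^sup>+u. ennreal ?b * indicator {s..<1} u +
        (\<Sum>k. ennreal (?\<rho> ^ Suc k) * indicator {real (Suc k)..<real (Suc (Suc k))} u) \<partial>lborel)"
    by (intro nn_integral_mono)
  also have "\<dots> = (\<integral>\<^sup>+u. ennreal ?b * indicator {s..<1} u \<partial>lborel) +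
      (\<integral>\<^sup>+u. (\<Sum>k. ennreal (?\<rho> ^ Suc k) * indicator {real (Suc k)..<real (Suc (Suc k))} u) \<partial>lborel)"
    by (rule nn_integral_add) measurable
  also have "(\<integral>\<^sup>+u. (\<Sum>k. ennreal (?\<rho> ^ Suc k) * indicator {real (Suc k)..<real (Suc (Suc k))} u) \<partial>lborel) =
      (\<Sum>k. \<integral>\<^sup>+u. ennreal (?\<rho> ^ Suc k) * indicator {real (Suc k)..<real (Suc (Suc k))} u \<partial>lborel)"
    by (rule nn_integral_suminf) measurable
  also have "(\<lambda>k. \<integral>\<^sup>+u. ennreal (?\<rho> ^ Suc k) * indicator {real (Suc k)..<real (Suc (Suc k))} u \<partial>lborel) =
      (\<lambda>k. ennreal (?\<rho> ^ Suc k))"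
    by (simp add: nn_integral_cmult_indicator)
  also have "(\<Sum>k. ennreal (?\<rho> ^ Suc k)) = ennreal (?\<rho> / (1 - ?\<rho>))"
  proof (rule suminf_ennreal_eq)
    show "(\<lambda>k. ?\<rho> ^ Suc k) sums (?\<rho> / (1 - ?\<rho>))"
      using sums_mult[OF geometric_sums[of ?\<rho>], of ?\<rho>] \<rho> by simp
  qed simp
  also have "(\<integral>\<^sup>+u. ennreal ?b * indicator {s..<1} u \<partial>lborel) = ennreal ?b * ennreal (1 - s)"
    using s by (simp add: nn_integral_cmult_indicator)
  also have "\<dots> \<le> ennreal ?b * 1" using s by (intro mult_left_mono) (auto simp: ennreal_le_1)
  finally show ?thesis
    using \<rho> unfolding survival_tail_def by (simp add: ennreal_plus add_right_mono)
qed

section \<open>Mean length and mean cost of the first cycle\<close>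

lemma cycle_mean_1_eq:
  "cycle_mean (\<lambda>_. 1) i j = (\<integral>\<^sup>+u. ennreal (survival u) * indicator {0..} u \<partial>lborel)"
  unfolding cycle_mean_def
proof (rule nn_integral_cong)
  fix u :: real
  have "(\<integral>\<^sup>+\<omega>. (if ennreal u < first_exit \<omega> then 1 else 0) \<partial>M) =
      (\<integral>\<^sup>+\<omega>. indicator {\<omega> \<in> space M. ennreal u < first_exit \<omega>} \<omega> \<partial>M)"
    by (intro nn_integral_cong) (simp add: indicator_def)
  also have "\<dots> = ennreal (survival u)" by (simp add: survival_def emeasure_eq_measure)
  finally show "(\<integral>\<^sup>+\<omega>. (if 0 \<le> u \<and> ennreal u < first_exit \<omega> then 1 else 0) \<partial>M) =
      ennreal (survival u) * indicator {0..} u"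
    by (cases "0 \<le> u") simp_all
qed

lemma mean_T_ET_upper:
  assumes s: "0 < s" "s \<le> 1"
  shows "mean_T_ET M I v 1 \<le> ennreal (s + survival_tail s)"
proof -
  obtain i where i: "i \<in> I" using agents_nonempty by blast
  have "mean_T_ET M I v 1 \<le> (\<integral>\<^sup>+u. indicator {0..<s} u + ennreal (survival u) * indicator {s..} u \<partial>lborel)"
    unfolding mean_T_ET_eq[OF i i] cycle_mean_1_eq
    using survival_bounds(2) by (intro nn_integral_mono) (auto simp: indicator_def ennreal_le_1)
  also have "\<dots> = ennreal s + (\<integral>\<^sup>+u. ennreal (survival u) * indicator {s..} u \<partial>lborel)"
    using s by (subst nn_integral_add) auto
  also have "\<dots> \<le> ennreal s + ennreal (survival_tail s)" by (intro add_left_mono survival_tail_bound s)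
  also have "\<dots> = ennreal (s + survival_tail s)"
    using s by (intro ennreal_plus[symmetric] survival_tail_nonneg) auto
  finally show ?thesis .
qed

lemma mean_T_ET_lower:
  assumes s: "0 < s"
  shows "ennreal (s * survival s) \<le> mean_T_ET M I v 1"
proof -
  obtain i where i: "i \<in> I" using agents_nonempty by blast
  have "ennreal (s * survival s) = ennreal (survival s) * emeasure lborel {0..s}"
    using s survival_bounds by (simp add: ennreal_mult mult.commute)
  also have "\<dots> = (\<integral>\<^sup>+u. ennreal (survival s) * indicator {0..s} u \<partial>lborel)"
    by (rule nn_integral_cmult_indicator[symmetric]) simp
  also have "\<dots> \<le> mean_T_ET M I v 1"
    unfolding mean_T_ET_eq[OF i i] cycle_mean_1_eq
    using survival_antimono by (intro nn_integral_mono) (auto simp: indicator_def intro: ennreal_leI)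
  finally show ?thesis .
qed

text \<open>Up to \<open>s\<close> the exit is ignored, and the variance \<open>2 * u\<close>
  integrates to \<open>s\<^sup>2\<close>; after \<open>s\<close> the squared difference is at most 4
  while the cycle lasts, which leaves four times the tail of the mean length.\<close>

lemma cycle_cost_upper:
  assumes ij: "i \<in> I" "j \<in> I" "i \<noteq> j" and s: "0 < s" "s \<le> 1"
  shows "cycle_mean square_rate i j \<le> ennreal (s\<^sup>2 + 4 * survival_tail s)"
proof -
  let ?W = "\<lambda>u. \<integral>\<^sup>+\<omega>. (if 0 \<le> u \<and> ennreal u < first_exit \<omega> then ennreal ((v i u \<omega> - v j u \<omega>)\<^sup>2) else 0) \<partial>M"
  have W1: "?W u \<le> ennreal (2 * u)" if "0 \<le> u" for u
  proof -
    have "?W u \<le> (\<integral>\<^sup>+\<omega>. ennreal ((v i u \<omega> - v i 0 \<omega> - (v j u \<omega> - v j 0 \<omega>))\<^sup>2) \<partial>M)"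
      using start_zero_family ij by (intro nn_integral_mono) auto
    then show ?thesis using second_moment_difference[OF ij, of 0 u] that by simp
  qed
  have W2: "?W u \<le> 4 * ennreal (survival u)" for u
  proof -
    have "?W u \<le> (\<integral>\<^sup>+\<omega>. 4 * indicator {\<omega> \<in> space M. ennreal u < first_exit \<omega>} \<omega> \<partial>M)"
    proof (intro nn_integral_mono)
      fix \<omega> assume \<omega>: "\<omega> \<in> space M"
      have "ennreal ((v i u \<omega> - v j u \<omega>)\<^sup>2) \<le> 4" if "0 \<le> u" "ennreal u < first_exit \<omega>"
      proof -
        have "(v i u \<omega> - v j u \<omega>)\<^sup>2 \<le> 2\<^sup>2"
          using exit_time_difference_less[OF \<omega> ij(1,2) that] by (intro power2_le_iff_abs_le[THEN iffD2]) auto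
        then have "ennreal ((v i u \<omega> - v j u \<omega>)\<^sup>2) \<le> ennreal 4" by (intro ennreal_leI) simp
        then show ?thesis by simp
      qed
      then show "(if 0 \<le> u \<and> ennreal u < first_exit \<omega> then ennreal ((v i u \<omega> - v j u \<omega>)\<^sup>2) else 0) \<le>
          4 * indicator {\<omega> \<in> space M. ennreal u < first_exit \<omega>} \<omega>"
        using \<omega> by auto
    qed
    also have "\<dots> = 4 * ennreal (survival u)"
      by (simp add: nn_integral_cmult_indicator survival_def emeasure_eq_measure)
    finally show ?thesis .
  qed
  have "cycle_mean square_rate i j \<le>
      (\<integral>\<^sup>+u. ennreal (2 * u) * indicator {0..s} u + 4 * (ennreal (survival u) * indicator {s..} u) \<partial>lborel)"
    unfolding cycle_mean_def
  proof (intro nn_integral_mono)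
    fix u :: real
    consider "u < 0" | "0 \<le> u" "u \<le> s" | "s < u" by linarith
    then have "?W u \<le> ennreal (2 * u) * indicator {0..s} u + 4 * (ennreal (survival u) * indicator {s..} u)"
    proof cases
      case 2
      then show ?thesis using W1[of u] by (simp add: add_increasing2)
    next
      case 3
      then show ?thesis using W2[of u] by simp
    qed simp
    then show "(\<integral>\<^sup>+\<omega>. (if 0 \<le> u \<and> ennreal u < first_exit \<omega> then square_rate (u, v i u \<omega> - v j u \<omega>) else 0) \<partial>M) \<le>
        ennreal (2 * u) * indicator {0..s} u + 4 * (ennreal (survival u) * indicator {s..} u)"
      by (simp cong: if_cong)
  qed
  also have "\<dots> = (\<integral>\<^sup>+u. ennreal (2 * u) * indicator {0..s} u \<partial>lborel) +
      (\<integral>\<^sup>+u. 4 * (ennreal (survival u) * indicator {s..} u) \<partial>lborel)"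
    by (rule nn_integral_add) measurable
  also have "(\<integral>\<^sup>+u. 4 * (ennreal (survival u) * indicator {s..} u) \<partial>lborel) =
      4 * (\<integral>\<^sup>+u. ennreal (survival u) * indicator {s..} u \<partial>lborel)"
    by (rule nn_integral_cmult) measurable
  also have "(\<integral>\<^sup>+u. ennreal (2 * u) * indicator {0..s} u \<partial>lborel) = ennreal (s\<^sup>2 - 0\<^sup>2)"
    using s by (intro nn_integral_FTC_Icc) (auto intro!: derivative_eq_intros)
  also have "ennreal (s\<^sup>2 - 0\<^sup>2) + 4 * (\<integral>\<^sup>+u. ennreal (survival u) * indicator {s..} u \<partial>lborel) \<le>
      ennreal (s\<^sup>2) + ennreal 4 * ennreal (survival_tail s)"
    using survival_tail_bound[OF s] by (intro add_mono mult_mono) auto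
  also have "\<dots> = ennreal (s\<^sup>2 + 4 * survival_tail s)"
  proof -
    have "ennreal 4 * ennreal (survival_tail s) = ennreal (4 * survival_tail s)"
      "ennreal (s\<^sup>2) + ennreal (4 * survival_tail s) = ennreal (s\<^sup>2 + 4 * survival_tail s)"
      using survival_tail_nonneg[of s]
      by (auto intro!: ennreal_mult[symmetric] ennreal_plus[symmetric] simp del: ennreal_numeral)
    then show ?thesis by simp
  qed
  finally show ?thesis .
qed

text \<open>Follows from \<open>(x - y) ^ 4 \<le> 8 * x ^ 4 + 8 * y ^ 4\<close> and the Gaussian
  fourth moment \<open>3 * u\<^sup>2\<close>; the constant is \<open>2 * 8 * 3\<close>. Its size is
  harmless because it is divided by a large \<open>K\<close> later.\<close>

lemma fourth_moment_difference:
  assumes ij: "i \<in> I" "j \<in> I" and u: "0 < u"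
  shows "(\<integral>\<^sup>+\<omega>. ennreal ((v i u \<omega> - v j u \<omega>) ^ 4) \<partial>M) \<le> ennreal (48 * u\<^sup>2)"
proof -
  have fourth: "(x - y) ^ 4 \<le> 8 * x ^ 4 + 8 * y ^ 4" for x y :: real
  proof -
    have "(x - y)\<^sup>2 \<le> 2 * (x\<^sup>2 + y\<^sup>2)" using zero_le_power2[of "x + y"] by (simp add: power2_eq_square algebra_simps)
    then have "((x - y)\<^sup>2)\<^sup>2 \<le> (2 * (x\<^sup>2 + y\<^sup>2))\<^sup>2" by (intro power_mono) auto
    also have "\<dots> \<le> 8 * (x\<^sup>2)\<^sup>2 + 8 * (y\<^sup>2)\<^sup>2"
      using zero_le_power2[of "x\<^sup>2 - y\<^sup>2"] by (simp add: power2_eq_square algebra_simps)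
    finally show ?thesis by (simp add: power_mult[symmetric])
  qed
  have m: "(\<integral>\<^sup>+\<omega>. ennreal (v l u \<omega> ^ 4) \<partial>M) = ennreal (3 * u\<^sup>2)" if l: "l \<in> I" for l
  proof -
    interpret B: standard_brownian_motion M "v l" by (rule brownian[OF l])
    have "(\<integral>\<^sup>+\<omega>. ennreal (v l u \<omega> ^ 4) \<partial>M) = (\<integral>\<^sup>+\<omega>. ennreal ((v l u \<omega> - v l 0 \<omega>) ^ 4) \<partial>M)"
      by (intro nn_integral_cong) (simp add: B.start_zero)
    also have "\<dots> = ennreal (3 * u\<^sup>2)"
      using B.increment_moments(1)[of 0 u 4] B.increment_moments(4)[of 0 u] u
      by (subst nn_integral_eq_integral) auto
    finally show ?thesis .
  qed
  have [measurable]: "v i u \<in> borel_measurable M" "v j u \<in> borel_measurable M"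
    using u ij by (auto intro!: measurable_process)
  have "(\<integral>\<^sup>+\<omega>. ennreal ((v i u \<omega> - v j u \<omega>) ^ 4) \<partial>M) \<le> (\<integral>\<^sup>+\<omega>. ennreal 8 * ennreal (v i u \<omega> ^ 4) + ennreal 8 * ennreal (v j u \<omega> ^ 4) \<partial>M)"
  proof (intro nn_integral_mono)
    fix \<omega>
    have "ennreal ((v i u \<omega> - v j u \<omega>) ^ 4) \<le> ennreal (8 * v i u \<omega> ^ 4 + 8 * v j u \<omega> ^ 4)"
      by (intro ennreal_leI fourth)
    also have "\<dots> = ennreal 8 * ennreal (v i u \<omega> ^ 4) + ennreal 8 * ennreal (v j u \<omega> ^ 4)"
      by (subst ennreal_plus) (auto simp del: ennreal_numeral simp: ennreal_mult)
    finally show "ennreal ((v i u \<omega> - v j u \<omega>) ^ 4) \<le> \<dots>" .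
  qed
  also have "\<dots> = ennreal 8 * ennreal (3 * u\<^sup>2) + ennreal 8 * ennreal (3 * u\<^sup>2)"
    using m[OF ij(1)] m[OF ij(2)] by (simp add: nn_integral_add nn_integral_cmult)
  also have "\<dots> = ennreal (48 * u\<^sup>2)"
    by (subst (1 2) ennreal_mult[symmetric], simp_all add: ennreal_plus[symmetric] del: ennreal_plus)
  finally show ?thesis .
qed

text \<open>The early-exit part of the second moment is controlled by \<open>d\<^sup>2 \<le> K * u + d^4 / (K * u)\<close>.\<close>

lemma cycle_cost_lower:
  assumes ij: "i \<in> I" "j \<in> I" "i \<noteq> j" and s: "0 < s" and K: "0 < K"
  shows "ennreal (s\<^sup>2 / 2 * (2 - (K * (1 - survival s) + 48 / K))) \<le> cycle_mean square_rate i j"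
proof -
  let ?W = "\<lambda>u. \<integral>\<^sup>+\<omega>. (if 0 \<le> u \<and> ennreal u < first_exit \<omega> then ennreal ((v i u \<omega> - v j u \<omega>)\<^sup>2) else 0) \<partial>M"
  let ?A = "{\<omega> \<in> space M. \<not> ennreal s < first_exit \<omega>}"
  let ?q = "K * (1 - survival s) + 48 / K"
  have q: "0 \<le> ?q" using K survival_bounds[of s] by (auto intro!: add_nonneg_nonneg)
  have A [measurable]: "?A \<in> sets M" using measurable_exit_time_path by measurable
  have A_eq: "emeasure M ?A = ennreal (1 - survival s)"
    unfolding survival_def using prob_neg[OF survival_sets[of s]] by (simp add: emeasure_eq_measure)
  \<comment> \<open>The exact second moment is \<open>2 * u\<close>. Outcomes with an early exit
    contribute at most \<open>u * ?q\<close> to it; an exit by time \<open>u\<close> is also one by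
    time \<open>s\<close>, so the single event \<open>?A\<close> serves all
    \<open>u\<close>.\<close>
  have W: "ennreal (u * (2 - ?q)) \<le> ?W u" if u: "0 < u" "u \<le> s" for u
  proof -
    have [measurable]: "v i u \<in> borel_measurable M" "v j u \<in> borel_measurable M"
      using u ij by (auto intro!: measurable_process)
    note [measurable] = measurable_exit_time_path
    let ?d = "\<lambda>\<omega>. v i u \<omega> - v j u \<omega>"
    have "ennreal (2 * u) = (\<integral>\<^sup>+\<omega>. ennreal ((?d \<omega>)\<^sup>2) \<partial>M)"
    proof -
      have "(\<integral>\<^sup>+\<omega>. ennreal ((?d \<omega>)\<^sup>2) \<partial>M) = (\<integral>\<^sup>+\<omega>. ennreal ((v i u \<omega> - v i 0 \<omega> - (v j u \<omega> - v j 0 \<omega>))\<^sup>2) \<partial>M)"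
        using start_zero_family ij by (intro nn_integral_cong) auto
      then show ?thesis using second_moment_difference[OF ij, of 0 u] u by simp
    qed
    also have "\<dots> \<le> (\<integral>\<^sup>+\<omega>. (if 0 \<le> u \<and> ennreal u < first_exit \<omega> then ennreal ((?d \<omega>)\<^sup>2) else 0) +
        (ennreal (K * u) * indicator ?A \<omega> + ennreal (1 / (K * u)) * ennreal (?d \<omega> ^ 4)) \<partial>M)"
    proof (intro nn_integral_mono)
      fix \<omega> assume \<omega>: "\<omega> \<in> space M"
      show "ennreal ((?d \<omega>)\<^sup>2) \<le> (if 0 \<le> u \<and> ennreal u < first_exit \<omega> then ennreal ((?d \<omega>)\<^sup>2) else 0) +
        (ennreal (K * u) * indicator ?A \<omega> + ennreal (1 / (K * u)) * ennreal (?d \<omega> ^ 4))"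
      proof (cases "ennreal u < first_exit \<omega>")
        case True
        then show ?thesis using u by (simp add: add_increasing2)
      next
        case False
        have "ennreal u \<le> ennreal s" using u by (intro ennreal_leI)
        then have "\<omega> \<in> ?A" using False \<omega> by (auto simp: not_less)
        have "(?d \<omega>)\<^sup>2 \<le> K * u + 1 / (K * u) * ?d \<omega> ^ 4"
        proof (cases "(?d \<omega>)\<^sup>2 \<le> K * u")
          case True
          then show ?thesis using K u by (simp add: add_increasing2)
        next
          case False
          then have "(?d \<omega>)\<^sup>2 * (K * u) \<le> (?d \<omega>)\<^sup>2 * (?d \<omega>)\<^sup>2" by (intro mult_left_mono) auto
          then have "(?d \<omega>)\<^sup>2 \<le> ((?d \<omega>)\<^sup>2 * (?d \<omega>)\<^sup>2) / (K * u)"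
            using K u by (subst pos_le_divide_eq) auto
          then have "(?d \<omega>)\<^sup>2 \<le> 1 / (K * u) * ?d \<omega> ^ 4" by (simp flip: power_add)
          then show ?thesis using K u by (simp add: add_increasing)
        qed
        then have "ennreal ((?d \<omega>)\<^sup>2) \<le> ennreal (K * u + 1 / (K * u) * ?d \<omega> ^ 4)" by (rule ennreal_leI)
        also have "\<dots> = ennreal (K * u) + ennreal (1 / (K * u)) * ennreal (?d \<omega> ^ 4)"
        proof -
          have "ennreal (1 / (K * u) * ?d \<omega> ^ 4) = ennreal (1 / (K * u)) * ennreal (?d \<omega> ^ 4)"
            using K u by (intro ennreal_mult) auto
          moreover have "ennreal (K * u + 1 / (K * u) * ?d \<omega> ^ 4) = ennreal (K * u) + ennreal (1 / (K * u) * ?d \<omega> ^ 4)"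
            using K u by (intro ennreal_plus) auto
          ultimately show ?thesis by simp
        qed
        finally show ?thesis using \<open>\<omega> \<in> ?A\<close> by (simp add: add_increasing)
      qed
    qed
    also have "\<dots> = ?W u + (\<integral>\<^sup>+\<omega>. (ennreal (K * u) * indicator ?A \<omega> + ennreal (1 / (K * u)) * ennreal (?d \<omega> ^ 4)) \<partial>M)"
      by (rule nn_integral_add) measurable
    also have "(\<integral>\<^sup>+\<omega>. (ennreal (K * u) * indicator ?A \<omega> + ennreal (1 / (K * u)) * ennreal (?d \<omega> ^ 4)) \<partial>M) =
        (\<integral>\<^sup>+\<omega>. ennreal (K * u) * indicator ?A \<omega> \<partial>M) + (\<integral>\<^sup>+\<omega>. ennreal (1 / (K * u)) * ennreal (?d \<omega> ^ 4) \<partial>M)"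
      by (rule nn_integral_add) measurable
    also have "(\<integral>\<^sup>+\<omega>. ennreal (K * u) * indicator ?A \<omega> \<partial>M) = ennreal (K * u) * ennreal (1 - survival s)"
      by (simp only: nn_integral_cmult_indicator[OF A] A_eq)
    also have "(\<integral>\<^sup>+\<omega>. ennreal (1 / (K * u)) * ennreal (?d \<omega> ^ 4) \<partial>M) = ennreal (1 / (K * u)) * (\<integral>\<^sup>+\<omega>. ennreal (?d \<omega> ^ 4) \<partial>M)"
      by (rule nn_integral_cmult) measurable
    also have "ennreal (1 / (K * u)) * (\<integral>\<^sup>+\<omega>. ennreal (?d \<omega> ^ 4) \<partial>M) \<le> ennreal (1 / (K * u)) * ennreal (48 * u\<^sup>2)"
      by (intro mult_left_mono fourth_moment_difference ij u) simp
    also have "ennreal (K * u) * ennreal (1 - survival s) + ennreal (1 / (K * u)) * ennreal (48 * u\<^sup>2) = ennreal (u * ?q)"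
    proof -
      have "ennreal (K * u) * ennreal (1 - survival s) = ennreal (K * u * (1 - survival s))"
        using K u survival_bounds[of s] by (intro ennreal_mult[symmetric]) auto
      moreover have "ennreal (1 / (K * u)) * ennreal (48 * u\<^sup>2) = ennreal (1 / (K * u) * (48 * u\<^sup>2))"
        using K u by (intro ennreal_mult[symmetric]) auto
      moreover have "1 / (K * u) * (48 * u\<^sup>2) = u * (48 / K)" using K u by (simp add: power2_eq_square)
      moreover have "ennreal (K * u * (1 - survival s)) + ennreal (u * (48 / K)) = ennreal (K * u * (1 - survival s) + u * (48 / K))"
        using K u survival_bounds[of s] by (intro ennreal_plus[symmetric]) auto
      moreover have "K * u * (1 - survival s) + u * (48 / K) = u * ?q" by (simp add: algebra_simps)
      ultimately show ?thesis by simp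
    qed
    finally have "ennreal (2 * u) \<le> ennreal (u * ?q) + ?W u" by (simp add: add.commute add_left_mono)
    then have "ennreal (2 * u) - ennreal (u * ?q) \<le> ?W u" by (simp add: ennreal_minus_le_iff)
    moreover have "ennreal (2 * u) - ennreal (u * ?q) = ennreal (2 * u - u * ?q)"
      using u q by (intro ennreal_minus mult_nonneg_nonneg) auto
    moreover have "2 * u - u * ?q = u * (2 - ?q)" by (simp only: right_diff_distrib mult.commute)
    ultimately show ?thesis by simp
  qed
  show ?thesis
  proof (cases "2 - ?q \<le> 0")
    case True
    then have "s\<^sup>2 / 2 * (2 - ?q) \<le> 0" by (intro mult_nonneg_nonpos) auto
    then show ?thesis by (simp add: ennreal_neg)
  next
    case False
    have "ennreal (s\<^sup>2 / 2 * (2 - ?q)) = ennreal (s\<^sup>2 / 2 * (2 - ?q) - 0\<^sup>2 / 2 * (2 - ?q))" by simp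
    also have "\<dots> = (\<integral>\<^sup>+u. ennreal (u * (2 - ?q)) * indicator {0..s} u \<partial>lborel)"
      using s False by (intro nn_integral_FTC_Icc[symmetric])
        (auto intro!: derivative_eq_intros mult_nonneg_nonneg)
    also have "\<dots> \<le> (\<integral>\<^sup>+u. ?W u \<partial>lborel)"
    proof (intro nn_integral_mono)
      fix u
      show "ennreal (u * (2 - ?q)) * indicator {0..s} u \<le> ?W u"
      proof (cases "u \<in> {0<..s}")
        case True
        then show ?thesis using W[of u] by simp
      next
        case False
        then have "ennreal (u * (2 - ?q)) * indicator {0..s} u = 0" by (cases "u = 0") auto
        then show ?thesis by (simp only: zero_le)
      qed
    qed
    finally show ?thesis by (simp add: cycle_mean_def cong: if_cong)
  qed
qed

end

section \<open>Asymptotics\<close>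

text \<open>At \<open>s = (1 + \<epsilon>) h\<close> the exponent
  \<open>real N * gauss_lower (1 / sqrt s)\<close> is, up to constants, \<open>N\<close> to the
  power \<open>1 - 1 / (1 + \<epsilon>)\<close> times \<open>exp (- b * sqrt (ln N))\<close>; the
  last factor stems from evaluating the density at \<open>x + 1\<close>. The survival probability is
  thus the exponential of minus almost a power of \<open>N\<close>, far below the square of
  \<open>1 / ln N\<close>.\<close>

lemma eventually_tail_small:
  assumes \<epsilon>: "0 < \<epsilon>"
  shows "\<forall>\<^sub>F N :: nat in sequentially. let h = 1 / (2 * ln (real N)); s = (1 + \<epsilon>) * h in
    exp (- real N * gauss_lower (1 / sqrt s)) +
      exp (- real N * gauss_lower 2) / (1 - exp (- real N * gauss_lower 2)) \<le> \<epsilon> * h\<^sup>2"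
proof -
  define a where "a = 1 / (1 + \<epsilon>)"
  define c where "c = gauss_lower 2"
  have a: "0 < a" "a < 1" using \<epsilon> by (auto simp: a_def)
  have c: "0 < c" unfolding c_def by (rule gauss_lower_pos)
  define b where "b = sqrt (2 * a)"
  define p where "p = sqrt (2 * pi)"
  define d where "d = 1 - a"
  have bpd: "0 < b" "0 < p" "0 < d" using a by (auto simp: b_def p_def d_def)
  \<comment> \<open>Here \<open>x\<close> stands for \<open>ln N\<close>. The two summands of the
    tail get \<open>\<epsilon> / 2\<close> each.\<close>
  have "\<forall>\<^sub>F x :: real in at_top. exp (- (exp (d * x - b * sqrt x - 1 / 2) / p)) \<le> \<epsilon> / 2 * (1 / (2 * x))\<^sup>2"
    using bpd \<epsilon> by real_asymp
  moreover have "filterlim (\<lambda>N :: nat. ln (real N)) at_top sequentially" by real_asymp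
  ultimately have "\<forall>\<^sub>F N :: nat in sequentially. exp (- (exp (d * ln (real N) - b * sqrt (ln (real N)) - 1 / 2) / p)) \<le>
      \<epsilon> / 2 * (1 / (2 * ln (real N)))\<^sup>2"
    by (rule eventually_compose_filterlim)
  moreover have "\<forall>\<^sub>F N :: nat in sequentially. exp (- real N * c) / (1 - exp (- real N * c)) \<le> \<epsilon> / 2 * (1 / (2 * ln (real N)))\<^sup>2"
    using c \<epsilon> by real_asymp
  ultimately show ?thesis using eventually_gt_at_top[of 1]
  proof eventually_elim
    case (elim N)
    have "0 < ln (real N)" using elim by simp
    then have eq1: "1 / sqrt ((1 + \<epsilon>) * (1 / (2 * ln (real N)))) = sqrt (2 * a * ln (real N))"
      using \<epsilon> by (simp add: a_def real_sqrt_divide real_sqrt_mult)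
    have eq2: "- real N * gauss_lower (sqrt (2 * a * ln (real N))) =
        - (exp (d * ln (real N) - b * sqrt (ln (real N)) - 1 / 2) / p)"
    proof -
      have "(sqrt (2 * a * ln (real N)) + 1)\<^sup>2 / 2 = a * ln (real N) + b * sqrt (ln (real N)) + 1 / 2"
        using a \<open>0 < ln (real N)\<close>
        by (simp add: power2_sum real_sqrt_mult b_def power_mult_distrib algebra_simps)
      then have "d * ln (real N) - b * sqrt (ln (real N)) - 1 / 2 =
          ln (real N) + - (sqrt (2 * a * ln (real N)) + 1)\<^sup>2 / 2"
        by (simp only: minus_divide_left[symmetric] d_def) (simp add: algebra_simps)
      then have "exp (d * ln (real N) - b * sqrt (ln (real N)) - 1 / 2) =
          real N * exp (- (sqrt (2 * a * ln (real N)) + 1)\<^sup>2 / 2)"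
        using elim by (simp only: exp_add exp_ln)
      then show ?thesis by (simp add: gauss_lower_def p_def)
    qed
    have "exp (- (exp (d * ln (real N) - b * sqrt (ln (real N)) - 1 / 2) / p)) +
        exp (- real N * c) / (1 - exp (- real N * c)) \<le>
        \<epsilon> / 2 * (1 / (2 * ln (real N)))\<^sup>2 + \<epsilon> / 2 * (1 / (2 * ln (real N)))\<^sup>2"
      by (rule add_mono[OF elim(1,2)])
    also have "\<dots> = \<epsilon> * (1 / (2 * ln (real N)))\<^sup>2" by simp
    finally show ?case unfolding Let_def eq1 eq2 c_def .
  qed
qed

context brownian_family
begin

text \<open>The times \<open>s\<close> and \<open>s'\<close> frame the exit time: after
  \<open>s\<close> hardly anything remains of the cycle, and before \<open>s'\<close> an exit is
  improbable. The bounds have the same relative error for every edge, so the number of edges enters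
  only as a factor of \<open>g\<close>.\<close>

lemma cost_window:
  fixes \<epsilon> h :: real
  assumes G: "pair_graph G" "pverts G = I" and \<epsilon>: "0 < \<epsilon>" "\<epsilon> < 1 / 31"
    and h: "0 < h" "h \<le> 1 / 2" and tail: "survival_tail ((1 + \<epsilon>) * h) \<le> \<epsilon> * h\<^sup>2"
    and early: "4 * real (card I) * exp (- (1 + \<epsilon>) / (2 * h)) \<le> \<epsilon>\<^sup>2"
  defines "g \<equiv> card (parcs G) * h / 2"
  shows "\<bar>enn2real (J_TT M G v c (enn2real (mean_T_ET M I v 1))) - g\<bar> \<le> 40 * \<epsilon> * g"
    and "\<bar>enn2real (J_ET M G v c' 1) - g\<bar> \<le> 40 * \<epsilon> * g"
proof -
  define s where "s = (1 + \<epsilon>) * h"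
  \<comment> \<open>Chosen such that for the level \<open>1 - \<epsilon>\<close> the Gaussian
    exponent is exactly \<open>- (1 + \<epsilon>) / (2 * h)\<close>. For
    \<open>h = 1 / (2 ln N)\<close> its exponential is \<open>N\<close> to the power
    \<open>- (1 + \<epsilon>)\<close>, which beats the union bound over \<open>N\<close>
    agents.\<close>
  define s' where "s' = (1 - \<epsilon>)\<^sup>2 / (1 + \<epsilon>) * h"
  have s: "0 < s" "s \<le> 1"
  proof -
    show "0 < s" using \<epsilon> h by (simp add: s_def)
    have "s \<le> 2 * (1 / 2)" unfolding s_def using \<epsilon> h by (intro mult_mono) auto
    then show "s \<le> 1" by simp
  qed
  have s': "0 < s'" using \<epsilon> h by (simp add: s'_def)
  have s'_ge: "(1 - 3 * \<epsilon>) * h \<le> s'"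
  proof -
    have "(1 - 3 * \<epsilon>) * (1 + \<epsilon>) \<le> (1 - \<epsilon>)\<^sup>2" by (simp add: power2_eq_square algebra_simps)
    then have "1 - 3 * \<epsilon> \<le> (1 - \<epsilon>)\<^sup>2 / (1 + \<epsilon>)" using \<epsilon> by (simp add: pos_le_divide_eq)
    then show ?thesis unfolding s'_def using h by (intro mult_right_mono) auto
  qed
  have surv: "1 - \<epsilon>\<^sup>2 \<le> survival s'"
  proof -
    have "- (1 - \<epsilon>)\<^sup>2 / (2 * s') = - (1 + \<epsilon>) / (2 * h)"
      using \<epsilon> h by (simp add: s'_def field_simps)
    then show ?thesis
      using survival_lower[OF s', of "1 - \<epsilon>"] early \<epsilon> by simp
  qed
  have mean_le: "mean_T_ET M I v 1 \<le> ennreal (s + survival_tail s)" by (rule mean_T_ET_upper[OF s])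
  then have fin: "mean_T_ET M I v 1 < \<infinity>" using le_less_trans[OF _ ennreal_less_top] by auto
  define m where "m = enn2real (mean_T_ET M I v 1)"
  have m: "mean_T_ET M I v 1 = ennreal m" "0 \<le> m" using fin by (auto simp: m_def)
  have h2: "h\<^sup>2 \<le> h"
  proof -
    have "h * h \<le> 1 * h" using h by (intro mult_right_mono) auto
    then show ?thesis by (simp add: power2_eq_square)
  qed
  have m_up: "m \<le> (1 + 2 * \<epsilon>) * h"
  proof -
    have "m \<le> s + survival_tail s"
      using mean_le s survival_tail_nonneg[of s] unfolding m(1) by (subst (asm) ennreal_le_iff) auto
    also have "\<dots> \<le> (1 + \<epsilon>) * h + \<epsilon> * h"
    proof -
      have "\<epsilon> * h\<^sup>2 \<le> \<epsilon> * h" using \<epsilon> by (intro mult_left_mono h2) auto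
      then show ?thesis using tail unfolding s_def by linarith
    qed
    finally show ?thesis by (simp add: algebra_simps)
  qed
  have m_low: "(1 - 4 * \<epsilon>) * h \<le> m"
  proof -
    have "s' * survival s' \<le> m"
      using mean_T_ET_lower[OF s'] m unfolding m(1) by (subst (asm) ennreal_le_iff) auto
    moreover have "((1 - 3 * \<epsilon>) * h) * (1 - \<epsilon>\<^sup>2) \<le> s' * survival s'"
      using s'_ge surv s' \<epsilon> h by (intro mult_mono) (auto simp: abs_square_le_1 power_le_one)
    moreover have "(1 - 4 * \<epsilon>) * h \<le> ((1 - 3 * \<epsilon>) * h) * (1 - \<epsilon>\<^sup>2)"
    proof -
      have "\<epsilon> * \<epsilon> \<le> \<epsilon> * 1" using \<epsilon> by (intro mult_left_mono) auto
      moreover have "0 \<le> \<epsilon> * \<epsilon> * \<epsilon>" using \<epsilon> by simp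
      ultimately have "1 - 4 * \<epsilon> \<le> (1 - 3 * \<epsilon>) * (1 - \<epsilon>\<^sup>2)"
        unfolding power2_eq_square by (simp add: algebra_simps)
      then have "(1 - 4 * \<epsilon>) * h \<le> (1 - 3 * \<epsilon>) * (1 - \<epsilon>\<^sup>2) * h" using h by (intro mult_right_mono) auto
      then show ?thesis by (simp add: mult.assoc mult.left_commute mult.commute)
    qed
    ultimately show ?thesis by linarith
  qed
  have m_pos: "0 < m"
  proof -
    have "0 < (1 - 4 * \<epsilon>) * h" using \<epsilon> h by (intro mult_pos_pos) auto
    then show ?thesis using m_low by linarith
  qed
  let ?n = "real (card (parcs G))"
  have g: "0 \<le> g" using h by (simp add: g_def)
  show "\<bar>enn2real (J_TT M G v c (enn2real (mean_T_ET M I v 1))) - g\<bar> \<le> 40 * \<epsilon> * g"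
  proof -
    have "enn2real (J_TT M G v c (enn2real (mean_T_ET M I v 1))) = ?n * m / 2"
      using J_TT_eq[OF G m_pos, of c] m_pos by (simp add: m(1))
    then have "enn2real (J_TT M G v c (enn2real (mean_T_ET M I v 1))) - g = ?n / 2 * (m - h)"
      by (simp add: g_def algebra_simps)
    moreover have "\<bar>m - h\<bar> \<le> 40 * \<epsilon> * h"
    proof -
      have "0 \<le> \<epsilon> * h" using \<epsilon> h by simp
      then show ?thesis using m_up m_low by (simp add: algebra_simps abs_le_iff)
    qed
    then have "?n / 2 * \<bar>m - h\<bar> \<le> ?n / 2 * (40 * \<epsilon> * h)" by (intro mult_left_mono) auto
    moreover have "?n / 2 * (40 * \<epsilon> * h) = 40 * \<epsilon> * g" by (simp add: g_def)
    ultimately show ?thesis by (simp only: abs_mult)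
  qed
  show "\<bar>enn2real (J_ET M G v c' 1) - g\<bar> \<le> 40 * \<epsilon> * g"
  proof -
    define \<kappa> where "\<kappa> e = enn2real (cycle_mean square_rate (fst e) (snd e))" for e
    have \<kappa>: "cycle_mean square_rate (fst e) (snd e) = ennreal (\<kappa> e)" "0 \<le> \<kappa> e"
      "(1 - 31 * \<epsilon>) * h\<^sup>2 \<le> \<kappa> e" "\<kappa> e \<le> (1 + 7 * \<epsilon>) * h\<^sup>2" if "e \<in> parcs G" for e
    proof -
      have ij: "fst e \<in> I" "snd e \<in> I" "fst e \<noteq> snd e" using edge_agents[OF G, of "fst e" "snd e"] that by auto
      have up: "cycle_mean square_rate (fst e) (snd e) \<le> ennreal (s\<^sup>2 + 4 * survival_tail s)"
        by (rule cycle_cost_upper[OF ij s])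
      then have "cycle_mean square_rate (fst e) (snd e) < \<infinity>"
        using le_less_trans[OF _ ennreal_less_top] by auto
      then show k: "cycle_mean square_rate (fst e) (snd e) = ennreal (\<kappa> e)" "0 \<le> \<kappa> e"
        by (auto simp: \<kappa>_def)
      have "\<kappa> e \<le> s\<^sup>2 + 4 * survival_tail s"
        using up k survival_tail_nonneg[of s] unfolding k(1) by (subst (asm) ennreal_le_iff) auto
      also have "\<dots> \<le> (1 + \<epsilon>)\<^sup>2 * h\<^sup>2 + 4 * (\<epsilon> * h\<^sup>2)"
        using tail by (simp add: s_def power_mult_distrib)
      also have "\<dots> = (1 + 6 * \<epsilon> + \<epsilon> * \<epsilon>) * h\<^sup>2" by (simp add: power2_eq_square algebra_simps)
      also have "\<dots> \<le> (1 + 7 * \<epsilon>) * h\<^sup>2"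
      proof (intro mult_right_mono)
        have "\<epsilon> * \<epsilon> \<le> 1 * \<epsilon>" using \<epsilon> by (intro mult_right_mono) auto
        then show "1 + 6 * \<epsilon> + \<epsilon> * \<epsilon> \<le> 1 + 7 * \<epsilon>" by simp
      qed simp
      finally show "\<kappa> e \<le> (1 + 7 * \<epsilon>) * h\<^sup>2" .
      \<comment> \<open>The choice \<open>K = 1 / \<epsilon>\<close> makes both losses linear in
        \<open>\<epsilon>\<close>: the probability of an exit by \<open>s'\<close> is at most
        \<open>\<epsilon>\<^sup>2\<close>, which contributes \<open>\<epsilon>\<close>, and the
        fourth moment contributes \<open>48 * \<epsilon>\<close>.\<close>
      let ?q = "1 / \<epsilon> * (1 - survival s') + 48 / (1 / \<epsilon>)"
      have "s'\<^sup>2 / 2 * (2 - ?q) \<le> \<kappa> e"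
        using cycle_cost_lower[OF ij s', of "1 / \<epsilon>"] \<epsilon> k by (auto simp: ennreal_le_iff2)
      moreover have "((1 - 3 * \<epsilon>) * h)\<^sup>2 / 2 * (2 - 49 * \<epsilon>) \<le> s'\<^sup>2 / 2 * (2 - ?q)"
      proof (intro mult_mono)
        show "((1 - 3 * \<epsilon>) * h)\<^sup>2 / 2 \<le> s'\<^sup>2 / 2"
          using s'_ge \<epsilon> h by (intro divide_right_mono power_mono) auto
        have "1 / \<epsilon> * (1 - survival s') \<le> 1 / \<epsilon> * \<epsilon>\<^sup>2"
          using surv \<epsilon> by (intro mult_left_mono) auto
        also have "\<dots> = \<epsilon>" using \<epsilon> by (simp add: power2_eq_square)
        finally show "2 - 49 * \<epsilon> \<le> 2 - ?q" by simp
      qed (use \<epsilon> in auto)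
      \<comment> \<open>To first order the factor is \<open>1 - 61 / 2 * \<epsilon>\<close>.
        Rounding \<open>61 / 2\<close> up to 31 leaves \<open>\<epsilon> / 2\<close> to spare, and
        the terms of higher order are together nonnegative for small
        \<open>\<epsilon>\<close>.\<close>
      moreover have "(1 - 31 * \<epsilon>) * h\<^sup>2 \<le> ((1 - 3 * \<epsilon>) * h)\<^sup>2 / 2 * (2 - 49 * \<epsilon>)"
      proof -
        have "\<epsilon> * \<epsilon> * (441 / 2 * \<epsilon>) \<le> \<epsilon> * \<epsilon> * 156" using \<epsilon> by (intro mult_left_mono) auto
        moreover have "(1 - 3 * \<epsilon>)\<^sup>2 / 2 * (2 - 49 * \<epsilon>) =
            (1 - 31 * \<epsilon>) + \<epsilon> / 2 + (\<epsilon> * \<epsilon> * 156 - \<epsilon> * \<epsilon> * (441 / 2 * \<epsilon>))"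
          by (simp add: power2_eq_square field_simps)
        ultimately have "1 - 31 * \<epsilon> \<le> (1 - 3 * \<epsilon>)\<^sup>2 / 2 * (2 - 49 * \<epsilon>)"
          using \<epsilon> by linarith
        then have "(1 - 31 * \<epsilon>) * h\<^sup>2 \<le> (1 - 3 * \<epsilon>)\<^sup>2 / 2 * (2 - 49 * \<epsilon>) * h\<^sup>2"
          by (intro mult_right_mono) auto
        also have "\<dots> = ((1 - 3 * \<epsilon>) * h)\<^sup>2 / 2 * (2 - 49 * \<epsilon>)"
          unfolding power_mult_distrib by simp
        finally show ?thesis .
      qed
      ultimately show "(1 - 31 * \<epsilon>) * h\<^sup>2 \<le> \<kappa> e" by linarith
    qed
    have "J_ET M G v c' 1 = (\<Sum>e\<in>parcs G. ennreal (\<kappa> e / (2 * m)))"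
      unfolding J_ET_eq[OF G fin]
    proof (intro sum.cong refl)
      fix e assume e: "e \<in> parcs G"
      have "ennreal (1 / 2) * (ennreal (\<kappa> e) / ennreal m) = ennreal (1 / 2) * ennreal (\<kappa> e / m)"
        using \<kappa>(2)[OF e] m_pos by (simp only: divide_ennreal)
      also have "\<dots> = ennreal (1 / 2 * (\<kappa> e / m))"
        using \<kappa>(2)[OF e] m_pos by (intro ennreal_mult[symmetric]) auto
      finally show "(case e of (i, j) \<Rightarrow> ennreal (1 / 2) * (cycle_mean square_rate i j / mean_T_ET M I v 1)) =
          ennreal (\<kappa> e / (2 * m))"
        unfolding case_prod_beta \<kappa>(1)[OF e, unfolded case_prod_beta] m(1) by simp
    qed
    also have "\<dots> = ennreal (\<Sum>e\<in>parcs G. \<kappa> e / (2 * m))"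
      using \<kappa>(2) m_pos by (intro sum_ennreal) auto
    finally have J: "enn2real (J_ET M G v c' 1) = (\<Sum>e\<in>parcs G. \<kappa> e / (2 * m))"
      using \<kappa>(2) m_pos by (simp add: sum_nonneg)
    \<comment> \<open>The numerator is known up to the factors \<open>1 - 31 * \<epsilon>\<close>
      and \<open>1 + 7 * \<epsilon>\<close>, the mean length up to \<open>1 - 4 * \<epsilon>\<close>
      and \<open>1 + 2 * \<epsilon>\<close>; the constant 40 leaves room for the second-order terms
      of the quotient.\<close>
    have each: "\<bar>\<kappa> e / (2 * m) - h / 2\<bar> \<le> 40 * \<epsilon> * (h / 2)" if e: "e \<in> parcs G" for e
    proof -
      have \<epsilon>2: "\<epsilon> * \<epsilon> \<le> \<epsilon> * (1 / 31)" "0 \<le> \<epsilon> * \<epsilon>" using \<epsilon> by (auto intro!: mult_left_mono)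
      have "\<kappa> e \<le> (1 + 40 * \<epsilon>) * (1 - 4 * \<epsilon>) * (h * h)"
      proof -
        have "1 + 7 * \<epsilon> \<le> (1 + 40 * \<epsilon>) * (1 - 4 * \<epsilon>)" using \<epsilon>2 \<epsilon> by (simp add: algebra_simps)
        then have "(1 + 7 * \<epsilon>) * h\<^sup>2 \<le> (1 + 40 * \<epsilon>) * (1 - 4 * \<epsilon>) * h\<^sup>2" by (intro mult_right_mono) auto
        then show ?thesis using \<kappa>(4)[OF e] by (simp add: power2_eq_square)
      qed
      also have "\<dots> = ((1 + 40 * \<epsilon>) * h) * ((1 - 4 * \<epsilon>) * h)" by simp
      also have "\<dots> \<le> ((1 + 40 * \<epsilon>) * h) * m" using \<epsilon> h by (intro mult_left_mono m_low) auto
      finally have upper: "\<kappa> e / (2 * m) \<le> (1 + 40 * \<epsilon>) * (h / 2)"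
        using m_pos by (simp add: pos_divide_le_eq)
      have lower: "(1 - 40 * \<epsilon>) * (h / 2) \<le> \<kappa> e / (2 * m)"
      proof (cases "0 \<le> 1 - 40 * \<epsilon>")
        case True
        have "((1 - 40 * \<epsilon>) * h) * m \<le> ((1 - 40 * \<epsilon>) * h) * ((1 + 2 * \<epsilon>) * h)"
          using True h by (intro mult_left_mono m_up) auto
        also have "\<dots> = (1 - 40 * \<epsilon>) * (1 + 2 * \<epsilon>) * h\<^sup>2" by (simp add: power2_eq_square)
        also have "\<dots> \<le> (1 - 31 * \<epsilon>) * h\<^sup>2"
          using \<epsilon>2 \<epsilon> by (intro mult_right_mono) (auto simp: algebra_simps)
        also have "\<dots> \<le> \<kappa> e" by (rule \<kappa>(3)[OF e])
        finally show ?thesis using m_pos by (simp add: pos_le_divide_eq)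
      next
        case False
        then have "(1 - 40 * \<epsilon>) * (h / 2) \<le> 0" using h by (intro mult_nonpos_nonneg) auto
        also have "0 \<le> \<kappa> e / (2 * m)" using \<kappa>(2)[OF e] m_pos by simp
        finally show ?thesis .
      qed
      show ?thesis using upper lower by (simp add: algebra_simps abs_le_iff)
    qed
    have "enn2real (J_ET M G v c' 1) - g = (\<Sum>e\<in>parcs G. \<kappa> e / (2 * m) - h / 2)"
      unfolding J by (simp add: sum_subtractf g_def)
    also have "\<bar>\<dots>\<bar> \<le> (\<Sum>e\<in>parcs G. \<bar>\<kappa> e / (2 * m) - h / 2\<bar>)" by (rule sum_abs)
    also have "\<dots> \<le> (\<Sum>e\<in>parcs G. 40 * \<epsilon> * (h / 2))" by (intro sum_mono each)
    also have "\<dots> = 40 * \<epsilon> * g" by (simp add: g_def)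
    finally show ?thesis .
  qed
qed

end

lemma asymp_equiv_relative_errorI:
  fixes f g :: "nat \<Rightarrow> real"
  assumes "0 < \<epsilon>0" "0 < C"
    and "\<And>\<epsilon>. 0 < \<epsilon> \<Longrightarrow> \<epsilon> < \<epsilon>0 \<Longrightarrow> \<forall>\<^sub>F N in sequentially. \<bar>f N - g N\<bar> \<le> C * \<epsilon> * \<bar>g N\<bar>"
  shows "f \<sim>[sequentially] g"
  unfolding asymp_equiv_altdef
proof (rule landau_o.smallI)
  fix c :: real assume c: "0 < c"
  define \<epsilon> where "\<epsilon> = min (\<epsilon>0 / 2) (c / C)"
  have \<epsilon>: "0 < \<epsilon>" "\<epsilon> < \<epsilon>0" "C * \<epsilon> \<le> c"
  proof -
    show "0 < \<epsilon>" "\<epsilon> < \<epsilon>0" using assms(1,2) c by (auto simp: \<epsilon>_def)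
    have "C * \<epsilon> \<le> C * (c / C)" using assms(2) by (intro mult_left_mono) (auto simp: \<epsilon>_def)
    then show "C * \<epsilon> \<le> c" using assms(2) by simp
  qed
  show "\<forall>\<^sub>F N in sequentially. norm (f N - g N) \<le> c * norm (g N)"
    using assms(3)[OF \<epsilon>(1,2)]
  proof eventually_elim
    case (elim N)
    also have "C * \<epsilon> * \<bar>g N\<bar> \<le> c * \<bar>g N\<bar>" using \<epsilon>(3) by (intro mult_right_mono) auto
    finally show ?case by simp
  qed
qed

theorem corollary1:
  fixes M :: "nat \<Rightarrow> 'a measure"
    and v :: "nat \<Rightarrow> nat \<Rightarrow> real \<Rightarrow> 'a \<Rightarrow> real"
    and G :: "nat \<Rightarrow> nat pair_pre_digraph"
    and c_ET c_TT :: "nat \<Rightarrow> nat \<Rightarrow> 'a \<Rightarrow> real"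
  assumes graph: "\<And>N. N \<ge> 2 \<Longrightarrow> pair_graph (G N)"
    and nodes: "\<And>N. N \<ge> 2 \<Longrightarrow> pverts (G N) = {1..N}"
    and connected: "\<And>N. N \<ge> 2 \<Longrightarrow> Digraph_Component.connected (with_proj (G N))"
    and noise: "\<And>N. N \<ge> 2 \<Longrightarrow> independent_brownian_motions (M N) {1..N} (v N)"
  shows
    "(\<lambda>N. enn2real (J_ET (M N) (G N) (v N) (c_ET N) 1))
       \<sim>[sequentially]
     (\<lambda>N. enn2real (J_TT (M N) (G N) (v N) (c_TT N) (enn2real (mean_T_ET (M N) {1..N} (v N) 1))))
     \<and>
     (\<lambda>N. enn2real (J_TT (M N) (G N) (v N) (c_TT N) (enn2real (mean_T_ET (M N) {1..N} (v N) 1))))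
       \<sim>[sequentially]
     (\<lambda>N. real (card (parcs (G N))) / (4 * ln (real N)))"
proof -
  let ?g = "\<lambda>N. real (card (parcs (G N))) / (4 * ln (real N))"
  let ?ET = "\<lambda>N. enn2real (J_ET (M N) (G N) (v N) (c_ET N) 1)"
  let ?TT = "\<lambda>N. enn2real (J_TT (M N) (G N) (v N) (c_TT N) (enn2real (mean_T_ET (M N) {1..N} (v N) 1)))"
  have window: "\<forall>\<^sub>F N in sequentially. \<bar>?TT N - ?g N\<bar> \<le> 40 * \<epsilon> * \<bar>?g N\<bar> \<and> \<bar>?ET N - ?g N\<bar> \<le> 40 * \<epsilon> * \<bar>?g N\<bar>"
    if \<epsilon>: "0 < \<epsilon>" "\<epsilon> < 1 / 31" for \<epsilon>
  proof -
    \<comment> \<open>This is the union bound for an exit by time \<open>s'\<close>, of order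
      \<open>N\<close> to the power \<open>- \<epsilon>\<close>.\<close>
    have "\<forall>\<^sub>F N :: nat in sequentially. 4 * real N * real N powr (- (1 + \<epsilon>)) \<le> \<epsilon>\<^sup>2"
      using \<epsilon>(1) by real_asymp
    \<comment> \<open>Ensures \<open>h \<le> 1 / 2\<close>, which keeps the time \<open>s\<close> in
      \<open>cost_window\<close> below 1.\<close>
    moreover have "\<forall>\<^sub>F N :: nat in sequentially. 1 \<le> ln (real N)" by real_asymp
    ultimately show ?thesis using eventually_tail_small[OF \<epsilon>(1)] eventually_ge_at_top[of 2]
    proof eventually_elim
      case (elim N)
      note noise' = noise[OF elim(4), unfolded independent_brownian_motions_def]
      interpret brownian_family "M N" "{1..N}" "v N"
      proof (intro brownian_family.intro brownian_family_axioms.intro)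
        show "{1..N} \<noteq> {}" using elim(4) by simp
      qed (use noise' in blast)+
      define h where "h = 1 / (2 * ln (real N))"
      have h: "0 < h" "h \<le> 1 / 2" using elim(2) by (auto simp: h_def field_simps)
      have tail: "survival_tail ((1 + \<epsilon>) * h) \<le> \<epsilon> * h\<^sup>2"
        using elim(3) unfolding survival_tail_def h_def Let_def by simp
      have early: "4 * real (card {1..N}) * exp (- (1 + \<epsilon>) / (2 * h)) \<le> \<epsilon>\<^sup>2"
        using elim(1,2,4) by (simp add: h_def powr_def mult.commute)
      have g: "real (card (parcs (G N))) * h / 2 = ?g N" by (simp add: h_def)
      have "0 \<le> ?g N" using elim(2) by simp
      show ?case
        using cost_window[OF graph[OF elim(4)] nodes[OF elim(4)] \<epsilon> h tail early]
        unfolding g abs_of_nonneg[OF \<open>0 \<le> ?g N\<close>] by blast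
    qed
  qed
  have ET: "?ET \<sim>[sequentially] ?g"
    by (rule asymp_equiv_relative_errorI[of "1 / 31" 40]) (use window in \<open>simp_all add: eventually_conj_iff\<close>)
  have TT: "?TT \<sim>[sequentially] ?g"
    by (rule asymp_equiv_relative_errorI[of "1 / 31" 40]) (use window in \<open>simp_all add: eventually_conj_iff\<close>)
  show ?thesis
    using asymp_equiv_trans[OF ET asymp_equiv_symI[OF TT]] TT by (rule conjI)
qed

end
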